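(* Let $\kappa,p\in\mathbb R$ and set $\gamma_*:=\frac{|\kappa|}{2S+1}$. Let $\rho(t)$, $t\ge 0$, be the solution on the spin-$S$ Hilbert space of the Lindblad equation $$\frac{\partial\rho}{\partial t}=-i[\hat H_{\mathrm{KT}}(t),\rho]-\frac{\gamma}{2}\sum_{\mu=x,y,z}[\hat S_\mu,[\hat S_\mu,\rho]],\qquad \hat H_{\mathrm{KT}}(t)=\frac{\kappa}{2S+1}\hat S_x^2+\sum_{n=1}^\infty p\,\delta(t-n)\hat S_z ,$$ starting in a spin coherent state $\rho(0)=|\Omega_0\rangle\langle\Omega_0|$. If $\gamma\ge\gamma_*$, then the dynamics remain a positive mixture of coherent states, $$\rho(t)=\int d\Omega\,P(\Omega,t)\,|\Omega\rangle\langle\Omega|,\qquad P(\Omega,t)\ge 0,$$ where the integral is taken over the sphere. Furthermore, the differential equation governing the evolution of $P$ matches the classical Fokker--Planck equation $$\frac{\partial f}{\partial t}=\{H_{\mathrm{KT}}(t),f\}+\frac{\gamma}{2}\sum_{\mu=x,y,z}\{S_\mu,\{S_\mu,f\}\},\qquad H_{\mathrm{KT}}(t)=\frac{\kappa}{2S}S_x^2+\sum_{n=1}^\infty p\,S_z\,\delta(t-n),$$ up to a relative error $O(1/S)$ in the Hamiltonian terms and $O(\gamma_*/\gamma)$ in the dissipator (the term proportional to $\gamma$).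
   Context: $S$ is a positive integer or half-integer, and $\hat S_x,\hat S_y,\hat S_z$ are the spin operators ($\hbar=1$, $[\hat S_\mu,\hat S_\nu]=i\sum_\lambda\epsilon_{\mu\nu\lambda}\hat S_\lambda$) of the spin-$S$ irreducible representation of $\mathrm{SU}(2)$, of dimension $2S+1$. For a unit vector $\Omega=(\Omega_x,\Omega_y,\Omega_z)\in\mathbb S^2$ with polar angles $(\theta,\varphi)$, the spin coherent state $|\Omega\rangle$ is the normalized eigenvector of $\sum_\mu\Omega_\mu\hat S_\mu$ with eigenvalue $S$. The measure is $d\Omega=\frac{2S+1}{4\pi}\sin\theta\,d\theta\,d\varphi$, so that $\int d\Omega\,|\Omega\rangle\langle\Omega|=\mathbb 1$. A delta function $\delta(t-n)$ in a Hamiltonian means an instantaneous kick at time $n$: quantum mechanically, conjugation by $e^{-ip\hat S_z}$; classically, the time-one flow generated by $p\,S_z$. Classical variables: $\bm S=(S_x,S_y,S_z)$ with $S_\mu(\Omega)=S\Omega_\mu$, and functions on the sphere have the Poisson bracket $\{f,g\}=\bm S\cdot\left(\frac{\partial f}{\partial\bm S}\times\frac{\partial g}{\partial\bm S}\right)$, so that $\{S_\mu,S_\nu\}=\sum_\lambda\epsilon_{\mu\nu\lambda}S_\lambda$. The function $P(\Omega,t)$ is the Glauber--Sudarshan quasiprobability distribution of the spin; any state can be represented in this form, but in general $P$ need not be positive and may be singular (a generalized function); e.g. at $t=0$ it is a delta distribution at $\Omega_0$. *)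

theory Defs
  imports "HOL-Analysis.Analysis" "HOL-Probability.Giry_Monad"
    "Jordan_Normal_Form.Schur_Decomposition"
begin

no_notation vec_index (infixl "$" 100)
no_notation scalar_prod (infix "\<bullet>" 70)

text \<open>
  The spin is encoded by the natural number \<open>N = 2 S\<close>, so that positive integers and
  half-integers \<open>S\<close> correspond to \<open>N \<ge> 1\<close>, and the Hilbert space is \<open>\<complex>\<close> to the power \<open>N + 1\<close>.
  Cartesian indices \<open>x, y, z\<close> are the elements \<open>1, 2, 3\<close> of the index type \<^typ>\<open>3\<close>.
\<close>

definition spin :: "nat \<Rightarrow> real" where
  "spin N = real N / 2"

definition gamma_star :: "nat \<Rightarrow> real \<Rightarrow> real" where
  "gamma_star N \<kappa> = \<bar>\<kappa>\<bar> / (2 * spin N + 1)"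

text \<open>The basis vector with index \<open>j\<close> is the state of magnetic quantum number \<open>S - j\<close>.\<close>

definition spin_raise :: "nat \<Rightarrow> complex mat" where
  "spin_raise N = Matrix.mat (N + 1) (N + 1) (\<lambda>(i, j).
     if Suc i = j
     then let m = spin N - real j
          in complex_of_real (sqrt (spin N * (spin N + 1) - m * (m + 1)))
     else 0)"

definition spin_lower :: "nat \<Rightarrow> complex mat" where
  "spin_lower N = mat_adjoint (spin_raise N)"

definition spin_op :: "nat \<Rightarrow> 3 \<Rightarrow> complex mat" where
  "spin_op N \<mu> =
     (if \<mu> = 1 then (1 / 2) \<cdot>\<^sub>m (spin_raise N + spin_lower N)
      else if \<mu> = 2 then (1 / (2 * \<i>)) \<cdot>\<^sub>m (spin_raise N - spin_lower N)
      else Matrix.mat (N + 1) (N + 1)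
             (\<lambda>(i, j). if i = j then complex_of_real (spin N - real j) else 0))"

definition commutator :: "complex mat \<Rightarrow> complex mat \<Rightarrow> complex mat" where
  "commutator A B = A * B - B * A"

definition is_coherent :: "nat \<Rightarrow> real^3 \<Rightarrow> complex Matrix.vec \<Rightarrow> bool" where
  "is_coherent N \<Omega> v \<longleftrightarrow>
     v \<in> carrier_vec (N + 1) \<and> v \<bullet>c v = 1 \<and>
     (complex_of_real (\<Omega> $ 1) \<cdot>\<^sub>m spin_op N 1 + complex_of_real (\<Omega> $ 2) \<cdot>\<^sub>m spin_op N 2
        + complex_of_real (\<Omega> $ 3) \<cdot>\<^sub>m spin_op N 3) *\<^sub>v v = complex_of_real (spin N) \<cdot>\<^sub>v v"

text \<open>The coherent state is unique up to a phase, which drops out of the projector.\<close>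

definition coherent :: "nat \<Rightarrow> real^3 \<Rightarrow> complex Matrix.vec" where
  "coherent N \<Omega> = (SOME v. is_coherent N \<Omega> v)"

definition coherent_proj :: "nat \<Rightarrow> real^3 \<Rightarrow> complex mat" where
  "coherent_proj N \<Omega> = Matrix.mat (N + 1) (N + 1)
     (\<lambda>(i, j). vec_index (coherent N \<Omega>) i * cnj (vec_index (coherent N \<Omega>) j))"

definition mat_exp :: "complex mat \<Rightarrow> complex mat" where
  "mat_exp A = Matrix.mat (dim_row A) (dim_row A)
     (\<lambda>(i, j). \<Sum>k. (A ^\<^sub>m k) $$ (i, j) / fact k)"

definition lindblad_rhs :: "nat \<Rightarrow> real \<Rightarrow> real \<Rightarrow> complex mat \<Rightarrow> complex mat" where
  "lindblad_rhs N \<kappa> \<gamma> \<rho> =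
     (- \<i>) \<cdot>\<^sub>m commutator
        (complex_of_real (\<kappa> / (2 * spin N + 1)) \<cdot>\<^sub>m (spin_op N 1 * spin_op N 1)) \<rho>
     - complex_of_real (\<gamma> / 2) \<cdot>\<^sub>m
        (commutator (spin_op N 1) (commutator (spin_op N 1) \<rho>)
         + commutator (spin_op N 2) (commutator (spin_op N 2) \<rho>)
         + commutator (spin_op N 3) (commutator (spin_op N 3) \<rho>))"

definition kick_unitary :: "nat \<Rightarrow> real \<Rightarrow> complex mat" where
  "kick_unitary N p = mat_exp ((- \<i> * complex_of_real p) \<cdot>\<^sub>m spin_op N 3)"

text \<open>
  \<open>\<rho> t\<close> is right-continuous: \<open>\<rho> n\<close> is the state just after the kick at the time \<open>n \<ge> 1\<close>,
  and \<open>\<sigma>\<close> is the state just before it.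
\<close>

definition lindblad_solution :: "nat \<Rightarrow> real \<Rightarrow> real \<Rightarrow> real \<Rightarrow> (real \<Rightarrow> complex mat) \<Rightarrow> bool" where
  "lindblad_solution N \<kappa> p \<gamma> \<rho> \<longleftrightarrow>
     (\<forall>t\<ge>0. \<rho> t \<in> carrier_mat (N + 1) (N + 1)) \<and>
     (\<forall>n::nat. \<forall>t\<in>{real n..<real n + 1}. \<forall>i\<le>N. \<forall>j\<le>N.
        ((\<lambda>s. \<rho> s $$ (i, j)) has_vector_derivative lindblad_rhs N \<kappa> \<gamma> (\<rho> t) $$ (i, j))
          (at t within {real n..<real n + 1})) \<and>
     (\<forall>n::nat. n \<ge> 1 \<longrightarrow> (\<exists>\<sigma>\<in>carrier_mat (N + 1) (N + 1).
        (\<forall>i\<le>N. \<forall>j\<le>N. ((\<lambda>s. \<rho> s $$ (i, j)) \<longlongrightarrow> \<sigma> $$ (i, j)) (at_left (real n))) \<and>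
        \<rho> (real n) = kick_unitary N p * \<sigma> * mat_adjoint (kick_unitary N p)))"

abbreviation unit_sphere :: "(real^3) measure" where
  "unit_sphere \<equiv> restrict_space borel (sphere 0 1)"

text \<open>
  A (possibly singular) nonnegative \<open>P(\<Omega>)\<close> is represented by the measure \<open>P(\<Omega>) d\<Omega>\<close>.
\<close>

definition positive_distribution :: "(real^3) measure \<Rightarrow> bool" where
  "positive_distribution P \<longleftrightarrow> finite_measure P \<and> sets P = sets unit_sphere"

definition coherent_mixture :: "nat \<Rightarrow> (real^3) measure \<Rightarrow> complex mat" where
  "coherent_mixture N P = Matrix.mat (N + 1) (N + 1)
     (\<lambda>(i, j). \<integral>\<Omega>. coherent_proj N \<Omega> $$ (i, j) \<partial>P)"

definition dOmega :: "nat \<Rightarrow> (real^3) measure" where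
  "dOmega N = distr
     (density (lborel \<Otimes>\<^sub>M lborel)
        (\<lambda>(\<theta>, \<phi>). ennreal (indicator ({0..pi} \<times> {0..2 * pi}) (\<theta>, \<phi>)
            * ((2 * spin N + 1) / (4 * pi)) * sin \<theta>)))
     unit_sphere
     (\<lambda>(\<theta>, \<phi>). vector [sin \<theta> * cos \<phi>, sin \<theta> * sin \<phi>, cos \<theta>])"

text \<open>
  Classical observables are functions of the spin vector \<open>S \<Omega>\<close>, extended to a neighbourhood in
  \<open>\<real>\<close>-three-space; the Poisson bracket at a point of the sphere of radius \<open>S\<close> depends only on
  the restrictions of its arguments to that sphere.
\<close>

definition partial :: "3 \<Rightarrow> (real^3 \<Rightarrow> real) \<Rightarrow> real^3 \<Rightarrow> real" where
  "partial \<mu> f x = frechet_derivative f (at x) (axis \<mu> 1)"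

primrec C_diff :: "nat \<Rightarrow> (real^3 \<Rightarrow> real) \<Rightarrow> bool" where
  "C_diff 0 f \<longleftrightarrow> continuous_on UNIV f"
| "C_diff (Suc k) f \<longleftrightarrow> (\<forall>x. f differentiable (at x)) \<and> (\<forall>\<mu>. C_diff k (partial \<mu> f))"

definition smooth :: "(real^3 \<Rightarrow> real) \<Rightarrow> bool" where
  "smooth f \<longleftrightarrow> (\<forall>k. C_diff k f)"

definition poisson :: "(real^3 \<Rightarrow> real) \<Rightarrow> (real^3 \<Rightarrow> real) \<Rightarrow> real^3 \<Rightarrow> real" where
  "poisson f g x = x \<bullet> cross3 (\<chi> \<mu>. partial \<mu> f x) (\<chi> \<mu>. partial \<mu> g x)"

definition classical_spin :: "3 \<Rightarrow> real^3 \<Rightarrow> real" where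
  "classical_spin \<mu> x = x $ \<mu>"

definition H_twist :: "nat \<Rightarrow> real \<Rightarrow> real^3 \<Rightarrow> real" where
  "H_twist N \<kappa> x = \<kappa> / (2 * spin N) * (classical_spin 1 x)\<^sup>2"

definition H_kick :: "real \<Rightarrow> real^3 \<Rightarrow> real" where
  "H_kick p x = p * classical_spin 3 x"

definition hamiltonian_orbit :: "(real^3 \<Rightarrow> real) \<Rightarrow> (real \<Rightarrow> real^3) \<Rightarrow> bool" where
  "hamiltonian_orbit H c \<longleftrightarrow>
     (\<forall>s. (c has_vector_derivative (\<chi> \<mu>. poisson (classical_spin \<mu>) H (c s))) (at s))"

definition time_one_flow :: "(real^3 \<Rightarrow> real) \<Rightarrow> real^3 \<Rightarrow> real^3" where
  "time_one_flow H x = (THE y. \<exists>c. hamiltonian_orbit H c \<and> c 0 = x \<and> c 1 = y)"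

text \<open>
  The right-hand side, away from the kicks, of a Fokker--Planck equation whose Hamiltonian term
  deviates from that of the classical kicked top by the relative error \<open>\<epsilon>\<close> and whose dissipator
  deviates by the matrix \<open>E\<close> of relative errors; \<open>\<epsilon> = 0\<close>, \<open>E = 0\<close> is the classical equation.
\<close>

definition fp_rhs ::
  "nat \<Rightarrow> real \<Rightarrow> real \<Rightarrow> real \<Rightarrow> (3 \<Rightarrow> 3 \<Rightarrow> real^3 \<Rightarrow> real) \<Rightarrow> (real^3 \<Rightarrow> real) \<Rightarrow> real^3 \<Rightarrow> real"
  where
  "fp_rhs N \<kappa> \<gamma> \<epsilon> E f x =
     (1 + \<epsilon>) * poisson (H_twist N \<kappa>) f x
     + \<gamma> / 2 * (\<Sum>\<mu>\<in>UNIV. \<Sum>\<nu>\<in>UNIV. ((if \<mu> = \<nu> then 1 else 0) + E \<mu> \<nu> x)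
         * poisson (classical_spin \<mu>) (poisson (classical_spin \<nu>) f) x)"

text \<open>
  \<open>A\<close> is the adjoint of \<open>L\<close> on smooth functions on the sphere, with respect to \<open>d\<Omega>\<close>;
  continuity makes \<open>A g\<close> unique on the sphere of radius \<open>S\<close>.
\<close>

definition formal_adjoint ::
  "nat \<Rightarrow> ((real^3 \<Rightarrow> real) \<Rightarrow> real^3 \<Rightarrow> real) \<Rightarrow> ((real^3 \<Rightarrow> real) \<Rightarrow> real^3 \<Rightarrow> real) \<Rightarrow> bool"
  where
  "formal_adjoint N L A \<longleftrightarrow>
     (\<forall>g. smooth g \<longrightarrow> continuous_on (sphere 0 (spin N)) (A g) \<and>
       (\<forall>f. smooth f \<longrightarrow>
          (\<integral>\<Omega>. L f (spin N *\<^sub>R \<Omega>) * g (spin N *\<^sub>R \<Omega>) \<partial>dOmega N) =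
          (\<integral>\<Omega>. f (spin N *\<^sub>R \<Omega>) * A g (spin N *\<^sub>R \<Omega>) \<partial>dOmega N)))"

text \<open>
  Weak form, tested against all smooth functions on the sphere, of the evolution equation with
  right-hand side \<open>L\<close> between the kicks and the time-one flow of \<open>K\<close> at each integer time
  \<open>n \<ge> 1\<close>: there the distributions just before the kick, transported by the flow, converge weakly
  to \<open>P n\<close>.
\<close>

definition weak_solution ::
  "nat \<Rightarrow> ((real^3 \<Rightarrow> real) \<Rightarrow> real^3 \<Rightarrow> real) \<Rightarrow> (real^3 \<Rightarrow> real) \<Rightarrow> (real \<Rightarrow> (real^3) measure) \<Rightarrow> bool"
  where
  "weak_solution N L K P \<longleftrightarrow>
     (\<exists>A. formal_adjoint N L A \<and>
       (\<forall>g. smooth g \<longrightarrow>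
         (\<forall>n::nat. \<forall>t\<in>{real n..<real n + 1}.
            ((\<lambda>s. \<integral>\<Omega>. g (spin N *\<^sub>R \<Omega>) \<partial>P s) has_real_derivative
               (\<integral>\<Omega>. A g (spin N *\<^sub>R \<Omega>) \<partial>P t)) (at t within {real n..<real n + 1})))) \<and>
     (\<forall>g. smooth g \<longrightarrow>
       (\<forall>n::nat. n \<ge> 1 \<longrightarrow>
          ((\<lambda>s. \<integral>\<Omega>. g (time_one_flow K (spin N *\<^sub>R \<Omega>)) \<partial>P s) \<longlongrightarrow>
             (\<integral>\<Omega>. g (spin N *\<^sub>R \<Omega>) \<partial>P (real n))) (at_left (real n))))"

end

theory Submission
  imports Defs "HOL-Probability.Probability"
begin

text \<open>
  Write \<open>c = \<kappa> / (2 S + 1)\<close> and \<open>X\<^sub>\<mu> = {S\<^sub>\<mu>, \<cdot>}\<close>. On coherent projectors the commutators with the spin operators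
  are the rotation fields \<open>X\<^sub>\<mu>\<close> up to a factor \<open>\<i>\<close>, and the raising operators along \<open>\<Omega>\<close> annihilate \<open>|\<Omega>\<rangle>\<close>, so that the
  anticommutator with \<open>S\<^sub>x\<close> is multiplication by \<open>2 S \<Omega>\<^sub>x\<close> plus the gradient field \<open>\<Omega>\<^sub>y X\<^sub>z - \<Omega>\<^sub>z X\<^sub>y\<close>. The
  Lindblad generator therefore acts on \<open>|\<Omega>\<rangle>\<langle>\<Omega>|\<close> as a real second-order operator \<open>B\<close> in \<open>\<Omega>\<close>. Its diffusion
  matrix has the eigenvalues \<open>\<gamma> \<plusminus> c (1 - \<Omega>\<^sub>x\<^sup>2)\<close> on the tangent plane, hence is positive semidefinite if
  \<open>\<gamma> \<ge> \<bar>c\<bar>\<close>, even though it may degenerate. Then \<open>B\<close> is approximated by the steps of a random walk on the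
  sphere, and a weak limit of the walks started in \<open>\<Omega>\<^sub>0\<close> solves the Fokker--Planck equation with the
  adjoint of \<open>B\<close> in the weak sense. Its mixture of coherent states solves the Lindblad equation, whose
  solution is unique. The kicks rotate both sides in the same way.

  Integration by parts turns \<open>B\<close> into the classical generator with the Hamiltonian term scaled by
  \<open>(2 S + 5 / 2) / (2 S + 1)\<close> and with off-diagonal errors \<open>\<plusminus> (c / \<gamma>) \<Omega>\<^sub>\<nu>\<close> in the dissipator. The second-order
  terms are kept symmetric in the two rotation fields throughout, so that second partial derivatives
  never have to be interchanged.
\<close>

section \<open>Weak compactness through a space-filling curve\<close>

text \<open>Two obstacles shape the proof. At the threshold the diffusion degenerates, and the
  initial distribution is a point mass, so there is neither a smooth density nor an elliptic
  equation to solve; the evolution is therefore treated with measures and test functions, and the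
  walk makes positivity automatic. Moreover, the limit is obtained by compactness alone. The choice
  among possible limits is immaterial, because the mixture of coherent states of any of them solves
  a linear system with finitely many unknowns. Compactness itself is reduced to distribution
  functions on the line.

  The factor (2 S + 5 / 2) / (2 S + 1) has two sources. The two orders of commutator and
  anticommutator give the backward twist the coefficients 2 S and 2 S - 1, with mean 2 S - 1 / 2.
  Integration by parts adds 3, since derivatives fall on the coefficients \<Omega>_y and \<Omega>_z.
  The classical coefficient is \<kappa> = (2 S + 1) c.\<close>

definition clipped_cos :: "real \<Rightarrow> real" where
  "clipped_cos t = max 0 (min 1 (1 / 2 - cos (pi * t)))"

text \<open>Coordinate \<open>l\<close> of Schoenberg's curve, with infinitely many coordinates so
  that every dimension can be read off. \<open>clipped_cos\<close> is even, has period 2, vanishes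
  on [0, 1/3] and equals 1 on [2/3, 1]; it thus reads a leading ternary digit 0 or 2 as 0 or 1.
  \<open>prod_encode\<close> deals out the ternary places to the pairs of a binary place and a
  coordinate.\<close>

definition schoenberg :: "nat \<Rightarrow> real \<Rightarrow> real" where
  "schoenberg l t = (\<Sum>k. clipped_cos (3 ^ prod_encode (k, l) * t) / 2 ^ Suc k)"

definition bin_digit :: "nat \<Rightarrow> real \<Rightarrow> real" where
  "bin_digit k y = real_of_int \<lfloor>2 ^ Suc k * y\<rfloor> - 2 * real_of_int \<lfloor>2 ^ k * y\<rfloor>"

text \<open>The point of the Cantor set in which the binary digits of all coordinates are
  interleaved: a right inverse of the curve, built from floors and hence Borel but not
  continuous.\<close>

definition cantor_code :: "(nat \<Rightarrow> real) \<Rightarrow> real" where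
  "cantor_code y = (\<Sum>m. 2 * bin_digit (fst (prod_decode m)) (y (snd (prod_decode m))) / 3 ^ Suc m)"

lemma clipped_cos_bounds: "0 \<le> clipped_cos t" "clipped_cos t \<le> 1"
  by (auto simp: clipped_cos_def)

lemma summable_over_pow2: "summable (\<lambda>k. 1 / 2 ^ Suc k :: real)"
  using sums_summable[OF power_half_series] by (simp add: power_divide)

lemma continuous_schoenberg: "continuous_on UNIV (schoenberg l)"
proof -
  have "uniform_limit UNIV (\<lambda>n t. \<Sum>k<n. clipped_cos (3 ^ prod_encode (k, l) * t) / 2 ^ Suc k)
      (\<lambda>t. \<Sum>k. clipped_cos (3 ^ prod_encode (k, l) * t) / 2 ^ Suc k) sequentially"
    by (rule Weierstrass_m_test[OF _ summable_over_pow2])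
      (simp add: clipped_cos_bounds divide_right_mono del: power_Suc)
  then show ?thesis
    unfolding schoenberg_def
    by (rule uniform_limit_theorem[rotated])
      (auto intro!: always_eventually continuous_intros simp: clipped_cos_def)
qed

lemma schoenberg_bounds: "0 \<le> schoenberg l t" "schoenberg l t \<le> 1"
proof -
  have s: "summable (\<lambda>k. clipped_cos (3 ^ prod_encode (k, l) * t) / 2 ^ Suc k)"
    by (rule summable_comparison_test'[OF summable_over_pow2, of 0])
      (simp add: clipped_cos_bounds divide_right_mono del: power_Suc)
  show "0 \<le> schoenberg l t"
    unfolding schoenberg_def by (rule suminf_nonneg[OF s]) (simp add: clipped_cos_bounds)
  have "schoenberg l t \<le> (\<Sum>k. 1 / 2 ^ Suc k)"
    unfolding schoenberg_def
    by (rule suminf_le[OF _ s summable_over_pow2])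
      (simp add: clipped_cos_bounds divide_right_mono del: power_Suc)
  also have "\<dots> = 1"
    using sums_unique[OF power_half_series] by (simp add: power_divide)
  finally show "schoenberg l t \<le> 1" .
qed

lemma bin_digit_cases: "bin_digit k y = 0 \<or> bin_digit k y = 1"
proof -
  have "2 * \<lfloor>2 ^ k * y\<rfloor> \<le> \<lfloor>2 ^ Suc k * y\<rfloor>" "\<lfloor>2 ^ Suc k * y\<rfloor> < 2 * \<lfloor>2 ^ k * y\<rfloor> + 2"
    by (simp_all add: le_floor_iff floor_less_iff) linarith+
  then have "\<lfloor>2 ^ Suc k * y\<rfloor> = 2 * \<lfloor>2 ^ k * y\<rfloor> \<or> \<lfloor>2 ^ Suc k * y\<rfloor> = 2 * \<lfloor>2 ^ k * y\<rfloor> + 1"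
    by linarith
  then show ?thesis by (auto simp: bin_digit_def)
qed

text \<open>The partial sums telescope to the dyadic truncations of \<open>y\<close>; by
  \<open>y < 1\<close> the integer part, which carries no digit, vanishes.\<close>

lemma bin_digit_sums:
  assumes "0 \<le> y" "y < 1"
  shows "(\<lambda>k. bin_digit k y / 2 ^ Suc k) sums y"
proof -
  define F where "F k = real_of_int \<lfloor>2 ^ k * y\<rfloor> / 2 ^ k" for k
  have "(\<lambda>k. y - 1 / 2 ^ k) \<longlonglongrightarrow> y - 0"
    by (intro tendsto_intros LIMSEQ_divide_realpow_zero) auto
  moreover have "y - 1 / 2 ^ k \<le> F k" "F k \<le> y" for k
  proof -
    have "2 ^ k * y - 1 \<le> real_of_int \<lfloor>2 ^ k * y\<rfloor>" "real_of_int \<lfloor>2 ^ k * y\<rfloor> \<le> 2 ^ k * y"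
      by linarith+
    then have "(2 ^ k * y - 1) / 2 ^ k \<le> F k" "F k \<le> (2 ^ k * y) / 2 ^ k"
      unfolding F_def by (intro divide_right_mono; simp)+
    then show "y - 1 / 2 ^ k \<le> F k" "F k \<le> y"
      by (simp_all add: diff_divide_distrib)
  qed
  ultimately have "F \<longlonglongrightarrow> y"
    by (intro tendsto_sandwich[of "\<lambda>k. y - 1 / 2 ^ k" F sequentially "\<lambda>_. y" y]) auto
  then have "(\<lambda>k. F (Suc k) - F k) sums (y - F 0)"
    by (rule telescope_sums)
  moreover have "F 0 = 0" using assms by (simp add: F_def) linarith
  moreover have "F (Suc k) - F k = bin_digit k y / 2 ^ Suc k" for k
    by (simp add: F_def bin_digit_def field_simps)
  ultimately show ?thesis by simp
qed

lemma cos_add_even: "cos (pi * (2 * of_int k + \<theta>)) = cos (pi * \<theta>)"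
  using cos_int_2pin[of k] sin_int_2pin[of k]
  by (simp add: distrib_left cos_add mult.assoc mult.commute mult.left_commute)

text \<open>Multiplying a ternary expansion with the digits 0 and 2 by a power of 3 moves the leading
  digits into an even integer, on which the 2-periodic clipped cosine does not depend.\<close>

lemma clipped_cos_ternary:
  assumes c: "\<And>m. c m = 0 \<or> c m = (1::real)"
  shows "clipped_cos (3 ^ n * (\<Sum>m. 2 * c m / 3 ^ Suc m)) = c n"
proof -
  have c01: "0 \<le> c m" "c m \<le> 1" for m using c[of m] by auto
  have geo: "(\<lambda>m. 2 / 3 ^ Suc m :: real) sums 1"
    using sums_mult[OF geometric_sums[of "1/3::real"], of "2/3"] by (simp add: power_divide)
  have s: "summable (\<lambda>m. 2 * c m / 3 ^ Suc m)"
    by (rule summable_comparison_test'[OF sums_summable[OF geo], of 0])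
      (simp add: c01 divide_right_mono del: power_Suc)
  define T where "T = (\<Sum>m. 2 * c (m + Suc n) / 3 ^ Suc (m + Suc n))"
  have split: "(\<Sum>m. 2 * c m / 3 ^ Suc m) = T + (\<Sum>m<Suc n. 2 * c m / 3 ^ Suc m)"
    unfolding T_def by (rule suminf_split_initial_segment[OF s])
  have "\<exists>k::int. 3 ^ j * (\<Sum>m<j. 2 * c m / 3 ^ Suc m) = 2 * of_int k" for j
  proof (induction j)
    case 0
    show ?case by (rule exI[of _ 0]) simp
  next
    case (Suc j)
    then obtain k :: int where k: "3 ^ j * (\<Sum>m<j. 2 * c m / 3 ^ Suc m) = 2 * of_int k" by auto
    have "3 ^ Suc j * (\<Sum>m<Suc j. 2 * c m / 3 ^ Suc m)
        = 3 * (3 ^ j * (\<Sum>m<j. 2 * c m / 3 ^ Suc m)) + 2 * c j"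
      by (simp add: field_simps)
    also have "\<dots> = 2 * of_int (3 * k + (if c j = 0 then 0 else 1))"
      unfolding k using c[of j] by auto
    finally show ?case by blast
  qed
  then obtain k :: int where k: "3 ^ n * (\<Sum>m<n. 2 * c m / 3 ^ Suc m) = 2 * of_int k" by blast
  have sT: "summable (\<lambda>m. 2 * c (m + Suc n) / 3 ^ Suc (m + Suc n))"
    using s by (subst summable_iff_shift)
  have "0 \<le> T" unfolding T_def by (rule suminf_nonneg[OF sT]) (simp add: c01)
  \<comment> \<open>The digits after place \<open>n\<close> weigh at most 1/3 after scaling, so the
    phase stays in [0, 1/3] or in [2/3, 1], where the clipped cosine is constant.\<close>
  moreover have "3 ^ n * T \<le> 1 / 3"
  proof -
    have "T \<le> (\<Sum>m. (2 / 3 ^ Suc m) * (1 / 3 ^ Suc n))"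
      unfolding T_def
    proof (rule suminf_le[OF _ sT])
      show "2 * c (m + Suc n) / 3 ^ Suc (m + Suc n) \<le> 2 / 3 ^ Suc m * (1 / 3 ^ Suc n)" for m
        using c01(2)[of "m + Suc n"] by (simp add: power_add field_simps)
      show "summable (\<lambda>m. 2 / 3 ^ Suc m * (1 / 3 ^ Suc n) :: real)"
        by (rule summable_mult2[OF sums_summable[OF geo]])
    qed
    also have "\<dots> = 1 / 3 ^ Suc n"
      using sums_unique[OF sums_mult2[OF geo, of "1 / 3 ^ Suc n"], symmetric] by (simp only: mult_1)
    finally show ?thesis by (simp add: field_simps)
  qed
  ultimately have \<theta>: "0 \<le> 3 ^ n * T" "3 ^ n * T \<le> 1 / 3" by auto
  have eq: "3 ^ n * (\<Sum>m. 2 * c m / 3 ^ Suc m) = 2 * of_int k + (2 * c n / 3 + 3 ^ n * T)"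
    unfolding split using k by (simp add: field_simps)
  show ?thesis
  proof (cases "c n = 0")
    case True
    have "cos (pi / 3) \<le> cos (pi * (3 ^ n * T))"
    proof (rule cos_monotone_0_pi_le)
      have "pi * (3 ^ n * T) \<le> pi * (1 / 3)" using \<theta> by (intro mult_left_mono) auto
      then show "pi * (3 ^ n * T) \<le> pi / 3" by simp
    qed (use \<theta> in auto)
    then show ?thesis
      unfolding eq clipped_cos_def cos_add_even using True by (simp add: cos_60)
  next
    case False
    then have 1: "c n = 1" using c[of n] by simp
    have "cos (pi * (2 / 3 + 3 ^ n * T)) \<le> cos (2 * pi / 3)"
    proof (rule cos_monotone_0_pi_le)
      have "pi * (2 / 3 + 3 ^ n * T) \<le> pi * 1" using \<theta> by (intro mult_left_mono) auto
      then show "pi * (2 / 3 + 3 ^ n * T) \<le> pi" by simp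
      show "2 * pi / 3 \<le> pi * (2 / 3 + 3 ^ n * T)" using \<theta> by (simp add: distrib_left)
    qed auto
    then show ?thesis
      unfolding eq clipped_cos_def cos_add_even using 1 by (simp add: cos_120)
  qed
qed

lemma schoenberg_cantor_code:
  assumes "0 \<le> y l" "y l < 1"
  shows "schoenberg l (cantor_code y) = y l"
proof -
  have "clipped_cos (3 ^ prod_encode (k, l) * cantor_code y) = bin_digit k (y l)" for k
    unfolding cantor_code_def
    using clipped_cos_ternary[of "\<lambda>m. bin_digit (fst (prod_decode m)) (y (snd (prod_decode m)))"
        "prod_encode (k, l)"] bin_digit_cases
    by simp
  then show ?thesis
    unfolding schoenberg_def using sums_unique[OF bin_digit_sums[OF assms]] by simp
qed

lemma cantor_code_bounds: "0 \<le> cantor_code y" "cantor_code y \<le> 1"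
proof -
  have b: "0 \<le> bin_digit k z" "bin_digit k z \<le> 1" for k z
    using bin_digit_cases[of k z] by auto
  have geo: "(\<lambda>m. 2 / 3 ^ Suc m :: real) sums 1"
    using sums_mult[OF geometric_sums[of "1/3::real"], of "2/3"] by (simp add: power_divide)
  have s: "summable (\<lambda>m. 2 * bin_digit (fst (prod_decode m)) (y (snd (prod_decode m))) / 3 ^ Suc m)"
    by (rule summable_comparison_test'[OF sums_summable[OF geo], of 0])
      (simp add: b divide_right_mono del: power_Suc)
  show "0 \<le> cantor_code y"
    unfolding cantor_code_def by (rule suminf_nonneg[OF s]) (simp add: b)
  have "cantor_code y \<le> (\<Sum>m. 2 / 3 ^ Suc m)"
    unfolding cantor_code_def
    by (rule suminf_le[OF _ s sums_summable[OF geo]]) (simp add: b divide_right_mono del: power_Suc)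
  then show "cantor_code y \<le> 1" using sums_unique[OF geo] by simp
qed

lemma measurable_cantor_code:
  assumes [measurable]: "\<And>l. (\<lambda>x. y x l) \<in> borel_measurable M"
  shows "(\<lambda>x. cantor_code (y x)) \<in> borel_measurable M"
  unfolding cantor_code_def bin_digit_def by measurable

text \<open>A Borel section of Schoenberg's space-filling curve moves the
  measures to the real line, where Helly's selection theorem applies; the curve is continuous, so
  it moves the limit back.\<close>

theorem weakly_convergent_subsequence:
  fixes M :: "nat \<Rightarrow> (real^'n) measure"
  assumes P: "\<And>n. prob_space (M n)" and sets: "\<And>n. sets (M n) = sets borel"
    and K: "compact K" and AEK: "\<And>n. AE x in M n. x \<in> K"
  shows "\<exists>r M'. strict_mono (r :: nat \<Rightarrow> nat) \<and> prob_space M' \<and> sets M' = sets borel \<and>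
    (AE x in M'. x \<in> K) \<and>
    (\<forall>g::real^'n \<Rightarrow> real. continuous_on UNIV g \<longrightarrow>
       (\<lambda>n. \<integral>x. g x \<partial>M (r n)) \<longlonglongrightarrow> (\<integral>x. g x \<partial>M'))"
proof -
  obtain e :: "'n \<Rightarrow> nat" where e: "inj e"
    using finite_imp_inj_to_nat_seg[of "UNIV :: 'n set"] by auto
  obtain R where R: "R > 0" "\<And>x. x \<in> K \<Longrightarrow> norm x \<le> R"
    using compact_imp_bounded[OF K] by (auto simp: bounded_pos)
  \<comment> \<open>The affine map sends [-R, R] to [1/4, 3/4] and so keeps the coordinates strictly
    below 1, as the binary expansion demands; \<open>h\<close> undoes it after the curve.\<close>
  define y where "y x l = (x $ (inv_into UNIV e l) / R + 2) / 4" for x :: "real^'n" and l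
  define s where "s x = cantor_code (y x)" for x
  define h where "h t = (\<chi> i. R * (4 * schoenberg (e i) t - 2))" for t
  have [measurable]: "s \<in> borel_measurable borel"
    unfolding s_def y_def by (intro measurable_cantor_code) measurable
  have hcont: "continuous_on UNIV h"
    unfolding h_def
    by (intro continuous_intros continuous_on_compose2[OF continuous_schoenberg]) auto
  then have [measurable]: "h \<in> borel_measurable borel"
    by (rule borel_measurable_continuous_onI)
  have hs: "h (s x) = x" if "x \<in> K" for x
  proof -
    have "\<bar>x $ i\<bar> \<le> R" for i
      using component_le_norm_cart[of x i] R(2)[OF that] by linarith
    then have "\<bar>x $ i / R\<bar> \<le> 1" for i using R(1) by simp
    then have "0 \<le> y x (e i) \<and> y x (e i) < 1" for i
      unfolding y_def inv_f_f[OF e] by (smt (verit) field_sum_of_halves divide_nonneg_pos divide_less_eq_1_pos)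
    moreover have "R * (4 * y x (e i) - 2) = x $ i" for i
      unfolding y_def inv_f_f[OF e] using R(1) by (simp add: field_simps)
    ultimately show ?thesis
      unfolding h_def s_def by (simp add: schoenberg_cantor_code vec_eq_iff)
  qed
  have hbdd: "norm (h t) \<le> (\<Sum>i\<in>(UNIV::'n set). 2 * R)" for t
  proof -
    have "\<bar>4 * schoenberg l t - 2\<bar> \<le> 2" for l
      using schoenberg_bounds[of l t] by (simp add: abs_le_iff)
    then have "\<bar>h t $ i\<bar> \<le> 2 * R" for i
      using R(1) by (simp add: h_def abs_mult mult.commute[of 2])
    then show ?thesis by (intro order_trans[OF norm_le_l1_cart] sum_mono)
  qed
  define \<nu> where "\<nu> n = distr (M n) borel s" for n
  have meas[measurable_cong]: "sets (M n) = sets borel" for n by (rule sets)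
  have \<nu>: "real_distribution (\<nu> n)" for n
    unfolding \<nu>_def by (intro real_distribution.intro prob_space.prob_space_distr P)
      (auto simp: real_distribution_axioms_def)
  have s01: "- 1 < s x" "s x \<le> 1" for x
    using cantor_code_bounds[of "y x"] by (auto simp: s_def)
  \<comment> \<open>Codes lie in [0, 1], so one bounded half-open interval carries all the mass,
    which is tightness for every \<epsilon> at once.\<close>
  have "measure (\<nu> n) {-1<..1} = 1" for n
  proof -
    have "measure (\<nu> n) {-1<..1} = measure (M n) (space (M n))"
      unfolding \<nu>_def
      by (subst measure_distr) (auto intro!: arg_cong[of _ _ "measure (M n)"] simp: s01)
    then show ?thesis using prob_space.prob_space[OF P] by simp
  qed
  then have "(-1 :: real) < 1 \<and> (\<forall>n. measure (\<nu> n) {-1<..1} > 1 - \<epsilon>)" if "\<epsilon> > 0" for \<epsilon>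
    using that by simp
  then have "tight \<nu>"
    unfolding tight_def using \<nu> by blast
  then obtain r L where r: "strict_mono (r :: nat \<Rightarrow> nat)" and L: "real_distribution L"
    and w: "weak_conv_m (\<nu> \<circ> id \<circ> r) L"
    using tight_imp_convergent_subsubsequence[of \<nu> id] by (auto simp: strict_mono_def)
  interpret L: real_distribution L by fact
  define M' where "M' = distr L borel h"
  have M': "prob_space M'" "sets M' = sets borel"
    unfolding M'_def by (auto intro!: L.prob_space_distr)
  have conv: "(\<lambda>n. \<integral>x. g x \<partial>M (r n)) \<longlonglongrightarrow> (\<integral>x. g x \<partial>M')" if g: "continuous_on UNIV g"
    for g :: "real^'n \<Rightarrow> real"
  proof -
    have gm[measurable]: "g \<in> borel_measurable borel"
      using g by (rule borel_measurable_continuous_onI)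
    have "compact (g ` cball 0 (\<Sum>i\<in>(UNIV::'n set). 2 * R))"
      by (intro compact_continuous_image continuous_on_subset[OF g]) auto
    then obtain B where B: "\<And>x. x \<in> cball 0 (\<Sum>i\<in>(UNIV::'n set). 2 * R) \<Longrightarrow> \<bar>g x\<bar> \<le> B"
      using compact_imp_bounded by (fastforce simp: bounded_real)
    have "(\<lambda>n. \<integral>t. g (h t) \<partial>(\<nu> \<circ> id \<circ> r) n) \<longlonglongrightarrow> (\<integral>t. g (h t) \<partial>L)"
    proof (rule weak_conv_imp_integral_bdd_continuous_conv[OF _ L w])
      show "isCont (\<lambda>t. g (h t)) x" for x
        using continuous_on_compose2[OF g hcont] by (simp add: continuous_on_eq_continuous_at)
      show "norm (g (h x)) \<le> B" for x
        using B[of "h x"] hbdd[of x] by simp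
    qed (use \<nu> in auto)
    moreover have "(\<integral>t. g (h t) \<partial>(\<nu> \<circ> id \<circ> r) n) = (\<integral>x. g x \<partial>M (r n))" for n
    proof -
      have "(\<integral>t. g (h t) \<partial>\<nu> (r n)) = (\<integral>x. g (h (s x)) \<partial>M (r n))"
        unfolding \<nu>_def by (rule integral_distr) auto
      also have "\<dots> = (\<integral>x. g x \<partial>M (r n))"
        using AEK[of "r n"] by (intro integral_cong_AE) (auto simp: hs)
      finally show ?thesis by simp
    qed
    moreover have "(\<integral>t. g (h t) \<partial>L) = (\<integral>x. g x \<partial>M')"
      unfolding M'_def by (rule integral_distr[symmetric]) auto
    ultimately show ?thesis by simp
  qed
  \<comment> \<open>The curve may leave \<open>K\<close> away from the codes of points of
    \<open>K\<close>, so the support of the limit is not automatic. The continuous function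
    \<open>infdist x K\<close> has integral 0 along the sequence, hence also in the limit.\<close>
  have "AE x in M'. x \<in> K"
  proof -
    have ne: "K \<noteq> {}"
      using AEK[of 0] prob_space.AE_False[OF P[of 0]] by auto
    interpret M': prob_space M' by (rule M')
    have [measurable_cong]: "sets M' = sets borel" by (rule M')
    have c: "continuous_on UNIV (\<lambda>x. infdist x K)" by (intro continuous_intros)
    then have [measurable]: "(\<lambda>x. infdist x K) \<in> borel_measurable borel"
      by (rule borel_measurable_continuous_onI)
    have "(\<integral>x. infdist x K \<partial>M (r n)) = 0" for n
    proof -
      have "(\<integral>x. infdist x K \<partial>M (r n)) = (\<integral>x. 0 \<partial>M (r n))"
        using AEK[of "r n"] by (intro integral_cong_AE) auto
      then show ?thesis by simp
    qed
    then have "(\<integral>x. infdist x K \<partial>M') = 0"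
      using conv[OF c] by (simp add: LIMSEQ_const_iff)
    moreover have "integrable M' (\<lambda>x. infdist x K)"
    proof -
      obtain a where "a \<in> K" using ne by auto
      have "integrable L (\<lambda>t. infdist (h t) K)"
      proof (rule L.integrable_const_bound)
        show "AE t in L. norm (infdist (h t) K) \<le> (\<Sum>i\<in>(UNIV::'n set). 2 * R) + norm a"
        proof (rule AE_I2)
          fix t
          have "infdist (h t) K \<le> dist (h t) a" by (rule infdist_le[OF \<open>a \<in> K\<close>])
          also have "\<dots> \<le> norm (h t) + norm a" by (simp add: dist_norm norm_triangle_ineq4)
          finally show "norm (infdist (h t) K) \<le> (\<Sum>i\<in>(UNIV::'n set). 2 * R) + norm a"
            using hbdd[of t] infdist_nonneg[of "h t" K] by simp
        qed
      qed measurable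
      then show ?thesis unfolding M'_def by (subst integrable_distr_eq) auto
    qed
    ultimately have "AE x in M'. infdist x K = 0"
      by (subst (asm) integral_nonneg_eq_0_iff_AE) (auto simp: infdist_nonneg)
    then show ?thesis
      using in_closed_iff_infdist_zero[OF compact_imp_closed[OF K] ne] by auto
  qed
  then show ?thesis using r M' conv by blast
qed

section \<open>Limits of random walks\<close>

text \<open>One step of the Markov chain that applies one of \<open>m\<close> maps, chosen
  uniformly. The random index is a factor of a product space, so that integrals against the result
  reduce to Fubini.\<close>

definition average_push :: "nat \<Rightarrow> (nat \<Rightarrow> real^'n \<Rightarrow> real^'n) \<Rightarrow> (real^'n) measure \<Rightarrow> (real^'n) measure"
  where "average_push m \<Phi> M =
    distr (measure_pmf (pmf_of_set {..<m}) \<Otimes>\<^sub>M M) borel (\<lambda>(i, x). \<Phi> i x)"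

context
  fixes m :: nat and \<Phi> :: "nat \<Rightarrow> real^'n \<Rightarrow> real^'n" and M :: "(real^'n) measure"
  assumes m: "m > 0" and \<Phi>: "\<And>i. \<Phi> i \<in> borel_measurable borel"
    and M: "prob_space M" "sets M = sets borel"
begin

lemma average_push_measurable:
  "(\<lambda>(i, x). \<Phi> i x) \<in> borel_measurable (measure_pmf (pmf_of_set {..<m}) \<Otimes>\<^sub>M M)"
proof -
  have "(\<lambda>(i, x). \<Phi> i x) \<in> borel_measurable (count_space UNIV \<Otimes>\<^sub>M M)"
    by (rule measurable_pair_measure_countable1) (auto simp: \<Phi> measurable_cong_sets[OF M(2) refl])
  also have "borel_measurable (count_space UNIV \<Otimes>\<^sub>M M)
      = borel_measurable (measure_pmf (pmf_of_set {..<m}) \<Otimes>\<^sub>M M)"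
    by (intro measurable_cong_sets sets_pair_measure_cong) auto
  finally show ?thesis .
qed

lemma prob_space_average_push: "prob_space (average_push m \<Phi> M)"
proof -
  interpret M: prob_space M by (rule M)
  interpret P: pair_prob_space "measure_pmf (pmf_of_set {..<m})" M ..
  show ?thesis
    unfolding average_push_def by (rule P.prob_space_distr[OF average_push_measurable])
qed

lemma integral_average_push:
  fixes g :: "real^'n \<Rightarrow> real"
  assumes g: "g \<in> borel_measurable borel" and b: "\<And>x. \<bar>g x\<bar> \<le> b"
  shows "(\<integral>x. g x \<partial>average_push m \<Phi> M) = (\<integral>x. (\<Sum>i<m. g (\<Phi> i x)) / m \<partial>M)"
proof -
  interpret M: prob_space M by (rule M)
  interpret P: pair_prob_space "measure_pmf (pmf_of_set {..<m})" M ..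
  let ?f = "\<lambda>(i, x). g (\<Phi> i x)"
  have meas: "?f \<in> borel_measurable (measure_pmf (pmf_of_set {..<m}) \<Otimes>\<^sub>M M)"
    using measurable_compose[OF average_push_measurable g] by (simp add: case_prod_unfold)
  have int: "integrable (measure_pmf (pmf_of_set {..<m}) \<Otimes>\<^sub>M M) ?f"
    by (rule P.integrable_const_bound[OF _ meas, of b]) (auto simp: b)
  have "(\<integral>x. g x \<partial>average_push m \<Phi> M)
      = (\<integral>z. ?f z \<partial>(measure_pmf (pmf_of_set {..<m}) \<Otimes>\<^sub>M M))"
    unfolding average_push_def
    by (subst integral_distr[OF average_push_measurable g]) (simp add: case_prod_unfold)
  also have "\<dots> = (\<integral>x. (\<integral>i. ?f (i, x) \<partial>measure_pmf (pmf_of_set {..<m})) \<partial>M)"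
    using P.integral_snd[of "\<lambda>i x. g (\<Phi> i x)"] int by simp
  also have "\<dots> = (\<integral>x. (\<Sum>i<m. g (\<Phi> i x)) / m \<partial>M)"
    using m by (subst integral_pmf_of_set) (auto simp: lessThan_empty_iff)
  finally show ?thesis .
qed

lemma AE_average_push:
  assumes K: "K \<in> sets borel" "AE x in M. x \<in> K" and inv: "\<And>i x. x \<in> K \<Longrightarrow> \<Phi> i x \<in> K"
  shows "AE x in average_push m \<Phi> M. x \<in> K"
proof -
  interpret M: prob_space M by (rule M)
  interpret A: prob_space "average_push m \<Phi> M" by (rule prob_space_average_push)
  have sA: "sets (average_push m \<Phi> M) = sets borel" by (simp add: average_push_def)
  have "measure (average_push m \<Phi> M) K = (\<integral>x. indicator K x \<partial>average_push m \<Phi> M)"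
    using K(1) sA by simp
  also have "\<dots> = (\<integral>x. (\<Sum>i<m. indicator K (\<Phi> i x)) / m \<partial>M)"
    using K(1) by (intro integral_average_push[where b = 1]) (auto simp: indicator_def)
  also have "\<dots> = (\<integral>x. 1 \<partial>M)"
  proof (rule integral_cong_AE)
    show "(\<lambda>x. (\<Sum>i<m. indicator K (\<Phi> i x)) / real m) \<in> borel_measurable M"
      using K(1) \<Phi> by (simp add: measurable_cong_sets[OF M(2) refl])
    show "AE x in M. (\<Sum>i<m. indicator K (\<Phi> i x)) / real m = 1"
      using K(2) by eventually_elim (use m inv in auto)
  qed auto
  also have "\<dots> = 1" by (simp add: M.prob_space)
  finally show ?thesis
    using A.AE_prob_1[of K] by simp
qed

end

lemma (in prob_space) abs_integral_le:
  fixes f :: "'a \<Rightarrow> real"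
  assumes "AE x in M. \<bar>f x\<bar> \<le> b" "f \<in> borel_measurable M"
  shows "\<bar>\<integral>x. f x \<partial>M\<bar> \<le> b"
proof -
  have i: "integrable M f" by (rule integrable_const_bound[of _ b]) (use assms in auto)
  have "(\<integral>x. f x \<partial>M) \<le> (\<integral>x. b \<partial>M)" "(\<integral>x. - b \<partial>M) \<le> (\<integral>x. f x \<partial>M)"
    using assms(1) by (intro integral_mono_AE i; simp; fastforce elim: eventually_mono)+
  then show ?thesis by (simp add: prob_space)
qed

text \<open>An error of h sqrt h in one step is o(h) and disappears after summation over 1/h steps.
  Closure of \<open>\<G>\<close> under \<open>B\<close> allows the expansion to be applied again to
  \<open>B g\<close>, which controls how fast the integral of \<open>B g\<close> varies.\<close>

locale random_walk =
  fixes K :: "(real^'n) set" and \<G> :: "(real^'n \<Rightarrow> real) set"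
    and B :: "(real^'n \<Rightarrow> real) \<Rightarrow> real^'n \<Rightarrow> real"
    and m :: nat and \<Phi> :: "real \<Rightarrow> nat \<Rightarrow> real^'n \<Rightarrow> real^'n"
  assumes K: "compact K" and m: "m > 0"
    and cont: "\<And>g. g \<in> \<G> \<Longrightarrow> continuous_on UNIV g"
    and B: "\<And>g. g \<in> \<G> \<Longrightarrow> B g \<in> \<G>"
    and \<Phi>_measurable: "\<And>h i. \<Phi> h i \<in> borel_measurable borel"
    and \<Phi>_K: "\<And>h i x. x \<in> K \<Longrightarrow> \<Phi> h i x \<in> K"
    and consistent: "\<And>g. g \<in> \<G> \<Longrightarrow> \<exists>C. \<forall>h\<in>{0<..1}. \<forall>x\<in>K.
      \<bar>(\<Sum>i<m. g (\<Phi> h i x)) / m - g x - h * B g x\<bar> \<le> C * (h * sqrt h)"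
begin

definition prob_on_K :: "(real^'n) measure \<Rightarrow> bool" where
  "prob_on_K M \<longleftrightarrow> prob_space M \<and> sets M = sets borel \<and> (AE x in M. x \<in> K)"

lemma K_borel: "K \<in> sets borel"
  using compact_imp_closed[OF K] by simp

lemma bounded_on_K:
  assumes "continuous_on UNIV (g :: real^'n \<Rightarrow> real)"
  obtains b where "b \<ge> 0" "\<And>x. x \<in> K \<Longrightarrow> \<bar>g x\<bar> \<le> b"
proof -
  have "bounded (g ` K)"
    using K assms by (intro compact_imp_bounded compact_continuous_image continuous_on_subset[OF assms]) auto
  then obtain b where "\<forall>y\<in>g ` K. \<bar>y\<bar> \<le> b" by (auto simp: bounded_real)
  then show ?thesis by (intro that[of "max b 0"]) auto
qed

lemma abs_integral_on_K:
  assumes "prob_on_K M" "f \<in> borel_measurable borel" "\<And>x. x \<in> K \<Longrightarrow> \<bar>f x\<bar> \<le> (b::real)"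
  shows "\<bar>\<integral>x. f x \<partial>M\<bar> \<le> b" "integrable M f"
proof -
  interpret prob_space M using assms by (simp add: prob_on_K_def)
  have s: "sets M = sets borel" using assms by (simp add: prob_on_K_def)
  have m: "f \<in> borel_measurable M" using assms(2) by (simp add: measurable_cong_sets[OF s refl])
  have "AE x in M. x \<in> K" using assms(1) by (simp add: prob_on_K_def)
  then have a: "AE x in M. \<bar>f x\<bar> \<le> b" using assms(3) by (auto elim: eventually_mono)
  show "\<bar>\<integral>x. f x \<partial>M\<bar> \<le> b" by (rule abs_integral_le[OF a m])
  show "integrable M f" by (rule integrable_const_bound[OF _ m, of b]) (use a in simp)
qed

lemma integrable_on_K:
  assumes "prob_on_K M" "continuous_on UNIV (g :: real^'n \<Rightarrow> real)"
  shows "integrable M g"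
proof -
  obtain b where "\<And>x. x \<in> K \<Longrightarrow> \<bar>g x\<bar> \<le> b" using bounded_on_K[OF assms(2)] by auto
  then show ?thesis
    using abs_integral_on_K(2)[OF assms(1) borel_measurable_continuous_onI[OF assms(2)]] by blast
qed

primrec chain :: "(real^'n) measure \<Rightarrow> real \<Rightarrow> nat \<Rightarrow> (real^'n) measure" where
  "chain M h 0 = M"
| "chain M h (Suc k) = average_push m (\<Phi> h) (chain M h k)"

lemma chain_prob: "prob_on_K M \<Longrightarrow> prob_on_K (chain M h k)"
proof (induction k)
  case (Suc k)
  then show ?case
    unfolding prob_on_K_def chain.simps
    using prob_space_average_push[OF m, where M = "chain M h k" and \<Phi> = "\<Phi> h"]
      AE_average_push[OF m, where M = "chain M h k" and \<Phi> = "\<Phi> h" and K = K] K_borel \<Phi>_K \<Phi>_measurable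
    by (auto simp: average_push_def)
qed simp

lemma integral_chain_Suc:
  assumes M: "prob_on_K M" and g: "continuous_on UNIV g"
  shows "(\<integral>x. g x \<partial>chain M h (Suc k)) = (\<integral>x. (\<Sum>i<m. g (\<Phi> h i x)) / m \<partial>chain M h k)"
proof -
  obtain b where b: "b \<ge> 0" "\<And>x. x \<in> K \<Longrightarrow> \<bar>g x\<bar> \<le> b" using bounded_on_K[OF g] by blast
  \<comment> \<open>The formula for one step wants a bounded integrand, while \<open>g\<close> is
    bounded on \<open>K\<close> only; truncation changes nothing on \<open>K\<close>, which carries
    all the mass.\<close>
  define g' where "g' x = max (- b) (min b (g x))" for x
  have [measurable]: "g \<in> borel_measurable borel" "g' \<in> borel_measurable borel"
    unfolding g'_def using g by (auto intro!: borel_measurable_continuous_onI continuous_intros)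
  note [measurable] = \<Phi>_measurable
  have eq: "g' x = g x" if "x \<in> K" for x using b(2)[OF that] by (auto simp: g'_def)
  have c: "prob_on_K (chain M h k)" "prob_on_K (chain M h (Suc k))" by (rule chain_prob[OF M])+
  have s[measurable_cong]: "sets (chain M h k) = sets borel" "sets (chain M h (Suc k)) = sets borel"
    using c unfolding prob_on_K_def by blast+
  have ae: "AE x in chain M h k. x \<in> K" "AE x in chain M h (Suc k). x \<in> K"
    using c unfolding prob_on_K_def by blast+
  have "(\<integral>x. g x \<partial>chain M h (Suc k)) = (\<integral>x. g' x \<partial>chain M h (Suc k))"
  proof (rule integral_cong_AE)
    show "AE x in chain M h (Suc k). g x = g' x" using ae(2) by eventually_elim (simp add: eq)
  qed measurable
  also have "\<dots> = (\<integral>x. (\<Sum>i<m. g' (\<Phi> h i x)) / m \<partial>chain M h k)"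
    unfolding chain.simps
    using c(1) b(1) by (intro integral_average_push[where b = b] m) (auto simp: prob_on_K_def g'_def)
  also have "\<dots> = (\<integral>x. (\<Sum>i<m. g (\<Phi> h i x)) / m \<partial>chain M h k)"
  proof (rule integral_cong_AE)
    show "AE x in chain M h k. (\<Sum>i<m. g' (\<Phi> h i x)) / m = (\<Sum>i<m. g (\<Phi> h i x)) / m"
      using ae(1) by eventually_elim (simp add: eq \<Phi>_K)
  qed measurable
  finally show ?thesis .
qed

lemma chain_step:
  assumes g: "g \<in> \<G>"
  shows "\<exists>C\<ge>0. \<forall>M h k. prob_on_K M \<longrightarrow> 0 < h \<longrightarrow> h \<le> 1 \<longrightarrow>
    \<bar>(\<integral>x. g x \<partial>chain M h (Suc k)) - (\<integral>x. g x \<partial>chain M h k) - h * (\<integral>x. B g x \<partial>chain M h k)\<bar>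
      \<le> C * (h * sqrt h)"
proof -
  obtain C where C0: "\<forall>h\<in>{0<..1}. \<forall>x\<in>K.
      \<bar>(\<Sum>i<m. g (\<Phi> h i x)) / m - g x - h * B g x\<bar> \<le> C * (h * sqrt h)"
    using consistent[OF g] by blast
  have C: "\<bar>(\<Sum>i<m. g (\<Phi> h i x)) / m - g x - h * B g x\<bar> \<le> C * (h * sqrt h)"
    if "0 < h" "h \<le> 1" "x \<in> K" for h x
    using C0 that by simp
  have [measurable]: "g \<in> borel_measurable borel" "B g \<in> borel_measurable borel"
    using cont[OF g] cont[OF B[OF g]] by (auto intro: borel_measurable_continuous_onI)
  note [measurable] = \<Phi>_measurable
  have "\<bar>(\<integral>x. g x \<partial>chain M h (Suc k)) - (\<integral>x. g x \<partial>chain M h k) - h * (\<integral>x. B g x \<partial>chain M h k)\<bar>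
      \<le> max C 0 * (h * sqrt h)" if M: "prob_on_K M" and h: "0 < h" "h \<le> 1" for M h k
  proof -
    note c = chain_prob[OF M, of h k]
    obtain b where b: "b \<ge> 0" "\<And>x. x \<in> K \<Longrightarrow> \<bar>g x\<bar> \<le> b" using bounded_on_K[OF cont[OF g]] by blast
    have i1: "integrable (chain M h k) (\<lambda>x. (\<Sum>i<m. g (\<Phi> h i x)) / m)"
    proof (rule abs_integral_on_K(2)[OF c, where b = b])
      show "\<bar>(\<Sum>i<m. g (\<Phi> h i x)) / m\<bar> \<le> b" if "x \<in> K" for x
      proof -
        have "\<bar>\<Sum>i<m. g (\<Phi> h i x)\<bar> \<le> (\<Sum>i<m. \<bar>g (\<Phi> h i x)\<bar>)" by (rule sum_abs)
        also have "\<dots> \<le> (\<Sum>i<m. b)" by (intro sum_mono b \<Phi>_K that)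
        finally show ?thesis using m by (simp add: field_simps abs_mult)
      qed
    qed measurable
    have i2: "integrable (chain M h k) g" "integrable (chain M h k) (B g)"
      using integrable_on_K[OF c] cont[OF g] cont[OF B[OF g]] by auto
    have "(\<integral>x. g x \<partial>chain M h (Suc k)) - (\<integral>x. g x \<partial>chain M h k) - h * (\<integral>x. B g x \<partial>chain M h k)
       = (\<integral>x. (\<Sum>i<m. g (\<Phi> h i x)) / m - g x - h * B g x \<partial>chain M h k)"
      unfolding integral_chain_Suc[OF M cont[OF g]] using i1 i2 by simp
    also have "\<bar>\<dots>\<bar> \<le> C * (h * sqrt h)"
      by (rule abs_integral_on_K(1)[OF c]) (use C h in auto)
    also have "\<dots> \<le> max C 0 * (h * sqrt h)"
      using h by (intro mult_right_mono) auto
    finally show ?thesis .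
  qed
  then show ?thesis by (intro exI[of _ "max C 0"]) auto
qed

text \<open>Each of the \<open>j\<close> steps contributes its own error h sqrt h. Replacing the
  current integral of \<open>B g\<close> by the initial one costs a term quadratic in the elapsed
  time, because that integral is Lipschitz in time: \<open>B (B g)\<close> is bounded on
  \<open>K\<close>. Only the quadratic term survives when \<open>h\<close> tends to 0.\<close>

lemma chain_estimate:
  assumes g: "g \<in> \<G>"
  shows "\<exists>C L. \<forall>M h k j. prob_on_K M \<longrightarrow> 0 < h \<longrightarrow> h \<le> 1 \<longrightarrow>
    \<bar>(\<integral>x. g x \<partial>chain M h (k + j)) - (\<integral>x. g x \<partial>chain M h k)
        - (real j * h) * (\<integral>x. B g x \<partial>chain M h k)\<bar>
      \<le> C * (real j * h * sqrt h) + L * (real j * h)\<^sup>2"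
proof -
  obtain C where C: "C \<ge> 0" "\<And>M h k. prob_on_K M \<Longrightarrow> 0 < h \<Longrightarrow> h \<le> 1 \<Longrightarrow>
    \<bar>(\<integral>x. g x \<partial>chain M h (Suc k)) - (\<integral>x. g x \<partial>chain M h k) - h * (\<integral>x. B g x \<partial>chain M h k)\<bar>
      \<le> C * (h * sqrt h)" using chain_step[OF g] by blast
  obtain C' where C': "C' \<ge> 0" "\<And>M h k. prob_on_K M \<Longrightarrow> 0 < h \<Longrightarrow> h \<le> 1 \<Longrightarrow>
    \<bar>(\<integral>x. B g x \<partial>chain M h (Suc k)) - (\<integral>x. B g x \<partial>chain M h k) - h * (\<integral>x. B (B g) x \<partial>chain M h k)\<bar>
      \<le> C' * (h * sqrt h)" using chain_step[OF B[OF g]] by blast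
  obtain b where b: "b \<ge> 0" "\<And>x. x \<in> K \<Longrightarrow> \<bar>B (B g) x\<bar> \<le> b"
    using bounded_on_K[OF cont[OF B[OF B[OF g]]]] by blast
  define L where "L = b + C'"
  have "L \<ge> 0" using b C' by (simp add: L_def)
  have "\<bar>(\<integral>x. g x \<partial>chain M h (k + j)) - (\<integral>x. g x \<partial>chain M h k)
        - (real j * h) * (\<integral>x. B g x \<partial>chain M h k)\<bar>
      \<le> C * (real j * h * sqrt h) + L * (real j * h)\<^sup>2"
    if M: "prob_on_K M" and h: "0 < h" "h \<le> 1" for M h k j
  proof -
    define E where "E k = (\<integral>x. g x \<partial>chain M h k)" for k
    define E' where "E' k = (\<integral>x. B g x \<partial>chain M h k)" for k
    have E1: "\<bar>E (Suc k) - E k - h * E' k\<bar> \<le> C * (h * sqrt h)" for k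
      unfolding E_def E'_def by (rule C(2)[OF M h])
    have E'1: "\<bar>E' (Suc k) - E' k\<bar> \<le> L * h" for k
    proof -
      have "\<bar>\<integral>x. B (B g) x \<partial>chain M h k\<bar> \<le> b"
        using cont[OF B[OF B[OF g]]] b(2)
        by (intro abs_integral_on_K(1)[OF chain_prob[OF M]] borel_measurable_continuous_onI)
      then have "\<bar>h * (\<integral>x. B (B g) x \<partial>chain M h k)\<bar> \<le> h * b"
        using h by (simp add: abs_mult)
      moreover have "C' * (h * sqrt h) \<le> C' * (h * 1)"
        using h C'(1) by (intro mult_left_mono) auto
      moreover have "\<bar>E' (Suc k) - E' k - h * (\<integral>x. B (B g) x \<partial>chain M h k)\<bar> \<le> C' * (h * sqrt h)"
        unfolding E'_def by (rule C'(2)[OF M h])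
      ultimately show ?thesis by (simp add: L_def algebra_simps abs_le_iff)
    qed
    have E'j: "\<bar>E' (k + j) - E' k\<bar> \<le> L * (real j * h)" for j
    proof (induction j)
      case (Suc j)
      then show ?case using E'1[of "k + j"] by (simp add: algebra_simps)
    qed simp
    have "\<bar>E (k + j) - E k - (real j * h) * E' k\<bar> \<le> C * (real j * h * sqrt h) + L * (real j * h)\<^sup>2"
    proof (induction j)
      case (Suc j)
      have "\<bar>h * (E' (k + j) - E' k)\<bar> \<le> h * (L * (real j * h))"
        using E'j[of j] h by (simp add: abs_mult)
      moreover have "E (k + Suc j) - E k - (real (Suc j) * h) * E' k =
          (E (k + j) - E k - (real j * h) * E' k)
          + (E (Suc (k + j)) - E (k + j) - h * E' (k + j)) + h * (E' (k + j) - E' k)"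
        by (simp add: algebra_simps)
      ultimately have "\<bar>E (k + Suc j) - E k - (real (Suc j) * h) * E' k\<bar>
          \<le> (C * (real j * h * sqrt h) + L * (real j * h)\<^sup>2) + C * (h * sqrt h) + h * (L * (real j * h))"
        using Suc E1[of "k + j"] by linarith
      also have "\<dots> = C * (real (Suc j) * h * sqrt h) + L * (h\<^sup>2 * (real j * real j + real j))"
        by (simp add: algebra_simps power2_eq_square)
      also have "L * (h\<^sup>2 * (real j * real j + real j)) \<le> L * (h\<^sup>2 * (real (Suc j) * real (Suc j)))"
        using \<open>L \<ge> 0\<close> by (intro mult_left_mono) (auto simp: algebra_simps)
      finally show ?case by (simp add: power_mult_distrib power2_eq_square mult_ac)
    qed simp
    then show ?thesis by (simp add: E_def E'_def)
  qed
  then show ?thesis by blast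
qed

text \<open>A diagonal argument over the countably many pairs \<open>(a, b)\<close>, which stand for
  the times a / 2^b. With step size 2^(-d n) such a time is reached after
  \<open>a * 2 ^ (d n - b)\<close> steps; the subtraction is truncated only for the finitely many
  \<open>n\<close> with \<open>d n < b\<close>.\<close>

lemma dyadic_limits:
  assumes M: "prob_on_K M"
  shows "\<exists>d \<nu>. strict_mono (d :: nat \<Rightarrow> nat) \<and> (\<forall>a b. prob_on_K (\<nu> a b) \<and>
    (\<forall>g::real^'n \<Rightarrow> real. continuous_on UNIV g \<longrightarrow>
      (\<lambda>n. \<integral>x. g x \<partial>chain M (1 / 2 ^ d n) (a * 2 ^ (d n - b))) \<longlonglongrightarrow> (\<integral>x. g x \<partial>\<nu> a b)))"
proof -
  define \<mu> where "\<mu> i n = chain M (1 / 2 ^ n) (fst (prod_decode i) * 2 ^ (n - snd (prod_decode i)))"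
    for i n
  define Q where "Q i s \<longleftrightarrow> (\<exists>M'. prob_on_K M' \<and> (\<forall>g::real^'n \<Rightarrow> real. continuous_on UNIV g \<longrightarrow>
      (\<lambda>n. \<integral>x. g x \<partial>\<mu> i (s n)) \<longlonglongrightarrow> (\<integral>x. g x \<partial>M')))" for i and s :: "nat \<Rightarrow> nat"
  interpret S: subseqs Q
  proof
    fix i and s :: "nat \<Rightarrow> nat"
    have "prob_on_K (\<mu> i n)" for n unfolding \<mu>_def by (rule chain_prob[OF M])
    then show "\<exists>r'. strict_mono r' \<and> Q i (s \<circ> r')"
      using weakly_convergent_subsequence[of "\<lambda>n. \<mu> i (s n)", OF _ _ K]
      unfolding prob_on_K_def Q_def by (auto simp: o_def)
  qed
  have Q: "\<exists>M'. prob_on_K M' \<and> (\<forall>g::real^'n \<Rightarrow> real. continuous_on UNIV g \<longrightarrow>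
      (\<lambda>n. \<integral>x. g x \<partial>\<mu> i (S.diagseq n)) \<longlonglongrightarrow> (\<integral>x. g x \<partial>M'))" for i
  proof -
    \<comment> \<open>The diagonal sequence is a subsequence of the \<open>i\<close>-th one only
      from index \<open>Suc i\<close> on; the shift is removed afterwards by
      \<open>LIMSEQ_offset\<close>.\<close>
    have "Q i (S.diagseq \<circ> ((+) (Suc i)))"
    proof (rule S.diagseq_holds)
      fix r s :: "nat \<Rightarrow> nat" and n
      assume r: "strict_mono r" and "Q n s"
      then obtain M' where "prob_on_K M'" and l: "\<And>g::real^'n \<Rightarrow> real. continuous_on UNIV g \<Longrightarrow>
        (\<lambda>k. \<integral>x. g x \<partial>\<mu> n (s k)) \<longlonglongrightarrow> (\<integral>x. g x \<partial>M')"
        unfolding Q_def by auto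
      then show "Q n (s \<circ> r)"
        unfolding Q_def using LIMSEQ_subseq_LIMSEQ[OF l r] by (intro exI[of _ M']) (simp add: o_def)
    qed
    then obtain M' where M': "prob_on_K M'"
      "\<And>g::real^'n \<Rightarrow> real. continuous_on UNIV g \<Longrightarrow>
        (\<lambda>n. \<integral>x. g x \<partial>\<mu> i (S.diagseq (Suc i + n))) \<longlonglongrightarrow> (\<integral>x. g x \<partial>M')"
      by (auto simp: Q_def)
    show ?thesis
    proof (intro exI[of _ M'] conjI M'(1) allI impI)
      fix g :: "real^'n \<Rightarrow> real" assume "continuous_on UNIV g"
      from M'(2)[OF this] have "(\<lambda>n. \<integral>x. g x \<partial>\<mu> i (S.diagseq (n + Suc i))) \<longlonglongrightarrow> (\<integral>x. g x \<partial>M')"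
        by (simp only: add.commute[of _ "Suc i"])
      then show "(\<lambda>n. \<integral>x. g x \<partial>\<mu> i (S.diagseq n)) \<longlonglongrightarrow> (\<integral>x. g x \<partial>M')"
        by (rule LIMSEQ_offset)
    qed
  qed
  then have "\<forall>i. \<exists>M'. prob_on_K M' \<and> (\<forall>g::real^'n \<Rightarrow> real. continuous_on UNIV g \<longrightarrow>
      (\<lambda>n. \<integral>x. g x \<partial>\<mu> i (S.diagseq n)) \<longlonglongrightarrow> (\<integral>x. g x \<partial>M'))" by (rule allI)
  from choice[OF this] obtain \<nu> where \<nu>_all: "\<forall>i. prob_on_K (\<nu> i) \<and> (\<forall>g::real^'n \<Rightarrow> real. continuous_on UNIV g \<longrightarrow>
      (\<lambda>n. \<integral>x. g x \<partial>\<mu> i (S.diagseq n)) \<longlonglongrightarrow> (\<integral>x. g x \<partial>\<nu> i))" by (elim exE)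
  have \<nu>: "prob_on_K (\<nu> i)" "continuous_on UNIV (g :: real^'n \<Rightarrow> real) \<Longrightarrow>
      (\<lambda>n. \<integral>x. g x \<partial>\<mu> i (S.diagseq n)) \<longlonglongrightarrow> (\<integral>x. g x \<partial>\<nu> i)" for i g
    using \<nu>_all by simp_all
  show ?thesis
    using S.subseq_diagseq \<nu>(1) \<nu>(2)[of _ "prod_encode (_, _)"]
    by (intro exI[of _ S.diagseq] exI[of _ "\<lambda>a b. \<nu> (prod_encode (a, b))"]) (auto simp: \<mu>_def)
qed

text \<open>The quadratic bound expresses that the integral of \<open>g\<close> has the integral of
  \<open>B g\<close> as its derivative, with an error uniform in time. In this form the claim passes
  to limits, unlike differentiability. It holds at dyadic times and is carried to all times by
  dyadic approximation from below.\<close>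

theorem evolution_exists:
  assumes M: "prob_on_K M"
  shows "\<exists>\<mu>. \<mu> 0 = M \<and> (\<forall>t\<ge>0. prob_on_K (\<mu> t)) \<and>
    (\<forall>g\<in>\<G>. \<exists>C. \<forall>s t. 0 \<le> s \<longrightarrow> s \<le> t \<longrightarrow>
      \<bar>(\<integral>x. g x \<partial>\<mu> t) - (\<integral>x. g x \<partial>\<mu> s) - (t - s) * (\<integral>x. B g x \<partial>\<mu> s)\<bar> \<le> C * (t - s)\<^sup>2)"
proof -
  obtain d \<nu> where d: "strict_mono (d :: nat \<Rightarrow> nat)"
    and \<nu>_all: "\<forall>a b. prob_on_K (\<nu> a b) \<and> (\<forall>g::real^'n \<Rightarrow> real. continuous_on UNIV g \<longrightarrow>
      (\<lambda>n. \<integral>x. g x \<partial>chain M (1 / 2 ^ d n) (a * 2 ^ (d n - b))) \<longlonglongrightarrow> (\<integral>x. g x \<partial>\<nu> a b))"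
    using dyadic_limits[OF M] by (elim exE conjE)
  have \<nu>: "prob_on_K (\<nu> a b)" for a b using \<nu>_all by simp
  have lim: "(\<lambda>n. \<integral>x. g x \<partial>chain M (1 / 2 ^ d n) (a * 2 ^ (d n - b))) \<longlonglongrightarrow> (\<integral>x. g x \<partial>\<nu> a b)"
    if "continuous_on UNIV g" for a b and g :: "real^'n \<Rightarrow> real" using \<nu>_all that by simp
  have \<nu>0: "(\<integral>x. g x \<partial>\<nu> 0 b) = (\<integral>x. g x \<partial>M)" if "continuous_on UNIV g" for g :: "real^'n \<Rightarrow> real" and b
    using LIMSEQ_unique[OF lim[OF that, of 0 b]] by simp
  have dyadic: "\<exists>L\<ge>0. \<forall>a b a' b'. real a / 2 ^ b \<le> real a' / 2 ^ b' \<longrightarrow>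
      \<bar>(\<integral>x. g x \<partial>\<nu> a' b') - (\<integral>x. g x \<partial>\<nu> a b) - (real a' / 2 ^ b' - real a / 2 ^ b) * (\<integral>x. B g x \<partial>\<nu> a b)\<bar>
        \<le> L * (real a' / 2 ^ b' - real a / 2 ^ b)\<^sup>2" if g: "g \<in> \<G>" for g
  proof -
    obtain C L where CL: "\<And>M h k j. prob_on_K M \<Longrightarrow> 0 < h \<Longrightarrow> h \<le> 1 \<Longrightarrow>
      \<bar>(\<integral>x. g x \<partial>chain M h (k + j)) - (\<integral>x. g x \<partial>chain M h k)
          - (real j * h) * (\<integral>x. B g x \<partial>chain M h k)\<bar>
        \<le> C * (real j * h * sqrt h) + L * (real j * h)\<^sup>2"
      using chain_estimate[OF g] by metis
    have "\<bar>(\<integral>x. g x \<partial>\<nu> a' b') - (\<integral>x. g x \<partial>\<nu> a b) - (real a' / 2 ^ b' - real a / 2 ^ b) * (\<integral>x. B g x \<partial>\<nu> a b)\<bar>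
        \<le> max L 0 * (real a' / 2 ^ b' - real a / 2 ^ b)\<^sup>2"
      if le: "real a / 2 ^ b \<le> real a' / 2 ^ b'" for a b a' b'
    proof -
      let ?D = "real a' / 2 ^ b' - real a / 2 ^ b"
      let ?k = "\<lambda>n. a * 2 ^ (d n - b)" and ?k' = "\<lambda>n. a' * 2 ^ (d n - b')" and ?h = "\<lambda>n. 1 / 2 ^ d n :: real"
      have ev: "\<forall>\<^sub>F n in sequentially.
        \<bar>(\<integral>x. g x \<partial>chain M (?h n) (?k' n)) - (\<integral>x. g x \<partial>chain M (?h n) (?k n))
            - ?D * (\<integral>x. B g x \<partial>chain M (?h n) (?k n))\<bar>
          \<le> C * (?D * sqrt (?h n)) + L * ?D\<^sup>2"
      proof (rule eventually_sequentiallyI)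
        fix n assume n: "n \<ge> max b b'"
        then have dn: "d n \<ge> b" "d n \<ge> b'" using seq_suble[OF d, of n] by auto
        have scale: "real (i * 2 ^ (l - j)) * (1 / 2 ^ l) = real i / 2 ^ j" if "j \<le> l" for i j l
        proof -
          from that obtain u where "l = j + u" using le_Suc_ex by blast
          then show ?thesis by (simp add: power_add)
        qed
        have e: "real (?k n) * ?h n = real a / 2 ^ b" "real (?k' n) * ?h n = real a' / 2 ^ b'"
          using dn by (intro scale; simp)+
        have "real (?k n) * ?h n \<le> real (?k' n) * ?h n" unfolding e by (rule le)
        then have "?k n \<le> ?k' n" by (simp add: divide_le_cancel flip: of_nat_mult of_nat_power)
        then obtain j where j: "?k' n = ?k n + j" using le_Suc_ex by blast
        have "real j * ?h n = ?D"
          unfolding e[symmetric] j by (simp add: field_simps)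
        then show "\<bar>(\<integral>x. g x \<partial>chain M (?h n) (?k' n)) - (\<integral>x. g x \<partial>chain M (?h n) (?k n))
            - ?D * (\<integral>x. B g x \<partial>chain M (?h n) (?k n))\<bar>
          \<le> C * (?D * sqrt (?h n)) + L * ?D\<^sup>2"
          using CL[OF M, of "?h n" "?k n" j] unfolding j by (simp add: mult.assoc)
      qed
      have l1: "(\<lambda>n. \<bar>(\<integral>x. g x \<partial>chain M (?h n) (?k' n)) - (\<integral>x. g x \<partial>chain M (?h n) (?k n))
            - ?D * (\<integral>x. B g x \<partial>chain M (?h n) (?k n))\<bar>)
          \<longlonglongrightarrow> \<bar>(\<integral>x. g x \<partial>\<nu> a' b') - (\<integral>x. g x \<partial>\<nu> a b) - ?D * (\<integral>x. B g x \<partial>\<nu> a b)\<bar>"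
        by (intro tendsto_intros lim cont g B)
      have l2: "(\<lambda>n. C * (?D * sqrt (?h n)) + L * ?D\<^sup>2) \<longlonglongrightarrow> C * (?D * sqrt 0) + L * ?D\<^sup>2"
        using LIMSEQ_subseq_LIMSEQ[OF LIMSEQ_divide_realpow_zero[of 2 1] d]
        by (intro tendsto_intros) (simp_all add: o_def)
      have "\<bar>(\<integral>x. g x \<partial>\<nu> a' b') - (\<integral>x. g x \<partial>\<nu> a b) - ?D * (\<integral>x. B g x \<partial>\<nu> a b)\<bar>
          \<le> C * (?D * sqrt 0) + L * ?D\<^sup>2"
        by (rule tendsto_le[OF sequentially_bot l2 l1 ev])
      then have "\<bar>(\<integral>x. g x \<partial>\<nu> a' b') - (\<integral>x. g x \<partial>\<nu> a b) - ?D * (\<integral>x. B g x \<partial>\<nu> a b)\<bar> \<le> L * ?D\<^sup>2"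
        by simp
      also have "\<dots> \<le> max L 0 * ?D\<^sup>2" by (intro mult_right_mono) auto
      finally show ?thesis .
    qed
    then show ?thesis by (intro exI[of _ "max L 0"]) auto
  qed
  \<comment> \<open>A modulus of continuity in time, independent of the dyadic representation and of
    the order of the two times.\<close>
  have lip: "\<exists>L. \<forall>a b a' b'. \<bar>(\<integral>x. g x \<partial>\<nu> a' b') - (\<integral>x. g x \<partial>\<nu> a b)\<bar>
      \<le> L * (\<bar>real a' / 2 ^ b' - real a / 2 ^ b\<bar> + (real a' / 2 ^ b' - real a / 2 ^ b)\<^sup>2)"
    if g: "g \<in> \<G>" for g
  proof -
    obtain L where L: "L \<ge> 0" "\<And>a b a' b'. real a / 2 ^ b \<le> real a' / 2 ^ b' \<Longrightarrow>
      \<bar>(\<integral>x. g x \<partial>\<nu> a' b') - (\<integral>x. g x \<partial>\<nu> a b) - (real a' / 2 ^ b' - real a / 2 ^ b) * (\<integral>x. B g x \<partial>\<nu> a b)\<bar>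
        \<le> L * (real a' / 2 ^ b' - real a / 2 ^ b)\<^sup>2" using dyadic[OF g] by metis
    obtain b0 where b0: "b0 \<ge> 0" "\<And>x. x \<in> K \<Longrightarrow> \<bar>B g x\<bar> \<le> b0"
      using bounded_on_K[OF cont[OF B[OF g]]] by blast
    have Bb: "\<bar>\<integral>x. B g x \<partial>\<nu> a b\<bar> \<le> b0" for a b
      using b0(2) cont[OF B[OF g]]
      by (intro abs_integral_on_K(1)[OF \<nu>] borel_measurable_continuous_onI) auto
    have *: "\<bar>(\<integral>x. g x \<partial>\<nu> a' b') - (\<integral>x. g x \<partial>\<nu> a b)\<bar>
      \<le> (L + b0) * (\<bar>real a' / 2 ^ b' - real a / 2 ^ b\<bar> + (real a' / 2 ^ b' - real a / 2 ^ b)\<^sup>2)"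
      if le: "real a / 2 ^ b \<le> real a' / 2 ^ b'" for a b a' b'
    proof -
      let ?D = "real a' / 2 ^ b' - real a / 2 ^ b"
      have D: "0 \<le> ?D" using le by simp
      have *: "\<bar>q\<bar> \<le> (L + b0) * (\<bar>D\<bar> + D\<^sup>2)"
        if "\<bar>p\<bar> \<le> b0" "\<bar>q - D * p\<bar> \<le> L * D\<^sup>2" "0 \<le> D" for p q D :: real
      proof -
        have "\<bar>D * p\<bar> \<le> D * b0" using that by (simp add: abs_mult mult_left_mono)
        moreover have "0 \<le> L * D" "0 \<le> b0 * D\<^sup>2" using L(1) b0(1) that by auto
        moreover have "\<bar>q\<bar> \<le> L * D\<^sup>2 + \<bar>D * p\<bar>" using that(2) by arith
        moreover have "(L + b0) * (\<bar>D\<bar> + D\<^sup>2) = L * D + D * b0 + L * D\<^sup>2 + b0 * D\<^sup>2"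
          using that(3) by (simp add: algebra_simps)
        ultimately show ?thesis by linarith
      qed
      show ?thesis by (rule *[OF Bb L(2)[OF le] D])
    qed
    have "\<bar>(\<integral>x. g x \<partial>\<nu> a' b') - (\<integral>x. g x \<partial>\<nu> a b)\<bar>
      \<le> (L + b0) * (\<bar>real a' / 2 ^ b' - real a / 2 ^ b\<bar> + (real a' / 2 ^ b' - real a / 2 ^ b)\<^sup>2)" for a b a' b'
    proof (cases "real a / 2 ^ b \<le> real a' / 2 ^ b'")
      case True then show ?thesis by (rule *)
    next
      case False
      then have "real a' / 2 ^ b' \<le> real a / 2 ^ b" by simp
      from *[OF this] show ?thesis
        by (simp add: abs_minus_commute power2_commute)
    qed
    then show ?thesis by blast
  qed
  define a where "a t n = nat \<lfloor>2 ^ n * t\<rfloor>" for t :: real and n :: nat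
  define q where "q t n = real (a t n) / 2 ^ n" for t n
  have q: "q t n \<le> t" "t - 1 / 2 ^ n \<le> q t n" if "t \<ge> 0" for t n
  proof -
    have "real (a t n) = real_of_int \<lfloor>2 ^ n * t\<rfloor>" using that by (simp add: a_def)
    then have "2 ^ n * t - 1 \<le> real (a t n)" "real (a t n) \<le> 2 ^ n * t" by linarith+
    then have "(2 ^ n * t - 1) / 2 ^ n \<le> q t n" "q t n \<le> (2 ^ n * t) / 2 ^ n"
      unfolding q_def by (intro divide_right_mono; simp)+
    then show "q t n \<le> t" "t - 1 / 2 ^ n \<le> q t n" by (simp_all add: diff_divide_distrib)
  qed
  have q_lim: "q t \<longlonglongrightarrow> t" if "t \<ge> 0" for t
  proof -
    have "(\<lambda>k. t - 1 / 2 ^ k) \<longlonglongrightarrow> t - 0"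
      by (intro tendsto_intros LIMSEQ_divide_realpow_zero) auto
    then show ?thesis
      using q[OF that] by (intro tendsto_sandwich[of "\<lambda>k. t - 1 / 2 ^ k" "q t" sequentially "\<lambda>_. t" t]) auto
  qed
  have q_mono: "q s n \<le> q t n" if "s \<le> t" for s t n
    unfolding q_def a_def using that
    by (intro divide_right_mono of_nat_mono nat_mono floor_mono mult_left_mono) auto
  \<comment> \<open>The weak limit at each time is again taken along a subsequence. At
    \<open>t = 0\<close> the measure \<open>M\<close> itself is chosen, because the claim is
    equality with the initial measure and not just equality of integrals.\<close>
  have "\<exists>M' r. prob_on_K M' \<and> (t = 0 \<longrightarrow> M' = M) \<and> strict_mono (r :: nat \<Rightarrow> nat) \<and>
      (\<forall>g::real^'n \<Rightarrow> real. continuous_on UNIV g \<longrightarrow>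
        (\<lambda>n. \<integral>x. g x \<partial>\<nu> (a t (r n)) (r n)) \<longlonglongrightarrow> (\<integral>x. g x \<partial>M'))" for t
  proof (cases "t = 0")
    case True
    then show ?thesis
      using M by (intro exI[of _ M] exI[of _ id]) (auto simp: a_def \<nu>0 strict_mono_def)
  next
    case False
    then show ?thesis
      using weakly_convergent_subsequence[of "\<lambda>n. \<nu> (a t n) n", OF _ _ K] \<nu>
      unfolding prob_on_K_def by blast
  qed
  then have "\<forall>t. \<exists>M' r. prob_on_K M' \<and> (t = 0 \<longrightarrow> M' = M) \<and> strict_mono (r :: nat \<Rightarrow> nat) \<and>
      (\<forall>g::real^'n \<Rightarrow> real. continuous_on UNIV g \<longrightarrow>
        (\<lambda>n. \<integral>x. g x \<partial>\<nu> (a t (r n)) (r n)) \<longlonglongrightarrow> (\<integral>x. g x \<partial>M'))" by (rule allI)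
  from choice[OF this] obtain \<mu> where
    "\<forall>t. \<exists>r. prob_on_K (\<mu> t) \<and> (t = 0 \<longrightarrow> \<mu> t = M) \<and> strict_mono (r :: nat \<Rightarrow> nat) \<and>
      (\<forall>g::real^'n \<Rightarrow> real. continuous_on UNIV g \<longrightarrow>
        (\<lambda>n. \<integral>x. g x \<partial>\<nu> (a t (r n)) (r n)) \<longlonglongrightarrow> (\<integral>x. g x \<partial>\<mu> t))" by (elim exE)
  from choice[OF this] obtain r where
    \<mu>_all: "\<forall>t. prob_on_K (\<mu> t) \<and> (t = 0 \<longrightarrow> \<mu> t = M) \<and> strict_mono (r t :: nat \<Rightarrow> nat) \<and>
      (\<forall>g::real^'n \<Rightarrow> real. continuous_on UNIV g \<longrightarrow>
        (\<lambda>n. \<integral>x. g x \<partial>\<nu> (a t (r t n)) (r t n)) \<longlonglongrightarrow> (\<integral>x. g x \<partial>\<mu> t))" by (elim exE)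
  have \<mu>: "prob_on_K (\<mu> t)" "\<mu> 0 = M" and r: "strict_mono (r t :: nat \<Rightarrow> nat)"
    and \<mu>lim: "continuous_on UNIV (g :: real^'n \<Rightarrow> real) \<Longrightarrow>
        (\<lambda>n. \<integral>x. g x \<partial>\<nu> (a t (r t n)) (r t n)) \<longlonglongrightarrow> (\<integral>x. g x \<partial>\<mu> t)" for t g
    using \<mu>_all by simp_all
  \<comment> \<open>The subsequence \<open>r t\<close> varies with \<open>t\<close>, so two times
    can be compared only once convergence of the whole sequence is known for \<open>g\<close> in
    \<open>\<G>\<close>.\<close>
  have full: "(\<lambda>n. \<integral>x. g x \<partial>\<nu> (a t n) n) \<longlonglongrightarrow> (\<integral>x. g x \<partial>\<mu> t)" if g: "g \<in> \<G>" and t: "t \<ge> 0" for g t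
  proof -
    obtain L where L: "\<And>a b a' b'. \<bar>(\<integral>x. g x \<partial>\<nu> a' b') - (\<integral>x. g x \<partial>\<nu> a b)\<bar>
      \<le> L * (\<bar>real a' / 2 ^ b' - real a / 2 ^ b\<bar> + (real a' / 2 ^ b' - real a / 2 ^ b)\<^sup>2)"
      using lip[OF g] by blast
    have "\<bar>(\<integral>x. g x \<partial>\<mu> t) - (\<integral>x. g x \<partial>\<nu> (a t n) n)\<bar> \<le> L * (\<bar>t - q t n\<bar> + (t - q t n)\<^sup>2)" for n
    proof (rule tendsto_le[of sequentially])
      have "(\<lambda>k. q t (r t k)) \<longlonglongrightarrow> t"
        using LIMSEQ_subseq_LIMSEQ[OF q_lim[OF t] r[of t]] by (simp add: o_def)
      then show "(\<lambda>k. L * (\<bar>q t (r t k) - q t n\<bar> + (q t (r t k) - q t n)\<^sup>2))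
          \<longlonglongrightarrow> L * (\<bar>t - q t n\<bar> + (t - q t n)\<^sup>2)"
        by (intro tendsto_intros)
      show "(\<lambda>k. \<bar>(\<integral>x. g x \<partial>\<nu> (a t (r t k)) (r t k)) - (\<integral>x. g x \<partial>\<nu> (a t n) n)\<bar>)
          \<longlonglongrightarrow> \<bar>(\<integral>x. g x \<partial>\<mu> t) - (\<integral>x. g x \<partial>\<nu> (a t n) n)\<bar>"
        by (intro tendsto_intros \<mu>lim cont g)
    qed (use L in \<open>auto simp: q_def\<close>)
    then have bnd: "norm ((\<integral>x. g x \<partial>\<nu> (a t n) n) - (\<integral>x. g x \<partial>\<mu> t)) \<le> L * (\<bar>t - q t n\<bar> + (t - q t n)\<^sup>2)" for n
      by (simp add: abs_minus_commute)
    have "(\<lambda>n. L * (\<bar>t - q t n\<bar> + (t - q t n)\<^sup>2)) \<longlonglongrightarrow> L * (\<bar>t - t\<bar> + (t - t)\<^sup>2)"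
      by (intro tendsto_intros q_lim t)
    then have "(\<lambda>n. L * (\<bar>t - q t n\<bar> + (t - q t n)\<^sup>2)) \<longlonglongrightarrow> 0" by simp
    then have "(\<lambda>n. (\<integral>x. g x \<partial>\<nu> (a t n) n) - (\<integral>x. g x \<partial>\<mu> t)) \<longlonglongrightarrow> 0"
      by (rule Lim_null_comparison[OF always_eventually[OF allI[OF bnd]]])
    then show ?thesis by (rule LIM_zero_cancel)
  qed
  have "\<exists>C. \<forall>s t. 0 \<le> s \<longrightarrow> s \<le> t \<longrightarrow>
      \<bar>(\<integral>x. g x \<partial>\<mu> t) - (\<integral>x. g x \<partial>\<mu> s) - (t - s) * (\<integral>x. B g x \<partial>\<mu> s)\<bar> \<le> C * (t - s)\<^sup>2" if g: "g \<in> \<G>" for g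
  proof -
    obtain L where L: "\<And>a b a' b'. real a / 2 ^ b \<le> real a' / 2 ^ b' \<Longrightarrow>
      \<bar>(\<integral>x. g x \<partial>\<nu> a' b') - (\<integral>x. g x \<partial>\<nu> a b) - (real a' / 2 ^ b' - real a / 2 ^ b) * (\<integral>x. B g x \<partial>\<nu> a b)\<bar>
        \<le> L * (real a' / 2 ^ b' - real a / 2 ^ b)\<^sup>2" using dyadic[OF g] by metis
    have "\<bar>(\<integral>x. g x \<partial>\<mu> t) - (\<integral>x. g x \<partial>\<mu> s) - (t - s) * (\<integral>x. B g x \<partial>\<mu> s)\<bar> \<le> L * (t - s)\<^sup>2"
      if st: "0 \<le> s" "s \<le> t" for s t
    proof (rule tendsto_le[of sequentially])
      have t: "0 \<le> t" using st by simp
      show "(\<lambda>n. L * (q t n - q s n)\<^sup>2) \<longlonglongrightarrow> L * (t - s)\<^sup>2"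
        by (intro tendsto_intros q_lim t st)
      show "(\<lambda>n. \<bar>(\<integral>x. g x \<partial>\<nu> (a t n) n) - (\<integral>x. g x \<partial>\<nu> (a s n) n)
            - (q t n - q s n) * (\<integral>x. B g x \<partial>\<nu> (a s n) n)\<bar>)
          \<longlonglongrightarrow> \<bar>(\<integral>x. g x \<partial>\<mu> t) - (\<integral>x. g x \<partial>\<mu> s) - (t - s) * (\<integral>x. B g x \<partial>\<mu> s)\<bar>"
        by (intro tendsto_intros full q_lim t st g B)
      show "\<forall>\<^sub>F n in sequentially. \<bar>(\<integral>x. g x \<partial>\<nu> (a t n) n) - (\<integral>x. g x \<partial>\<nu> (a s n) n)
            - (q t n - q s n) * (\<integral>x. B g x \<partial>\<nu> (a s n) n)\<bar> \<le> L * (q t n - q s n)\<^sup>2"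
        using L q_mono[OF st(2)] by (auto simp: q_def)
    qed simp
    then show ?thesis by blast
  qed
  then show ?thesis using \<mu> by (intro exI[of _ \<mu>]) simp
qed

end

section \<open>Smooth functions and rotation fields\<close>

lemma has_derivative_partial:
  assumes "f differentiable (at x)"
  shows "(f has_derivative (\<lambda>v. \<Sum>\<mu>\<in>UNIV. v $ \<mu> * partial \<mu> f x)) (at x)"
proof -
  let ?F = "frechet_derivative f (at x)"
  have d: "(f has_derivative ?F) (at x)" using assms by (simp add: frechet_derivative_works)
  then have lin: "linear ?F" by (rule has_derivative_linear)
  have "?F v = (\<Sum>\<mu>\<in>UNIV. v $ \<mu> * partial \<mu> f x)" for v
  proof -
    have "?F v = ?F (\<Sum>\<mu>\<in>UNIV. v $ \<mu> *s axis \<mu> 1)" by (simp add: basis_expansion)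
    also have "\<dots> = (\<Sum>\<mu>\<in>UNIV. v $ \<mu> * partial \<mu> f x)"
      unfolding partial_def linear_sum[OF lin] scalar_mult_eq_scaleR linear_cmul[OF lin] by simp
    finally show ?thesis .
  qed
  then have "?F = (\<lambda>v. \<Sum>\<mu>\<in>UNIV. v $ \<mu> * partial \<mu> f x)" by (rule ext)
  with d show ?thesis by simp
qed

lemma partial_eqI: "(f has_derivative F) (at x) \<Longrightarrow> partial \<mu> f x = F (axis \<mu> 1)"
  unfolding partial_def by (simp add: frechet_derivative_at[symmetric])

lemma partial_const [simp]: "partial \<mu> (\<lambda>x. c) = (\<lambda>x. 0)"
  by (rule ext, rule partial_eqI[OF has_derivative_const, THEN trans]) simp

lemma partial_coord: "partial \<mu> (\<lambda>x. x $ \<nu>) = (\<lambda>x. if \<mu> = \<nu> then 1 else 0)"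
proof (rule ext)
  fix x :: "real^3"
  have "((\<lambda>x::real^3. x $ \<nu>) has_derivative (\<lambda>v. v $ \<nu>)) (at x)"
    by (rule bounded_linear_imp_has_derivative) (rule bounded_linear_vec_nth)
  from partial_eqI[OF this] show "partial \<mu> (\<lambda>x. x $ \<nu>) x = (if \<mu> = \<nu> then 1 else 0)"
    by (simp add: axis_def eq_commute)
qed

lemma partial_add:
  assumes "f differentiable (at x)" "g differentiable (at x)"
  shows "partial \<mu> (\<lambda>x. f x + g x) x = partial \<mu> f x + partial \<mu> g x"
  using partial_eqI[OF has_derivative_add[OF has_derivative_partial[OF assms(1)] has_derivative_partial[OF assms(2)]], of \<mu>]
  by (simp add: axis_def if_distrib[of "\<lambda>c. c * _"] cong: if_cong)

lemma partial_mult: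
  fixes f g :: "real^3 \<Rightarrow> real"
  assumes "f differentiable (at x)" "g differentiable (at x)"
  shows "partial \<mu> (\<lambda>x. f x * g x) x = f x * partial \<mu> g x + partial \<mu> f x * g x"
  using partial_eqI[OF has_derivative_mult[OF has_derivative_partial[OF assms(1)] has_derivative_partial[OF assms(2)]], of \<mu>]
  by (simp add: axis_def if_distrib[of "\<lambda>c. c * _"] cong: if_cong)

lemma partial_linear_comp:
  assumes f: "f differentiable (at (L x))" and L: "bounded_linear L"
  shows "partial \<mu> (\<lambda>x. f (L x)) x = (\<Sum>\<nu>\<in>UNIV. L (axis \<mu> 1) $ \<nu> * partial \<nu> f (L x))"
proof -
  have "((\<lambda>x. f (L x)) has_derivative (\<lambda>v. \<Sum>\<nu>\<in>UNIV. L v $ \<nu> * partial \<nu> f (L x))) (at x)"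
    using has_derivative_compose[OF bounded_linear_imp_has_derivative[OF L] has_derivative_partial[OF f]] .
  then show ?thesis by (rule partial_eqI)
qed

section \<open>Closure properties of smooth functions\<close>

lemma C_diff_SucD: "C_diff (Suc k) f \<Longrightarrow> C_diff k f"
proof (induction k arbitrary: f)
  case 0
  then show ?case
    by (auto intro!: differentiable_imp_continuous_on simp: differentiable_on_def)
next
  case (Suc k)
  then show ?case by auto
qed

lemma C_diff_const [simp]: "C_diff k (\<lambda>x. c)"
  by (induction k arbitrary: c) auto

lemma C_diff_coord [simp]: "C_diff k (\<lambda>x. x $ \<nu>)"
proof (cases k)
  case (Suc k')
  have "(\<lambda>x::real^3. x $ \<nu>) differentiable (at x)" for x
    using bounded_linear_imp_differentiable[OF bounded_linear_vec_nth] by blast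
  then show ?thesis by (simp add: Suc partial_coord)
qed (auto intro!: continuous_intros)

lemma C_diff_add: "C_diff k f \<Longrightarrow> C_diff k g \<Longrightarrow> C_diff k (\<lambda>x. f x + g x)"
proof (induction k arbitrary: f g)
  case (Suc k)
  then have "partial \<mu> (\<lambda>x. f x + g x) = (\<lambda>x. partial \<mu> f x + partial \<mu> g x)" for \<mu>
    by (intro ext partial_add) auto
  with Suc show ?case by (auto intro: differentiable_add)
qed (auto intro: continuous_intros)

lemma C_diff_mult: "C_diff k f \<Longrightarrow> C_diff k g \<Longrightarrow> C_diff k (\<lambda>x. f x * g x)"
proof (induction k arbitrary: f g)
  case (Suc k)
  have "partial \<mu> (\<lambda>x. f x * g x) = (\<lambda>x. f x * partial \<mu> g x + partial \<mu> f x * g x)" for \<mu>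
    using Suc.prems by (intro ext partial_mult) auto
  moreover have "C_diff k f" "C_diff k g" by (rule Suc.prems[THEN C_diff_SucD])+
  ultimately show ?case
    using Suc by (auto intro!: C_diff_add Suc.IH differentiable_mult)
qed (auto intro: continuous_intros)

lemma C_diff_linear_comp:
  assumes L: "bounded_linear (L :: real^3 \<Rightarrow> real^3)"
  shows "C_diff k f \<Longrightarrow> C_diff k (\<lambda>x. f (L x))"
proof (induction k arbitrary: f)
  case 0
  then show ?case
    using continuous_on_compose2[of UNIV f UNIV L] L
    by (simp add: linear_continuous_on)
next
  case (Suc k)
  have d: "f differentiable (at x)" for x using Suc.prems by auto
  have "(\<lambda>x. f (L x)) differentiable (at x)" for x
    using has_derivative_compose[OF bounded_linear_imp_has_derivative[OF L] has_derivative_partial[OF d]]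
    by (rule differentiableI)
  moreover have "partial \<mu> (\<lambda>x. f (L x)) = (\<lambda>x. \<Sum>\<nu>\<in>UNIV. L (axis \<mu> 1) $ \<nu> * partial \<nu> f (L x))" for \<mu>
    by (intro ext partial_linear_comp d L)
  moreover have "C_diff k (\<lambda>x. \<Sum>\<nu>\<in>UNIV. L (axis \<mu> 1) $ \<nu> * partial \<nu> f (L x))" for \<mu>
    unfolding sum_3 using Suc by (intro C_diff_add C_diff_mult C_diff_const Suc.IH) auto
  ultimately show ?case by simp
qed

lemma smooth_const [simp]: "smooth (\<lambda>x. c)" and smooth_coord [simp]: "smooth (\<lambda>x. x $ \<nu>)"
  by (simp_all add: smooth_def)

lemma smooth_add: "smooth f \<Longrightarrow> smooth g \<Longrightarrow> smooth (\<lambda>x. f x + g x)"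
  and smooth_mult: "smooth f \<Longrightarrow> smooth g \<Longrightarrow> smooth (\<lambda>x. f x * g x)"
  by (simp_all add: smooth_def C_diff_add C_diff_mult)

lemma smooth_uminus: "smooth f \<Longrightarrow> smooth (\<lambda>x. - f x)"
  using smooth_mult[of "\<lambda>x. -1" f] by simp

lemma smooth_diff: "smooth f \<Longrightarrow> smooth g \<Longrightarrow> smooth (\<lambda>x. f x - g x)"
  using smooth_add[of f "\<lambda>x. - g x"] smooth_uminus[of g] by simp

lemma smooth_power: "smooth f \<Longrightarrow> smooth (\<lambda>x. f x ^ n)"
  by (induction n) (auto intro: smooth_mult)

lemma smooth_sum: "(\<And>i. i \<in> I \<Longrightarrow> smooth (f i)) \<Longrightarrow> smooth (\<lambda>x. \<Sum>i\<in>I. f i x)"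
  by (induction I rule: infinite_finite_induct) (auto intro: smooth_add)

lemma smooth_linear_comp: "bounded_linear L \<Longrightarrow> smooth f \<Longrightarrow> smooth (\<lambda>x. f (L x))"
  by (simp add: smooth_def C_diff_linear_comp)

lemma smooth_scale: "smooth f \<Longrightarrow> smooth (\<lambda>x. f (c *\<^sub>R x))"
  by (rule smooth_linear_comp[OF bounded_linear_scaleR_right])

lemma smooth_partial: "smooth f \<Longrightarrow> smooth (partial \<mu> f)"
  unfolding smooth_def by (metis C_diff.simps(2))

lemma smooth_differentiable: "smooth f \<Longrightarrow> f differentiable (at x)"
  unfolding smooth_def by (metis C_diff.simps(2))

lemma smooth_continuous: "smooth f \<Longrightarrow> continuous_on A f"
  unfolding smooth_def by (metis C_diff.simps(1) continuous_on_subset subset_UNIV)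

lemmas smooth_intros = smooth_const smooth_coord smooth_add smooth_mult smooth_diff smooth_uminus
  smooth_power smooth_sum smooth_scale smooth_partial

lemma smooth_borel_measurable: "smooth f \<Longrightarrow> f \<in> borel_measurable borel"
  by (intro borel_measurable_continuous_onI smooth_continuous)

section \<open>The rotation fields as derivations\<close>

abbreviation rot :: "3 \<Rightarrow> (real^3 \<Rightarrow> real) \<Rightarrow> real^3 \<Rightarrow> real" where
  "rot \<mu> \<equiv> poisson (classical_spin \<mu>)"

lemma poisson_eq:
  "poisson f g x = x $ 1 * (partial 2 f x * partial 3 g x - partial 3 f x * partial 2 g x)
    + x $ 2 * (partial 3 f x * partial 1 g x - partial 1 f x * partial 3 g x)
    + x $ 3 * (partial 1 f x * partial 2 g x - partial 2 f x * partial 1 g x)"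
  by (simp add: poisson_def cross3_simps inner_vec_def sum_3)

lemma partial_classical_spin: "partial \<mu> (classical_spin \<nu>) x = (if \<mu> = \<nu> then 1 else 0)"
  using partial_coord[of \<mu> \<nu>] unfolding classical_spin_def[abs_def] by simp

lemma rot_eq:
  "rot 1 g x = x $ 3 * partial 2 g x - x $ 2 * partial 3 g x"
  "rot 2 g x = x $ 1 * partial 3 g x - x $ 3 * partial 1 g x"
  "rot 3 g x = x $ 2 * partial 1 g x - x $ 1 * partial 2 g x"
  by (simp_all add: poisson_eq partial_classical_spin)

lemma rot_cases:
  fixes P :: "3 \<Rightarrow> bool"
  assumes "P 1" "P 2" "P 3"
  shows "P \<mu>"
  using assms exhaust_3[of \<mu>] by auto

lemma smooth_classical_spin [simp]: "smooth (classical_spin \<mu>)"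
  unfolding classical_spin_def[abs_def] by simp

lemma smooth_poisson: "smooth f \<Longrightarrow> smooth g \<Longrightarrow> smooth (poisson f g)"
  unfolding poisson_eq[abs_def] by (intro smooth_intros)

lemma smooth_rot: "smooth g \<Longrightarrow> smooth (rot \<mu> g)"
  by (intro smooth_poisson smooth_classical_spin)

lemma rot_add: "smooth f \<Longrightarrow> smooth g \<Longrightarrow> rot \<mu> (\<lambda>x. f x + g x) x = rot \<mu> f x + rot \<mu> g x"
  by (simp add: poisson_eq partial_add smooth_differentiable algebra_simps)

lemma rot_mult: "smooth f \<Longrightarrow> smooth g \<Longrightarrow>
    rot \<mu> (\<lambda>x. f x * g x) x = f x * rot \<mu> g x + rot \<mu> f x * g x"
  by (simp add: poisson_eq partial_mult smooth_differentiable algebra_simps)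

lemma rot_const [simp]: "rot \<mu> (\<lambda>x. c) x = 0"
  by (simp add: poisson_eq)

lemma rot_cmult: "smooth f \<Longrightarrow> rot \<mu> (\<lambda>x. c * f x) x = c * rot \<mu> f x"
  using rot_mult[of "\<lambda>x. c" f \<mu> x] by simp

lemma rot_diff: "smooth f \<Longrightarrow> smooth g \<Longrightarrow> rot \<mu> (\<lambda>x. f x - g x) x = rot \<mu> f x - rot \<mu> g x"
  using rot_add[of f "\<lambda>x. - 1 * g x" \<mu> x] rot_cmult[of g \<mu> "-1" x]
  by (simp add: smooth_uminus)

lemma rot_coord:
  "rot 1 (\<lambda>x. x $ 1) x = 0" "rot 1 (\<lambda>x. x $ 2) x = x $ 3" "rot 1 (\<lambda>x. x $ 3) x = - x $ 2"
  "rot 2 (\<lambda>x. x $ 1) x = - x $ 3" "rot 2 (\<lambda>x. x $ 2) x = 0" "rot 2 (\<lambda>x. x $ 3) x = x $ 1"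
  "rot 3 (\<lambda>x. x $ 1) x = x $ 2" "rot 3 (\<lambda>x. x $ 2) x = - x $ 1" "rot 3 (\<lambda>x. x $ 3) x = 0"
  by (simp_all add: rot_eq partial_coord)

text \<open>Rotation fields commute with dilations. This moves the equation between the sphere of
  radius S, on which the classical variables live, and the unit sphere of the coherent
  states.\<close>

lemma rot_scale:
  assumes "smooth f"
  shows "rot \<mu> f (c *\<^sub>R x) = rot \<mu> (\<lambda>y. f (c *\<^sub>R y)) x"
proof -
  have "partial \<nu> (\<lambda>y. f (c *\<^sub>R y)) x = c * partial \<nu> f (c *\<^sub>R x)" for \<nu>
    by (subst partial_linear_comp)
      (auto simp: smooth_differentiable[OF assms] bounded_linear_scaleR_right axis_def
        if_distrib[of "\<lambda>d. d * _"] if_distrib[of "\<lambda>d. c * d"] cong: if_cong)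
  then show ?thesis by (simp add: poisson_eq partial_classical_spin algebra_simps)
qed

text \<open>\<open>H_twist\<close> depends on the first coordinate only, so its bracket is its
  derivative in that coordinate times \<open>rot 1\<close>.\<close>

lemma poisson_H_twist:
  assumes "N \<ge> 1"
  shows "poisson (H_twist N \<kappa>) f x = \<kappa> / spin N * x $ 1 * rot 1 f x"
proof -
  have "H_twist N \<kappa> = (\<lambda>x. \<kappa> / (2 * spin N) * (x $ 1 * x $ 1))"
    by (simp add: H_twist_def classical_spin_def power2_eq_square fun_eq_iff)
  moreover have "partial \<mu> (\<lambda>x. \<kappa> / (2 * spin N) * (x $ 1 * x $ 1)) x
      = \<kappa> / spin N * x $ 1 * (if \<mu> = 1 then 1 else 0)" for \<mu> x
    using assms
    by (subst partial_mult partial_mult; (intro smooth_differentiable smooth_intros)?)+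
      (simp add: partial_coord spin_def)
  ultimately show ?thesis by (simp add: poisson_eq partial_classical_spin algebra_simps)
qed

lemma poisson_H_kick: "poisson (classical_spin \<mu>) (H_kick p) x = p * rot \<mu> (\<lambda>x. x $ 3) x"
proof -
  have "H_kick p = (\<lambda>x. p * x $ 3)" by (simp add: H_kick_def classical_spin_def fun_eq_iff)
  then show ?thesis by (simp add: rot_cmult)
qed

section \<open>Walks on the sphere\<close>

definition dir_deriv :: "real^3 \<Rightarrow> (real^3 \<Rightarrow> real) \<Rightarrow> real^3 \<Rightarrow> real" where
  "dir_deriv v f x = (\<Sum>i\<in>UNIV. v $ i * partial i f x)"

lemma smooth_dir_deriv: "smooth f \<Longrightarrow> smooth (dir_deriv v f)"
  unfolding dir_deriv_def[abs_def] by (intro smooth_intros)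

lemma dir_deriv_add: "dir_deriv (v + w) f x = dir_deriv v f x + dir_deriv w f x"
  by (simp add: dir_deriv_def algebra_simps sum.distrib)

lemma dir_deriv_scaleR: "dir_deriv (c *\<^sub>R v) f x = c * dir_deriv v f x"
  by (simp add: dir_deriv_def algebra_simps sum_distrib_left)

lemma dir_deriv_dir_deriv:
  assumes "smooth f"
  shows "dir_deriv v (dir_deriv w f) x = (\<Sum>i\<in>UNIV. \<Sum>j\<in>UNIV. v $ i * w $ j * partial i (partial j f) x)"
proof -
  have "partial i (dir_deriv w f) x = (\<Sum>j\<in>UNIV. w $ j * partial i (partial j f) x)" for i
    unfolding dir_deriv_def[abs_def] sum_3
    by (subst partial_add partial_mult; (intro smooth_differentiable smooth_intros assms)?)+ simp
  then show ?thesis by (simp add: dir_deriv_def sum_distrib_left mult.assoc)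
qed

lemma dir_deriv_has_real_derivative:
  assumes "smooth f"
  shows "((\<lambda>s. f (x + s *\<^sub>R v)) has_real_derivative dir_deriv v f (x + s *\<^sub>R v)) (at s)"
proof -
  have "((\<lambda>s. x + s *\<^sub>R v) has_derivative (\<lambda>t. t *\<^sub>R v)) (at s)"
    by (auto intro!: derivative_eq_intros)
  from has_derivative_compose[OF this has_derivative_partial[OF smooth_differentiable[OF assms]]]
  have "((\<lambda>s. f (x + s *\<^sub>R v)) has_derivative (\<lambda>t. t * dir_deriv v f (x + s *\<^sub>R v))) (at s)"
    by (simp add: dir_deriv_def sum_distrib_left mult.assoc)
  then show ?thesis by (simp add: has_field_derivative_def mult.commute[of _ "dir_deriv _ _ _"])
qed

lemma abs_dir_deriv_le: "\<bar>dir_deriv v f x\<bar> \<le> norm v * (\<Sum>i\<in>UNIV. \<bar>partial i f x\<bar>)"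
proof -
  have "\<bar>dir_deriv v f x\<bar> \<le> (\<Sum>i\<in>UNIV. \<bar>v $ i * partial i f x\<bar>)"
    unfolding dir_deriv_def by (rule sum_abs)
  also have "\<dots> \<le> (\<Sum>i\<in>UNIV. norm v * \<bar>partial i f x\<bar>)"
    by (intro sum_mono) (auto simp: abs_mult intro!: mult_right_mono component_le_norm_cart)
  finally show ?thesis by (simp add: sum_distrib_left)
qed

lemma smooth_bounded:
  assumes "smooth f" "compact S"
  shows "\<exists>b\<ge>0. \<forall>x\<in>S. \<bar>f x\<bar> \<le> b"
proof -
  have "bounded (f ` S)"
    by (intro compact_imp_bounded compact_continuous_image smooth_continuous assms)
  then obtain b where "\<forall>y\<in>f ` S. \<bar>y\<bar> \<le> b" by (auto simp: bounded_real)
  then show ?thesis by (intro exI[of _ "max b 0"]) auto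
qed

lemma partials_bounded:
  assumes "smooth f" "compact S"
  shows "\<exists>b\<ge>0. \<forall>x\<in>S. \<forall>v. \<bar>dir_deriv v f x\<bar> \<le> b * norm v"
proof -
  have "\<exists>b\<ge>0. \<forall>x\<in>S. \<bar>partial i f x\<bar> \<le> b" for i
    by (intro smooth_bounded smooth_partial assms)
  then obtain b where b: "\<And>i. b i \<ge> 0" "\<And>i x. x \<in> S \<Longrightarrow> \<bar>partial i f x\<bar> \<le> b i" by metis
  have "\<bar>dir_deriv v f x\<bar> \<le> (\<Sum>i\<in>UNIV. b i) * norm v" if "x \<in> S" for x v
  proof -
    have "norm v * (\<Sum>i\<in>UNIV. \<bar>partial i f x\<bar>) \<le> norm v * (\<Sum>i\<in>UNIV. b i)"
      by (intro mult_left_mono sum_mono b that) auto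
    then show ?thesis using abs_dir_deriv_le[of v f x] by (simp add: mult.commute)
  qed
  then show ?thesis using b(1) by (intro exI[of _ "\<Sum>i\<in>UNIV. b i"]) (auto intro: sum_nonneg)
qed

lemma dir_deriv2_bounded:
  assumes "smooth f" "compact S"
  shows "\<exists>b\<ge>0. \<forall>x\<in>S. \<forall>v w. \<bar>dir_deriv v (dir_deriv w f) x\<bar> \<le> b * (norm v * norm w)"
proof -
  have "\<exists>b\<ge>0. \<forall>x\<in>S. \<forall>v. \<bar>dir_deriv v (partial j f) x\<bar> \<le> b * norm v" for j
    by (intro partials_bounded smooth_partial assms)
  then obtain b where b: "\<And>j. b j \<ge> 0"
    "\<And>j x v. x \<in> S \<Longrightarrow> \<bar>dir_deriv v (partial j f) x\<bar> \<le> b j * norm v" by metis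
  have "\<bar>dir_deriv v (dir_deriv w f) x\<bar> \<le> (\<Sum>j\<in>UNIV. b j) * (norm v * norm w)" if "x \<in> S" for x v w
  proof -
    have "dir_deriv v (dir_deriv w f) x = (\<Sum>j\<in>UNIV. w $ j * dir_deriv v (partial j f) x)"
      unfolding dir_deriv_dir_deriv[OF assms(1)] dir_deriv_def[of v "partial _ f"]
      by (subst sum.swap) (simp add: sum_distrib_left mult_ac)
    also have "\<bar>\<dots>\<bar> \<le> (\<Sum>j\<in>UNIV. \<bar>w $ j * dir_deriv v (partial j f) x\<bar>)" by (rule sum_abs)
    also have "\<dots> \<le> (\<Sum>j\<in>UNIV. norm w * (b j * norm v))"
      unfolding abs_mult by (intro sum_mono mult_mono b that component_le_norm_cart) auto
    also have "\<dots> = (\<Sum>j\<in>UNIV. b j) * (norm v * norm w)"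
      by (simp add: sum_distrib_right sum_distrib_left mult_ac)
    finally show ?thesis .
  qed
  then show ?thesis using b(1) by (intro exI[of _ "\<Sum>i\<in>UNIV. b i"]) (auto intro: sum_nonneg)
qed

lemma dir_deriv3_bounded:
  assumes "smooth f" "compact S"
  shows "\<exists>b\<ge>0. \<forall>x\<in>S. \<forall>v. \<bar>dir_deriv v (dir_deriv v (dir_deriv v f)) x\<bar> \<le> b * norm v ^ 3"
proof -
  have "\<exists>b\<ge>0. \<forall>x\<in>S. \<forall>v w. \<bar>dir_deriv v (dir_deriv w (partial j f)) x\<bar> \<le> b * (norm v * norm w)" for j
    by (intro dir_deriv2_bounded smooth_partial assms)
  then obtain b where b: "\<And>j. b j \<ge> 0"
    "\<And>j x v w. x \<in> S \<Longrightarrow> \<bar>dir_deriv v (dir_deriv w (partial j f)) x\<bar> \<le> b j * (norm v * norm w)"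
    by metis
  have lin: "dir_deriv v (dir_deriv v (dir_deriv v f)) x
      = (\<Sum>j\<in>UNIV. v $ j * dir_deriv v (dir_deriv v (partial j f)) x)" for v x
  proof -
    have d1: "dir_deriv w (\<lambda>x. \<Sum>j\<in>UNIV. v $ j * g j x) x = (\<Sum>j\<in>UNIV. v $ j * dir_deriv w (g j) x)"
      if "\<And>j. smooth (g j)" for w g x
    proof -
      have "partial i (\<lambda>x. \<Sum>j\<in>UNIV. v $ j * g j x) x = (\<Sum>j\<in>UNIV. v $ j * partial i (g j) x)" for i
        unfolding sum_3
        by (subst partial_add partial_mult; (intro smooth_differentiable smooth_intros that)?)+ simp
      then show ?thesis
        by (simp add: dir_deriv_def sum_3 algebra_simps)
    qed
    show ?thesis
      by (simp only: dir_deriv_def[of v f, abs_def] d1[OF smooth_partial[OF assms(1)], abs_def]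
          d1[OF smooth_dir_deriv[OF smooth_partial[OF assms(1)]]])
  qed
  have "\<bar>dir_deriv v (dir_deriv v (dir_deriv v f)) x\<bar> \<le> (\<Sum>j\<in>UNIV. b j) * norm v ^ 3" if "x \<in> S" for x v
  proof -
    have "\<bar>dir_deriv v (dir_deriv v (dir_deriv v f)) x\<bar>
        \<le> (\<Sum>j\<in>UNIV. \<bar>v $ j * dir_deriv v (dir_deriv v (partial j f)) x\<bar>)"
      unfolding lin by (rule sum_abs)
    also have "\<dots> \<le> (\<Sum>j\<in>UNIV. norm v * (b j * (norm v * norm v)))"
      unfolding abs_mult by (intro sum_mono mult_mono b that component_le_norm_cart) auto
    also have "\<dots> = (\<Sum>j\<in>UNIV. b j) * norm v ^ 3"
      by (simp add: sum_distrib_right sum_distrib_left mult_ac power3_eq_cube)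
    finally show ?thesis .
  qed
  then show ?thesis using b(1) by (intro exI[of _ "\<Sum>i\<in>UNIV. b i"]) (auto intro: sum_nonneg)
qed

text \<open>Taylor's formula in one variable along the chord from \<open>x\<close> to
  \<open>x + u\<close>. A chord of the sphere leaves the sphere but not the ball, which is why the
  constant is taken over the ball.\<close>

lemma smooth_taylor2:
  assumes f: "smooth f"
  shows "\<exists>C\<ge>0. \<forall>x\<in>cball 0 1. \<forall>u. x + u \<in> cball 0 1 \<longrightarrow>
    \<bar>f (x + u) - f x - dir_deriv u f x - dir_deriv u (dir_deriv u f) x / 2\<bar> \<le> C * norm u ^ 3"
proof -
  obtain b where b: "b \<ge> 0"
    "\<And>x v. x \<in> cball 0 1 \<Longrightarrow> \<bar>dir_deriv v (dir_deriv v (dir_deriv v f)) x\<bar> \<le> b * norm v ^ 3"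
    using dir_deriv3_bounded[OF f compact_cball] by metis
  have "\<bar>f (x + u) - f x - dir_deriv u f x - dir_deriv u (dir_deriv u f) x / 2\<bar> \<le> b * norm u ^ 3"
    if x: "x \<in> cball 0 1" "x + u \<in> cball 0 1" for x u
  proof -
    define diff where "diff m s = (dir_deriv u ^^ m) f (x + s *\<^sub>R u)" for m s
    have sm: "smooth ((dir_deriv u ^^ m) f)" for m
      by (induction m) (auto intro: f smooth_dir_deriv)
    have D: "DERIV (diff m) t :> diff (Suc m) t" for m t
      unfolding diff_def using dir_deriv_has_real_derivative[OF sm, of m x u t] by simp
    have "\<exists>t>0. t < 1 \<and> diff 0 1 = (\<Sum>m<3. diff m 0 / fact m * 1 ^ m) + diff 3 t / fact 3 * 1 ^ 3"
      by (rule Maclaurin[where diff = diff]) (use D in auto)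
    then obtain t where t: "0 < t" "t < 1"
      and eq: "diff 0 1 = (\<Sum>m<3. diff m 0 / fact m * 1 ^ m) + diff 3 t / fact 3 * 1 ^ 3"
      by blast
    have "x + t *\<^sub>R u = (1 - t) *\<^sub>R x + t *\<^sub>R (x + u)" by (simp add: algebra_simps)
    also have "\<dots> \<in> cball 0 1"
      using t x convex_cball[of "0::real^3" 1] by (intro convexD) auto
    finally have "\<bar>diff 3 t\<bar> \<le> b * norm u ^ 3"
      using b(2)[of "x + t *\<^sub>R u" u] by (simp add: diff_def numeral_3_eq_3)
    moreover have "f (x + u) = f x + dir_deriv u f x + dir_deriv u (dir_deriv u f) x / 2 + diff 3 t / 6"
      using eq by (simp add: diff_def numeral_3_eq_3 lessThan_Suc fact_numeral)
    moreover have "0 \<le> b * norm u ^ 3" using b(1) by simp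
    ultimately show ?thesis by linarith
  qed
  then show ?thesis using b(1) by blast
qed

text \<open>Inverse stereographic projection of the tangent vector \<open>v / 2\<close> at \<open>x\<close>: a rational way of moving
  along the unit sphere.\<close>

definition sphere_step :: "real^3 \<Rightarrow> real^3 \<Rightarrow> real^3" where
  "sphere_step x v = (1 / (1 + v \<bullet> v / 4)) *\<^sub>R ((1 - v \<bullet> v / 4) *\<^sub>R x + v)"

lemma norm_sphere_step:
  assumes "norm x = 1" "v \<bullet> x = 0"
  shows "norm (sphere_step x v) = 1"
proof -
  define q where "q = v \<bullet> v"
  have q: "0 \<le> q" by (simp add: q_def)
  have "x \<bullet> x = 1" using assms(1) by (simp add: dot_square_norm)
  then have "((1 - q / 4) *\<^sub>R x + v) \<bullet> ((1 - q / 4) *\<^sub>R x + v) = (1 + q / 4)\<^sup>2"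
    using assms(2) by (simp add: inner_add_left inner_add_right inner_commute[of x v] power2_eq_square
        flip: q_def) (simp add: algebra_simps)
  then have "norm ((1 - q / 4) *\<^sub>R x + v) = 1 + q / 4"
    using q by (simp add: norm_eq_sqrt_inner)
  then show ?thesis using q by (simp add: sphere_step_def q_def[symmetric])
qed

lemma abs_le_combine:
  fixes a b c :: real
  assumes "\<bar>a - a' - b - c / 2\<bar> \<le> X" "\<bar>b - (d - e)\<bar> \<le> Y" "\<bar>c - f\<bar> \<le> Z"
  shows "\<bar>a - a' - (d + f / 2 - e)\<bar> \<le> X + Y + Z / 2"
  using assms by arith

text \<open>Up to third order the displacement is \<open>v\<close> minus |v|^2 / 2 times
  \<open>x\<close>. The second term is the curvature of the sphere and produces the radial
  derivative.\<close>

lemma sphere_step_expansion: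
  assumes G: "smooth G"
  shows "\<exists>C\<ge>0. \<forall>x v. norm x = 1 \<longrightarrow> v \<bullet> x = 0 \<longrightarrow> norm v \<le> R \<longrightarrow>
    \<bar>G (sphere_step x v) - G x
       - (dir_deriv v G x + dir_deriv v (dir_deriv v G) x / 2 - v \<bullet> v / 2 * dir_deriv x G x)\<bar>
      \<le> C * norm v ^ 3"
proof -
  obtain C where C: "C \<ge> 0" "\<And>x u. x \<in> cball 0 1 \<Longrightarrow> x + u \<in> cball 0 1 \<Longrightarrow>
    \<bar>G (x + u) - G x - dir_deriv u G x - dir_deriv u (dir_deriv u G) x / 2\<bar> \<le> C * norm u ^ 3"
    using smooth_taylor2[OF G] by metis
  obtain b1 where b1: "b1 \<ge> 0" "\<And>x v. x \<in> cball 0 1 \<Longrightarrow> \<bar>dir_deriv v G x\<bar> \<le> b1 * norm v"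
    using partials_bounded[OF G compact_cball] by metis
  obtain b2 where b2: "b2 \<ge> 0"
    "\<And>x v w. x \<in> cball 0 1 \<Longrightarrow> \<bar>dir_deriv v (dir_deriv w G) x\<bar> \<le> b2 * (norm v * norm w)"
    using dir_deriv2_bounded[OF G compact_cball] by metis
  \<comment> \<open>The displacement \<open>u\<close> satisfies |u| \<le> k |v|. The three summands
    of \<open>C'\<close> belong to the Taylor remainder, to the cubic part \<open>r\<close> of the
    displacement in the first-order term, and to the replacement of \<open>u\<close> by
    \<open>v\<close> in the second-order term.\<close>
  define k where "k = 1 + R / 2"
  define C' where "C' = C * k ^ 3 + b1 * (k / 4) + b2 * ((1 / 2 + R / 4 * k) * (k + 1)) / 2"
  have "\<bar>G (sphere_step x v) - G x
       - (dir_deriv v G x + dir_deriv v (dir_deriv v G) x / 2 - v \<bullet> v / 2 * dir_deriv x G x)\<bar>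
      \<le> C' * norm v ^ 3 \<and> C' \<ge> 0" if x: "norm x = 1" "v \<bullet> x = 0" and v: "norm v \<le> R" for x v
  proof -
    define n where "n = norm v"
    have n: "0 \<le> n" "n \<le> R" using v by (auto simp: n_def)
    have k: "k \<ge> 1" using n by (simp add: k_def)
    define u where "u = sphere_step x v - x"
    define d where "d = 1 + n\<^sup>2 / 4"
    have d: "d \<ge> 1" by (simp add: d_def)
    have vv: "v \<bullet> v = n\<^sup>2" by (simp add: n_def dot_square_norm)
    define w where "w = v - (n\<^sup>2 / 2) *\<^sub>R x"
    define r where "r = - (n\<^sup>2 / 4 / d) *\<^sub>R w"
    have "u = (1 / d) *\<^sub>R ((1 - n\<^sup>2 / 4) *\<^sub>R x + v) - (1 / d) *\<^sub>R (d *\<^sub>R x)"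
      using d unfolding u_def sphere_step_def vv d_def[symmetric] by simp
    also have "\<dots> = (1 / d) *\<^sub>R (v + ((1 - n\<^sup>2 / 4) *\<^sub>R x - d *\<^sub>R x))"
      by (simp add: scaleR_diff_right scaleR_add_right)
    also have "(1 - n\<^sup>2 / 4) *\<^sub>R x - d *\<^sub>R x = - (n\<^sup>2 / 2) *\<^sub>R x"
      by (simp add: d_def flip: scaleR_diff_left)
    finally have u: "u = (1 / d) *\<^sub>R w" by (simp add: w_def)
    have nw: "norm w \<le> n * k"
    proof -
      have "norm w \<le> n + n\<^sup>2 / 2"
        using norm_triangle_ineq4[of v "(n\<^sup>2 / 2) *\<^sub>R x"] x(1) by (simp add: w_def n_def)
      also have "\<dots> = n * (1 + n / 2)" by (simp add: power2_eq_square algebra_simps)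
      also have "\<dots> \<le> n * k" using n by (intro mult_left_mono) (auto simp: k_def)
      finally show ?thesis .
    qed
    have nu: "norm u \<le> n * k"
    proof -
      have "norm u = norm w / d" using d by (simp add: u)
      also have "\<dots> \<le> norm w / 1" using d by (intro divide_left_mono) auto
      finally show ?thesis using nw by simp
    qed
    have "1 / d + n\<^sup>2 / 4 / d = d / d" by (simp only: d_def add_divide_distrib)
    then have "1 / d = 1 - n\<^sup>2 / 4 / d" using d by simp
    then have "u = (1 - n\<^sup>2 / 4 / d) *\<^sub>R w" unfolding u by (rule arg_cong)
    then have ur: "u = w + r" unfolding r_def by (simp add: scaleR_left_diff_distrib)
    have nr: "norm r \<le> n ^ 3 * (k / 4)"
    proof -
      have "norm r = n\<^sup>2 / 4 / d * norm w" using d by (simp add: r_def)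
      also have "\<dots> \<le> n\<^sup>2 / 4 / 1 * (n * k)"
        using d nw n by (intro mult_mono divide_left_mono) auto
      finally show ?thesis by (simp add: power2_eq_square power3_eq_cube mult_ac)
    qed
    have nuv: "norm (u - v) \<le> n\<^sup>2 * (1 / 2 + R / 4 * k)"
    proof -
      have "u - v = r - (n\<^sup>2 / 2) *\<^sub>R x" by (simp add: ur w_def)
      then have "norm (u - v) \<le> norm r + n\<^sup>2 / 2"
        using norm_triangle_ineq4[of r "(n\<^sup>2 / 2) *\<^sub>R x"] x(1) by simp
      also have "\<dots> \<le> n\<^sup>2 * (n / 4 * k) + n\<^sup>2 / 2"
        using nr by (simp add: power2_eq_square power3_eq_cube mult_ac)
      also have "\<dots> = n\<^sup>2 * (1 / 2 + n / 4 * k)" by (simp add: algebra_simps)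
      also have "\<dots> \<le> n\<^sup>2 * (1 / 2 + R / 4 * k)"
        using n k by (intro mult_left_mono add_left_mono mult_right_mono) auto
      finally show ?thesis .
    qed
    have xu: "x \<in> cball 0 1" "x + u \<in> cball 0 1"
      using x norm_sphere_step[OF x] by (auto simp: u_def)
    have 1: "\<bar>G (x + u) - G x - dir_deriv u G x - dir_deriv u (dir_deriv u G) x / 2\<bar> \<le> C * k ^ 3 * n ^ 3"
    proof -
      have "C * norm u ^ 3 \<le> C * (n * k) ^ 3" using nu C(1) by (intro mult_left_mono power_mono) auto
      then show ?thesis using C(2)[OF xu] by (simp add: power_mult_distrib mult_ac)
    qed
    have 2: "\<bar>dir_deriv u G x - (dir_deriv v G x - n\<^sup>2 / 2 * dir_deriv x G x)\<bar> \<le> b1 * (k / 4) * n ^ 3"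
    proof -
      have "dir_deriv u G x - (dir_deriv v G x - n\<^sup>2 / 2 * dir_deriv x G x) = dir_deriv r G x"
        using dir_deriv_add[of w r G x] dir_deriv_add[of v "- (n\<^sup>2 / 2) *\<^sub>R x" G x]
          dir_deriv_scaleR[of "- (n\<^sup>2 / 2)" x G x]
        by (simp add: ur w_def)
      also have "\<bar>\<dots>\<bar> \<le> b1 * norm r" by (rule b1(2)[OF xu(1)])
      also have "\<dots> \<le> b1 * (n ^ 3 * (k / 4))" using nr b1(1) by (rule mult_left_mono)
      finally show ?thesis by (simp add: mult_ac)
    qed
    have 3: "\<bar>dir_deriv u (dir_deriv u G) x - dir_deriv v (dir_deriv v G) x\<bar>
        \<le> b2 * ((1 / 2 + R / 4 * k) * (k + 1)) * n ^ 3"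
    proof -
      have lin: "dir_deriv z (dir_deriv (a + c) G) x = dir_deriv z (dir_deriv a G) x + dir_deriv z (dir_deriv c G) x"
        for z a c unfolding dir_deriv_dir_deriv[OF G] by (simp add: algebra_simps sum.distrib)
      have "dir_deriv u (dir_deriv u G) x - dir_deriv v (dir_deriv v G) x
          = dir_deriv u (dir_deriv (u - v) G) x + dir_deriv (u - v) (dir_deriv v G) x"
        using lin[of u "u - v" v] dir_deriv_add[of "u - v" v "dir_deriv v G" x] by simp
      also have "\<bar>\<dots>\<bar> \<le> b2 * (norm u * norm (u - v)) + b2 * (norm (u - v) * norm v)"
        using b2(2)[OF xu(1), of u "u - v"] b2(2)[OF xu(1), of "u - v" v] by linarith
      also have "\<dots> = b2 * (norm (u - v) * (norm u + n))" by (simp add: n_def algebra_simps)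
      also have "\<dots> \<le> b2 * ((n\<^sup>2 * (1 / 2 + R / 4 * k)) * (n * k + n))"
        using nu nuv b2(1) n k by (intro mult_left_mono mult_mono) auto
      also have "\<dots> = b2 * ((1 / 2 + R / 4 * k) * (k + 1)) * n ^ 3"
        by (simp add: power2_eq_square power3_eq_cube algebra_simps)
      finally show ?thesis .
    qed
    have "C' * norm v ^ 3 = C * k ^ 3 * n ^ 3 + b1 * (k / 4) * n ^ 3
        + b2 * ((1 / 2 + R / 4 * k) * (k + 1)) * n ^ 3 / 2"
      by (simp add: C'_def n_def algebra_simps)
    moreover have "sphere_step x v = x + u" by (simp add: u_def)
    ultimately have "\<bar>G (sphere_step x v) - G x
       - (dir_deriv v G x + dir_deriv v (dir_deriv v G) x / 2 - v \<bullet> v / 2 * dir_deriv x G x)\<bar>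
      \<le> C' * norm v ^ 3"
      using abs_le_combine[OF 1 2 3] by (simp only: vv)
    moreover have "C' \<ge> 0" unfolding C'_def using C(1) b1(1) b2(1) k n by simp
    ultimately show ?thesis by blast
  qed
  \<comment> \<open>If \<open>C'\<close> is negative, there is no admissible pair of
    \<open>x\<close> and \<open>v\<close>, and any constant will do.\<close>
  then show ?thesis by (cases "C' \<ge> 0") (blast, meson order_refl)
qed

lemma sum_pairs: "(\<Sum>i<2 * n. f i) = (\<Sum>i<n. f (2 * i) + f (Suc (2 * i)))"
  for f :: "nat \<Rightarrow> 'a::comm_monoid_add"
  by (induction n) (simp_all add: add.assoc)

text \<open>The 2n moves are equally likely: \<open>i div 2\<close> selects a direction and the
  parity of \<open>i\<close> its sign. Each direction has probability 1/n, so the factor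
  \<open>n\<close> under the root restores the covariance h times the sum of the matrices w
  w^T.\<close>

definition walk_step :: "nat \<Rightarrow> (nat \<Rightarrow> real^3 \<Rightarrow> real^3) \<Rightarrow> (real^3 \<Rightarrow> real^3) \<Rightarrow> real \<Rightarrow> nat \<Rightarrow> real^3 \<Rightarrow> real^3"
  where "walk_step n w \<beta> h i x =
    sphere_step x ((if even i then sqrt (n * h) else - sqrt (n * h)) *\<^sub>R w (i div 2) x + h *\<^sub>R \<beta> x)"

lemma abs_scaled_diff: "\<bar>a - r * g - r * m\<bar> / r = \<bar>a / r - g - m\<bar>" if "r > 0" for r :: real
proof -
  have "a - r * g - r * m = r * (a / r - g - m)" using that by (simp add: field_simps)
  then show ?thesis using that by (simp add: abs_mult)
qed

text \<open>The sign symmetry of the walk cancels the first-order terms in \<open>w\<close> and the mixed second-order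
  terms, which leaves the Ito generator.\<close>

lemma walk_consistent:
  assumes G: "smooth G" and n: "n > 0"
    and w: "\<And>i. continuous_on UNIV (w i)" and \<beta>: "continuous_on UNIV \<beta>"
    and tan: "\<And>i x. norm x = 1 \<Longrightarrow> w i x \<bullet> x = 0" "\<And>x. norm x = 1 \<Longrightarrow> \<beta> x \<bullet> x = 0"
  shows "\<exists>C. \<forall>h\<in>{0<..1}. \<forall>x\<in>sphere 0 1.
    \<bar>(\<Sum>i<2 * n. G (walk_step n w \<beta> h i x)) / real (2 * n) - G x
      - h * (dir_deriv (\<beta> x) G x + (\<Sum>i<n. dir_deriv (w i x) (dir_deriv (w i x) G) x / 2
                - w i x \<bullet> w i x / 2 * dir_deriv x G x))\<bar> \<le> C * (h * sqrt h)"
proof -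
  have bdd: "\<exists>b\<ge>0. \<forall>x\<in>sphere 0 1. norm (f x) \<le> b" if "continuous_on UNIV f" for f :: "real^3 \<Rightarrow> real^3"
  proof -
    have "bounded (f ` sphere 0 1)"
      by (intro compact_imp_bounded compact_continuous_image continuous_on_subset[OF that]) auto
    then obtain b where "\<forall>y\<in>f ` sphere 0 1. norm y \<le> b" by (auto simp: bounded_iff)
    then show ?thesis by (intro exI[of _ "max b 0"]) auto
  qed
  obtain bw where bw: "\<And>i. bw i \<ge> 0" "\<And>i x. x \<in> sphere 0 1 \<Longrightarrow> norm (w i x) \<le> bw i"
    using bdd[OF w] by metis
  obtain b\<beta> where b\<beta>: "b\<beta> \<ge> 0" "\<And>x. x \<in> sphere 0 1 \<Longrightarrow> norm (\<beta> x) \<le> b\<beta>"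
    using bdd[OF \<beta>] by metis
  define R where "R = sqrt n * (\<Sum>i<n. bw i) + b\<beta>"
  have R: "R \<ge> 0" unfolding R_def using bw(1) b\<beta>(1) by (intro add_nonneg_nonneg mult_nonneg_nonneg sum_nonneg) auto
  obtain C where C: "C \<ge> 0" "\<And>x v. norm x = 1 \<Longrightarrow> v \<bullet> x = 0 \<Longrightarrow> norm v \<le> R \<Longrightarrow>
    \<bar>G (sphere_step x v) - G x
       - (dir_deriv v G x + dir_deriv v (dir_deriv v G) x / 2 - v \<bullet> v / 2 * dir_deriv x G x)\<bar>
      \<le> C * norm v ^ 3"
    using sphere_step_expansion[OF G, of R] by metis
  obtain b1 where b1: "b1 \<ge> 0" "\<And>x v. x \<in> sphere 0 1 \<Longrightarrow> \<bar>dir_deriv v G x\<bar> \<le> b1 * norm v"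
    using partials_bounded[OF G compact_sphere] by metis
  obtain b2 where b2: "b2 \<ge> 0"
    "\<And>x v w. x \<in> sphere 0 1 \<Longrightarrow> \<bar>dir_deriv v (dir_deriv w G) x\<bar> \<le> b2 * (norm v * norm w)"
    using dir_deriv2_bounded[OF G compact_sphere] by metis
  define D where "D = C * R ^ 3 + (b2 + b1) * b\<beta>\<^sup>2"
  have "\<bar>(\<Sum>i<2 * n. G (walk_step n w \<beta> h i x)) / real (2 * n) - G x
      - h * (dir_deriv (\<beta> x) G x + (\<Sum>i<n. dir_deriv (w i x) (dir_deriv (w i x) G) x / 2
                - w i x \<bullet> w i x / 2 * dir_deriv x G x))\<bar> \<le> D * (h * sqrt h)"
    if h: "0 < h" "h \<le> 1" and x: "x \<in> sphere 0 1" for h x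
  proof -
    have nx: "norm x = 1" using x by simp
    define quad where "quad a = dir_deriv a (dir_deriv a G) x / 2 - a \<bullet> a / 2 * dir_deriv x G x" for a
    define v where "v i = (if even i then sqrt (n * h) else - sqrt (n * h)) *\<^sub>R w (i div 2) x + h *\<^sub>R \<beta> x" for i
    \<comment> \<open>The parallelogram law of a quadratic form; it makes the mixed terms between a
      direction and the drift cancel over the two signs.\<close>
    have quad_pm: "quad (a + c) + quad (- a + c) = 2 * quad a + 2 * quad c" for a c
      unfolding quad_def dir_deriv_dir_deriv[OF G]
      by (simp add: sum_3 inner_vec_def algebra_simps add_divide_distrib diff_divide_distrib)
    have quad_scale: "quad (s *\<^sub>R a) = s\<^sup>2 * quad a" for s a
      unfolding quad_def dir_deriv_dir_deriv[OF G]
      by (simp add: sum_3 power2_eq_square algebra_simps add_divide_distrib diff_divide_distrib)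
    have nv: "norm (v i) \<le> R * sqrt h" if "i < 2 * n" for i
    proof -
      have "norm (v i) \<le> sqrt (n * h) * norm (w (i div 2) x) + h * norm (\<beta> x)"
        unfolding v_def using h by (intro order_trans[OF norm_triangle_ineq]) auto
      also have "\<dots> \<le> sqrt (n * h) * bw (i div 2) + sqrt h * b\<beta>"
      proof (intro add_mono mult_mono bw b\<beta> x)
        have "sqrt h * sqrt h \<le> sqrt h * 1" using h by (intro mult_left_mono) auto
        then show "h \<le> sqrt h" using h by simp
      qed (use h in auto)
      also have "\<dots> \<le> sqrt (n * h) * (\<Sum>i<n. bw i) + sqrt h * b\<beta>"
        using that bw(1) h by (intro add_right_mono mult_left_mono member_le_sum) auto
      also have "\<dots> = R * sqrt h" by (simp add: R_def real_sqrt_mult algebra_simps)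
      finally show ?thesis .
    qed
    have step: "\<bar>G (walk_step n w \<beta> h i x) - G x - (dir_deriv (v i) G x + quad (v i))\<bar> \<le> C * R ^ 3 * (h * sqrt h)"
      if "i < 2 * n" for i
    proof -
      have "R * sqrt h \<le> R * 1" using R h by (intro mult_left_mono) auto
      then have "norm (v i) \<le> R" using nv[OF that] by simp
      moreover have "v i \<bullet> x = 0" by (simp add: v_def inner_add_left tan nx)
      ultimately have "\<bar>G (walk_step n w \<beta> h i x) - G x - (dir_deriv (v i) G x + quad (v i))\<bar> \<le> C * norm (v i) ^ 3"
        using C(2)[OF nx, of "v i"] by (simp add: walk_step_def v_def[symmetric] quad_def add_diff_eq)
      also have "\<dots> \<le> C * (R * sqrt h) ^ 3"
        using nv[OF that] C(1) by (intro mult_left_mono power_mono) auto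
      also have "\<dots> = C * R ^ 3 * (h * sqrt h)"
        using h by (simp add: power_mult_distrib power3_eq_cube mult.assoc)
      finally show ?thesis .
    qed
    let ?main = "h * (dir_deriv (\<beta> x) G x + (\<Sum>i<n. quad (w i x)))"
    have "(\<Sum>i<2 * n. dir_deriv (v i) G x + quad (v i))
       = (\<Sum>i<n. 2 * (h * dir_deriv (\<beta> x) G x) + 2 * (n * h * quad (w i x)) + 2 * (h\<^sup>2 * quad (\<beta> x)))"
      unfolding sum_pairs
    proof (rule sum.cong[OF refl])
      fix i
      let ?a = "sqrt (n * h) *\<^sub>R w i x" and ?c = "h *\<^sub>R \<beta> x"
      have v: "v (2 * i) = ?a + ?c" "v (Suc (2 * i)) = - ?a + ?c" by (simp_all add: v_def)
      have d: "dir_deriv (?a + ?c) G x + dir_deriv (- ?a + ?c) G x = 2 * (h * dir_deriv (\<beta> x) G x)"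
        by (simp add: dir_deriv_def sum_3 algebra_simps)
      have q: "quad (?a + ?c) + quad (- ?a + ?c) = 2 * (n * h * quad (w i x)) + 2 * (h\<^sup>2 * quad (\<beta> x))"
        using h by (simp only: quad_pm quad_scale) simp
      show "dir_deriv (v (2 * i)) G x + quad (v (2 * i)) + (dir_deriv (v (Suc (2 * i))) G x + quad (v (Suc (2 * i))))
          = 2 * (h * dir_deriv (\<beta> x) G x) + 2 * (n * h * quad (w i x)) + 2 * (h\<^sup>2 * quad (\<beta> x))"
        unfolding v using d q by linarith
    qed
    also have "\<dots> = real (2 * n) * (?main + h\<^sup>2 * quad (\<beta> x))"
      by (simp add: sum.distrib algebra_simps flip: sum_distrib_left)
    finally have sum: "(\<Sum>i<2 * n. dir_deriv (v i) G x + quad (v i)) = real (2 * n) * (?main + h\<^sup>2 * quad (\<beta> x))" .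
    have "\<bar>(\<Sum>i<2 * n. G (walk_step n w \<beta> h i x) - G x - (dir_deriv (v i) G x + quad (v i)))\<bar>
        \<le> (\<Sum>i<2 * n. C * R ^ 3 * (h * sqrt h))"
      by (rule order_trans[OF sum_abs]) (intro sum_mono step, simp)
    then have "\<bar>(\<Sum>i<2 * n. G (walk_step n w \<beta> h i x)) - real (2 * n) * G x - real (2 * n) * (?main + h\<^sup>2 * quad (\<beta> x))\<bar>
        \<le> real (2 * n) * (C * R ^ 3 * (h * sqrt h))"
      unfolding sum_subtractf sum by simp
    then have "\<bar>(\<Sum>i<2 * n. G (walk_step n w \<beta> h i x)) - real (2 * n) * G x - real (2 * n) * (?main + h\<^sup>2 * quad (\<beta> x))\<bar> / real (2 * n)
        \<le> C * R ^ 3 * (h * sqrt h)"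
      using n by (simp add: divide_le_eq mult.commute)
    moreover have "\<bar>(\<Sum>i<2 * n. G (walk_step n w \<beta> h i x)) - real (2 * n) * G x - real (2 * n) * (?main + h\<^sup>2 * quad (\<beta> x))\<bar> / real (2 * n)
        = \<bar>(\<Sum>i<2 * n. G (walk_step n w \<beta> h i x)) / real (2 * n) - G x - (?main + h\<^sup>2 * quad (\<beta> x))\<bar>"
      using n by (intro abs_scaled_diff) simp
    moreover have "\<bar>h\<^sup>2 * quad (\<beta> x)\<bar> \<le> (b2 + b1) * b\<beta>\<^sup>2 * (h * sqrt h)"
    proof -
      have "\<bar>quad (\<beta> x)\<bar> \<le> \<bar>dir_deriv (\<beta> x) (dir_deriv (\<beta> x) G) x\<bar> / 2 + (norm (\<beta> x))\<^sup>2 / 2 * \<bar>dir_deriv x G x\<bar>"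
        unfolding quad_def dot_square_norm by (rule order_trans[OF abs_triangle_ineq4]) (simp add: abs_mult)
      also have "\<dots> \<le> b2 * (norm (\<beta> x))\<^sup>2 / 2 + (norm (\<beta> x))\<^sup>2 / 2 * b1"
        using b2(2)[OF x, of "\<beta> x" "\<beta> x"] b1(2)[OF x, of x] nx
        by (intro add_mono mult_left_mono) (auto simp: power2_eq_square)
      also have "\<dots> = (b2 + b1) / 2 * (norm (\<beta> x))\<^sup>2" by (simp add: algebra_simps)
      also have "\<dots> \<le> (b2 + b1) * b\<beta>\<^sup>2"
        using b\<beta>(2)[OF x] b1(1) b2(1) by (intro mult_mono power_mono) auto
      finally have "\<bar>quad (\<beta> x)\<bar> \<le> (b2 + b1) * b\<beta>\<^sup>2" .
      moreover have "h\<^sup>2 \<le> h * sqrt h"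
      proof -
        have "sqrt h * sqrt h \<le> sqrt h * 1" using h by (intro mult_left_mono) auto
        then have "h \<le> sqrt h" using h by simp
        then show ?thesis using h by (simp add: power2_eq_square)
      qed
      ultimately have "h\<^sup>2 * \<bar>quad (\<beta> x)\<bar> \<le> (h * sqrt h) * ((b2 + b1) * b\<beta>\<^sup>2)"
        by (intro mult_mono) (use h in auto)
      then show ?thesis by (simp add: abs_mult mult_ac)
    qed
    ultimately show ?thesis
      unfolding quad_def[symmetric] D_def distrib_right by linarith
  qed
  then show ?thesis by (intro exI[of _ D]) auto
qed

lemma has_vector_derivative_vec3:
  "(c has_vector_derivative v) (at s) \<longleftrightarrow> (\<forall>i. ((\<lambda>s. c s $ i) has_real_derivative v $ i) (at s))"
  for c :: "real \<Rightarrow> real^3"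
proof
  assume "(c has_vector_derivative v) (at s)"
  then show "\<forall>i. ((\<lambda>s. c s $ i) has_real_derivative v $ i) (at s)"
    using bounded_linear.has_vector_derivative[OF bounded_linear_vec_nth]
    by (auto simp: has_real_derivative_iff_has_vector_derivative)
next
  assume c: "\<forall>i. ((\<lambda>s. c s $ i) has_real_derivative v $ i) (at s)"
  have "(c has_derivative (\<lambda>t. t *\<^sub>R v)) (at s)"
  proof (subst has_derivative_componentwise_within, rule ballI)
    fix b :: "real^3" assume "b \<in> Basis"
    then obtain i where b: "b = axis i 1" by (auto simp: Basis_vec_def)
    show "((\<lambda>s. c s \<bullet> b) has_derivative (\<lambda>t. t *\<^sub>R v \<bullet> b)) (at s)"
      using c[rule_format, of i] by (simp add: b inner_axis has_field_derivative_def mult.commute[of _ "v $ i"])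
  qed
  then show "(c has_vector_derivative v) (at s)" by (simp add: has_vector_derivative_def)
qed

lemma smooth_along_curve:
  assumes F: "smooth F" and c: "\<And>i. ((\<lambda>s. c s $ i) has_real_derivative v $ i) (at s)"
  shows "((\<lambda>s. F (c s)) has_real_derivative dir_deriv v F (c s)) (at s)"
proof -
  have "(c has_derivative (\<lambda>t. t *\<^sub>R v)) (at s)"
    using c has_vector_derivative_vec3 unfolding has_vector_derivative_def by blast
  from has_derivative_compose[OF this has_derivative_partial[OF smooth_differentiable[OF F]]]
  have "((\<lambda>s. F (c s)) has_derivative (\<lambda>t. t * dir_deriv v F (c s))) (at s)"
    by (simp add: dir_deriv_def sum_distrib_left mult.assoc)
  then show ?thesis by (simp add: has_field_derivative_def mult.commute[of _ "dir_deriv _ _ _"])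
qed

section \<open>Integration by parts on the sphere\<close>

definition spherical :: "real \<Rightarrow> real \<Rightarrow> real^3" where
  "spherical \<theta> \<phi> = vector [sin \<theta> * cos \<phi>, sin \<theta> * sin \<phi>, cos \<theta>]"

lemma spherical_components:
  "spherical \<theta> \<phi> $ 1 = sin \<theta> * cos \<phi>" "spherical \<theta> \<phi> $ 2 = sin \<theta> * sin \<phi>" "spherical \<theta> \<phi> $ 3 = cos \<theta>"
  by (simp_all add: spherical_def)

lemma norm_spherical: "norm (spherical \<theta> \<phi>) = 1"
proof -
  have "(sin \<theta> * cos \<phi>)\<^sup>2 + (sin \<theta> * sin \<phi>)\<^sup>2 + (cos \<theta>)\<^sup>2
      = (sin \<theta>)\<^sup>2 * ((sin \<phi>)\<^sup>2 + (cos \<phi>)\<^sup>2) + (cos \<theta>)\<^sup>2"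
    by (simp only: power_mult_distrib distrib_left add_ac)
  also have "\<dots> = 1" by simp
  finally show ?thesis
    by (simp add: norm_eq_sqrt_inner inner_vec_def sum_3 spherical_components power2_eq_square)
qed

lemma continuous_spherical: "continuous_on A (\<lambda>z. spherical (fst z) (snd z))"
proof -
  have "(\<lambda>z. spherical (fst z) (snd z)) = (\<lambda>z. \<chi> i. if i = 1 then sin (fst z) * cos (snd z)
      else if i = 2 then sin (fst z) * sin (snd z) else cos (fst z))"
    by (rule ext) (simp add: Finite_Cartesian_Product.vec_eq_iff forall_3 spherical_components)
  moreover have "continuous_on A (\<lambda>z::real \<times> real. if i = (1::3) then sin (fst z) * cos (snd z)
      else if i = 2 then sin (fst z) * sin (snd z) else cos (fst z))" for i
    by (cases "i = 1"; cases "i = 2") (auto intro!: continuous_intros)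
  ultimately show ?thesis by (simp only:) (rule continuous_on_vec_lambda)
qed

lemma dOmega_continuous:
  fixes f :: "real^3 \<Rightarrow> real"
  assumes f: "continuous_on UNIV f"
  shows "integrable (dOmega N) f"
    and "(\<integral>x. f x \<partial>dOmega N) = (2 * spin N + 1) / (4 * pi) *
      (\<integral>z. indicator ({0..pi} \<times> {0..2 * pi}) z *\<^sub>R (sin (fst z) * f (spherical (fst z) (snd z))) \<partial>lborel)"
proof -
  let ?Q = "{0..pi} \<times> {0..2 * pi} :: (real \<times> real) set"
  let ?k = "(2 * spin N + 1) / (4 * pi)"
  let ?D = "\<lambda>z. indicator ?Q z * ?k * sin (fst z)"
  let ?M = "density (lborel \<Otimes>\<^sub>M lborel) (\<lambda>z. ennreal (?D z))"
  let ?s = "\<lambda>z. spherical (fst z) (snd z)"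
  have dO: "dOmega N = distr ?M unit_sphere ?s"
    by (simp add: dOmega_def spherical_def case_prod_unfold)
  have sQ: "?Q \<in> sets (lborel \<Otimes>\<^sub>M lborel)" by simp
  have Dm: "?D \<in> borel_measurable (lborel \<Otimes>\<^sub>M lborel)" using sQ by measurable
  have D0: "AE z in lborel \<Otimes>\<^sub>M lborel. 0 \<le> ?D z"
    by (intro AE_I2) (auto simp: indicator_def spin_def sin_ge_zero)
  have sm: "?s \<in> borel_measurable (lborel \<Otimes>\<^sub>M lborel)"
    unfolding lborel_prod using borel_measurable_continuous_onI[OF continuous_spherical] by simp
  have sM: "?s \<in> measurable ?M unit_sphere"
    by (rule measurable_restrict_space2) (use sm norm_spherical in auto)
  have fm: "f \<in> borel_measurable borel" by (rule borel_measurable_continuous_onI[OF f])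
  have fu: "f \<in> borel_measurable unit_sphere"
    by (rule measurable_restrict_space1[OF fm])
  have fs: "(\<lambda>z. f (?s z)) \<in> borel_measurable (lborel \<Otimes>\<^sub>M lborel)"
    by (rule measurable_compose[OF sm fm])
  have eq: "?D z * f (?s z) = ?k * (indicator ?Q z *\<^sub>R (sin (fst z) * f (?s z)))" for z
    by simp
  have "integrable lborel (\<lambda>z. indicator ?Q z *\<^sub>R (sin (fst z) * f (?s z)))"
    by (intro borel_integrable_compact continuous_intros continuous_on_compose2[OF f continuous_spherical] compact_Times)
      auto
  then have "integrable (lborel \<Otimes>\<^sub>M lborel) (\<lambda>z. ?D z * f (?s z))"
    unfolding eq lborel_prod by (rule integrable_mult_right)
  then have "integrable ?M (\<lambda>z. f (?s z))"
    by (subst integrable_real_density[OF Dm D0 fs])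
  then show "integrable (dOmega N) f"
    unfolding dO by (subst integrable_distr_eq[OF sM fu])
  have "(\<integral>x. f x \<partial>dOmega N) = (\<integral>z. f (?s z) \<partial>?M)"
    unfolding dO by (rule integral_distr[OF sM fu])
  also have "\<dots> = (\<integral>z. ?D z * f (?s z) \<partial>(lborel \<Otimes>\<^sub>M lborel))"
    by (rule integral_real_density[OF Dm D0 fs])
  finally show "(\<integral>x. f x \<partial>dOmega N) = ?k * (\<integral>z. indicator ?Q z *\<^sub>R (sin (fst z) * f (?s z)) \<partial>lborel)"
    unfolding eq lborel_prod by simp
qed

text \<open>Fubini with the first variable inside, where the fundamental theorem of calculus leaves
  the difference of the boundary values.\<close>

lemma integral_box_derivative_fst:
  fixes a a' :: "real \<Rightarrow> real \<Rightarrow> real"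
  assumes c: "continuous_on UNIV (\<lambda>z. a' (fst z) (snd z))"
    and d: "\<And>\<theta> \<phi>. ((\<lambda>\<theta>. a \<theta> \<phi>) has_real_derivative a' \<theta> \<phi>) (at \<theta>)"
    and bc: "\<And>\<phi>. a l \<phi> = a r \<phi>" and lr: "l \<le> r"
  shows "(\<integral>z. indicator ({l..r} \<times> {l'..r'}) z *\<^sub>R a' (fst z) (snd z) \<partial>lborel) = 0"
proof -
  let ?f = "\<lambda>\<theta> \<phi>. indicator ({l..r} \<times> {l'..r'}) (\<theta>, \<phi>) *\<^sub>R a' \<theta> \<phi>"
  have "integrable lborel (\<lambda>z. indicator ({l..r} \<times> {l'..r'}) z *\<^sub>R a' (fst z) (snd z))"
    by (intro borel_integrable_compact compact_Times continuous_on_subset[OF c]) auto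
  then have i: "integrable (lborel \<Otimes>\<^sub>M lborel) (case_prod ?f)"
    by (simp add: lborel_prod case_prod_unfold)
  have "(\<integral>\<theta>. ?f \<theta> \<phi> \<partial>lborel) = 0" for \<phi>
  proof -
    have "continuous_on UNIV (\<lambda>\<theta>. a' \<theta> \<phi>)"
      using continuous_on_compose2[OF c, of UNIV "\<lambda>\<theta>. (\<theta>, \<phi>)"] by (simp add: continuous_intros)
    then have "(\<integral>\<theta>. a' \<theta> \<phi> * indicator {l..r} \<theta> \<partial>lborel) = a r \<phi> - a l \<phi>"
      by (intro integral_FTC_Icc_real lr) (auto simp: d continuous_on_eq_continuous_at)
    moreover have "?f \<theta> \<phi> = indicator {l'..r'} \<phi> * (a' \<theta> \<phi> * indicator {l..r} \<theta>)" for \<theta>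
      by (auto simp: indicator_def)
    ultimately show ?thesis using bc by (simp only: integral_mult_right_zero diff_self mult_zero_right)
  qed
  then have "(\<integral>z. case_prod ?f z \<partial>(lborel \<Otimes>\<^sub>M lborel)) = 0"
    using lborel_pair.integral_snd[OF i] by simp
  then show ?thesis by (simp add: lborel_prod case_prod_unfold)
qed

lemma integral_box_derivative_snd:
  fixes a a' :: "real \<Rightarrow> real \<Rightarrow> real"
  assumes c: "continuous_on UNIV (\<lambda>z. a' (fst z) (snd z))"
    and d: "\<And>\<theta> \<phi>. ((\<lambda>\<phi>. a \<theta> \<phi>) has_real_derivative a' \<theta> \<phi>) (at \<phi>)"
    and bc: "\<And>\<theta>. a \<theta> l' = a \<theta> r'" and lr: "l' \<le> r'"
  shows "(\<integral>z. indicator ({l..r} \<times> {l'..r'}) z *\<^sub>R a' (fst z) (snd z) \<partial>lborel) = 0"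
proof -
  let ?f = "\<lambda>\<theta> \<phi>. indicator ({l..r} \<times> {l'..r'}) (\<theta>, \<phi>) *\<^sub>R a' \<theta> \<phi>"
  have "integrable lborel (\<lambda>z. indicator ({l..r} \<times> {l'..r'}) z *\<^sub>R a' (fst z) (snd z))"
    by (intro borel_integrable_compact compact_Times continuous_on_subset[OF c]) auto
  then have i: "integrable (lborel \<Otimes>\<^sub>M lborel) (case_prod ?f)"
    by (simp add: lborel_prod case_prod_unfold)
  have "(\<integral>\<phi>. ?f \<theta> \<phi> \<partial>lborel) = 0" for \<theta>
  proof -
    have "continuous_on UNIV (\<lambda>\<phi>. a' \<theta> \<phi>)"
      using continuous_on_compose2[OF c, of UNIV "\<lambda>\<phi>. (\<theta>, \<phi>)"] by (simp add: continuous_intros)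
    then have "(\<integral>\<phi>. a' \<theta> \<phi> * indicator {l'..r'} \<phi> \<partial>lborel) = a \<theta> r' - a \<theta> l'"
      by (intro integral_FTC_Icc_real lr) (auto simp: d continuous_on_eq_continuous_at)
    moreover have "?f \<theta> \<phi> = indicator {l..r} \<theta> * (a' \<theta> \<phi> * indicator {l'..r'} \<phi>)" for \<phi>
      by (auto simp: indicator_def)
    ultimately show ?thesis using bc by (simp only: integral_mult_right_zero diff_self mult_zero_right)
  qed
  then have "(\<integral>z. case_prod ?f z \<partial>(lborel \<Otimes>\<^sub>M lborel)) = 0"
    using lborel_pair.integral_fst[OF i] by simp
  then show ?thesis by (simp add: lborel_prod case_prod_unfold)
qed

text \<open>The Pythagorean identity in the nested shape that products have after
  \<open>algebra_simps\<close>, so that it can serve as a rewrite rule.\<close>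

lemma cos_cos_mult: "cos \<phi> * (cos \<phi> * r) = r - sin \<phi> * (sin \<phi> * r)" for r \<phi> :: real
proof -
  have "cos \<phi> * (cos \<phi> * r) = (cos \<phi>)\<^sup>2 * r" by (simp add: power2_eq_square)
  also have "\<dots> = (1 - (sin \<phi>)\<^sup>2) * r" by (simp only: cos_squared_eq)
  finally show ?thesis by (simp add: power2_eq_square algebra_simps)
qed

text \<open>In spherical coordinates \<open>sin \<theta>\<close> times a rotation field is a divergence
  \<open>\<partial>\<^sub>\<theta> (p u) + \<partial>\<^sub>\<phi> (q u)\<close>, where \<open>p\<close> vanishes at the poles and \<open>q\<close> is periodic.\<close>

lemma integral_rot_eq_0:
  assumes F: "smooth F"
  shows "(\<integral>x. rot \<mu> F x \<partial>dOmega N) = 0"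
proof -
  define u where "u \<theta> \<phi> = F (spherical \<theta> \<phi>)" for \<theta> \<phi>
  define P where "P i \<theta> \<phi> = partial i F (spherical \<theta> \<phi>)" for i \<theta> \<phi>
  define u1 where "u1 \<theta> \<phi> = cos \<theta> * cos \<phi> * P 1 \<theta> \<phi> + cos \<theta> * sin \<phi> * P 2 \<theta> \<phi> - sin \<theta> * P 3 \<theta> \<phi>" for \<theta> \<phi>
  define u2 where "u2 \<theta> \<phi> = - sin \<theta> * sin \<phi> * P 1 \<theta> \<phi> + sin \<theta> * cos \<phi> * P 2 \<theta> \<phi>" for \<theta> \<phi>
  have cu: "continuous_on UNIV (\<lambda>z. u (fst z) (snd z))"
    unfolding u_def by (rule continuous_on_compose2[OF smooth_continuous[OF F] continuous_spherical]) auto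
  have cP: "continuous_on UNIV (\<lambda>z. P i (fst z) (snd z))" for i
    unfolding P_def
    by (rule continuous_on_compose2[OF smooth_continuous[OF smooth_partial[OF F]] continuous_spherical]) auto
  have cu12: "continuous_on UNIV (\<lambda>z. u1 (fst z) (snd z))" "continuous_on UNIV (\<lambda>z. u2 (fst z) (snd z))"
    unfolding u1_def u2_def by (intro continuous_intros cP)+
  have d1: "((\<lambda>\<theta>. u \<theta> \<phi>) has_real_derivative u1 \<theta> \<phi>) (at \<theta>)" for \<theta> \<phi>
  proof -
    let ?v = "vector [cos \<theta> * cos \<phi>, cos \<theta> * sin \<phi>, - sin \<theta>] :: real^3"
    have "((\<lambda>\<theta>. spherical \<theta> \<phi> $ i) has_real_derivative ?v $ i) (at \<theta>)" for i
      by (rule rot_cases[of _ i]) (auto simp: spherical_components intro!: derivative_eq_intros)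
    from smooth_along_curve[OF F this] show ?thesis
      by (simp add: dir_deriv_def sum_3 u_def u1_def P_def)
  qed
  have d2: "((\<lambda>\<phi>. u \<theta> \<phi>) has_real_derivative u2 \<theta> \<phi>) (at \<phi>)" for \<theta> \<phi>
  proof -
    let ?v = "vector [- sin \<theta> * sin \<phi>, sin \<theta> * cos \<phi>, 0] :: real^3"
    have "((\<lambda>\<phi>. spherical \<theta> \<phi> $ i) has_real_derivative ?v $ i) (at \<phi>)" for i
      by (rule rot_cases[of _ i]) (auto simp: spherical_components intro!: derivative_eq_intros)
    from smooth_along_curve[OF F this] show ?thesis
      by (simp add: dir_deriv_def sum_3 u_def u2_def P_def)
  qed
  have per: "u \<theta> 0 = u \<theta> (2 * pi)" for \<theta>
    by (simp add: u_def spherical_def)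
  have main: "(\<integral>x. rot \<mu> F x \<partial>dOmega N) = 0"
    if p: "\<And>\<theta> \<phi>. ((\<lambda>\<theta>. p \<theta> \<phi>) has_real_derivative p' \<theta> \<phi>) (at \<theta>)"
      and q: "\<And>\<theta> \<phi>. ((\<lambda>\<phi>. q \<theta> \<phi>) has_real_derivative q' \<theta> \<phi>) (at \<phi>)"
      and pc: "continuous_on UNIV (\<lambda>z. p (fst z) (snd z))" "continuous_on UNIV (\<lambda>z. p' (fst z) (snd z))"
      and qc: "continuous_on UNIV (\<lambda>z. q (fst z) (snd z))" "continuous_on UNIV (\<lambda>z. q' (fst z) (snd z))"
      and p0: "\<And>\<phi>. p 0 \<phi> = 0" "\<And>\<phi>. p pi \<phi> = 0" and q0: "\<And>\<theta>. q \<theta> 0 = q \<theta> (2 * pi)"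
      and eq: "\<And>\<theta> \<phi>. sin \<theta> * rot \<mu> F (spherical \<theta> \<phi>)
          = (p' \<theta> \<phi> * u \<theta> \<phi> + p \<theta> \<phi> * u1 \<theta> \<phi>) + (q' \<theta> \<phi> * u \<theta> \<phi> + q \<theta> \<phi> * u2 \<theta> \<phi>)"
    for p p' q q' :: "real \<Rightarrow> real \<Rightarrow> real" and \<mu>
  proof -
    let ?I = "indicator ({0..pi} \<times> {0..2 * pi}) :: real \<times> real \<Rightarrow> real"
    let ?A = "\<lambda>z. p' (fst z) (snd z) * u (fst z) (snd z) + p (fst z) (snd z) * u1 (fst z) (snd z)"
    let ?B = "\<lambda>z. q' (fst z) (snd z) * u (fst z) (snd z) + q (fst z) (snd z) * u2 (fst z) (snd z)"
    have cA: "continuous_on UNIV ?A" "continuous_on UNIV ?B"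
      by (intro continuous_intros pc qc cu cu12)+
    have "(\<integral>z. ?I z *\<^sub>R ?A z \<partial>lborel) = 0"
      by (rule integral_box_derivative_fst[where a = "\<lambda>\<theta> \<phi>. p \<theta> \<phi> * u \<theta> \<phi>"
            and a' = "\<lambda>\<theta> \<phi>. p' \<theta> \<phi> * u \<theta> \<phi> + p \<theta> \<phi> * u1 \<theta> \<phi>"])
        (use cA in \<open>auto intro!: derivative_eq_intros p d1 simp: p0\<close>)
    moreover have "(\<integral>z. ?I z *\<^sub>R ?B z \<partial>lborel) = 0"
      by (rule integral_box_derivative_snd[where a = "\<lambda>\<theta> \<phi>. q \<theta> \<phi> * u \<theta> \<phi>"
            and a' = "\<lambda>\<theta> \<phi>. q' \<theta> \<phi> * u \<theta> \<phi> + q \<theta> \<phi> * u2 \<theta> \<phi>"])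
        (use cA in \<open>auto intro!: derivative_eq_intros q d2 simp: q0 per\<close>)
    moreover have "integrable lborel (\<lambda>z. ?I z *\<^sub>R ?A z)" "integrable lborel (\<lambda>z. ?I z *\<^sub>R ?B z)"
      by (intro borel_integrable_compact compact_Times continuous_on_subset[OF cA(1)]
          continuous_on_subset[OF cA(2)]; simp)+
    ultimately have "(\<integral>z. ?I z *\<^sub>R ?A z + ?I z *\<^sub>R ?B z \<partial>lborel) = 0"
      by (subst Bochner_Integration.integral_add) auto
    then show ?thesis
      unfolding dOmega_continuous(2)[OF smooth_continuous[OF smooth_rot[OF F]]] eq scaleR_add_right
      by simp
  qed
  show ?thesis
  proof (rule rot_cases[of _ \<mu>])
    show "(\<integral>x. rot 1 F x \<partial>dOmega N) = 0"
    \<comment> \<open>In spherical coordinates this field is sin \<phi> d/d\<theta> + cot \<theta>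
      cos \<phi> d/d\<phi>. The weight sin \<theta> removes the singularity of the cotangent, and
      the terms with \<open>p'\<close> and \<open>q'\<close> cancel because a rotation preserves
      area.\<close>
    proof (rule main[where p = "\<lambda>\<theta> \<phi>. sin \<theta> * sin \<phi>" and p' = "\<lambda>\<theta> \<phi>. cos \<theta> * sin \<phi>"
          and q = "\<lambda>\<theta> \<phi>. cos \<theta> * cos \<phi>" and q' = "\<lambda>\<theta> \<phi>. - cos \<theta> * sin \<phi>"])
      fix \<theta> \<phi> :: real
      show "sin \<theta> * rot 1 F (spherical \<theta> \<phi>)
          = (cos \<theta> * sin \<phi> * u \<theta> \<phi> + sin \<theta> * sin \<phi> * u1 \<theta> \<phi>) + (- cos \<theta> * sin \<phi> * u \<theta> \<phi> + cos \<theta> * cos \<phi> * u2 \<theta> \<phi>)"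
        by (simp add: rot_eq spherical_components u1_def u2_def flip: P_def) (simp add: algebra_simps cos_cos_mult)
    qed (auto intro!: derivative_eq_intros continuous_intros)
    show "(\<integral>x. rot 2 F x \<partial>dOmega N) = 0"
    proof (rule main[where p = "\<lambda>\<theta> \<phi>. - sin \<theta> * cos \<phi>" and p' = "\<lambda>\<theta> \<phi>. - cos \<theta> * cos \<phi>"
          and q = "\<lambda>\<theta> \<phi>. cos \<theta> * sin \<phi>" and q' = "\<lambda>\<theta> \<phi>. cos \<theta> * cos \<phi>"])
      fix \<theta> \<phi> :: real
      show "sin \<theta> * rot 2 F (spherical \<theta> \<phi>)
          = (- cos \<theta> * cos \<phi> * u \<theta> \<phi> + - sin \<theta> * cos \<phi> * u1 \<theta> \<phi>) + (cos \<theta> * cos \<phi> * u \<theta> \<phi> + cos \<theta> * sin \<phi> * u2 \<theta> \<phi>)"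
        by (simp add: rot_eq spherical_components u1_def u2_def flip: P_def) (simp add: algebra_simps cos_cos_mult)
    qed (auto intro!: derivative_eq_intros continuous_intros)
    show "(\<integral>x. rot 3 F x \<partial>dOmega N) = 0"
    proof (rule main[where p = "\<lambda>\<theta> \<phi>. 0" and p' = "\<lambda>\<theta> \<phi>. 0"
          and q = "\<lambda>\<theta> \<phi>. - sin \<theta>" and q' = "\<lambda>\<theta> \<phi>. 0"])
      fix \<theta> \<phi> :: real
      show "sin \<theta> * rot 3 F (spherical \<theta> \<phi>)
          = (0 * u \<theta> \<phi> + 0 * u1 \<theta> \<phi>) + (0 * u \<theta> \<phi> + - sin \<theta> * u2 \<theta> \<phi>)"
        by (simp add: rot_eq spherical_components u1_def u2_def flip: P_def) (simp add: algebra_simps)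
    qed (auto intro!: derivative_eq_intros continuous_intros)
  qed
qed

lemma integrable_dOmega: "smooth f \<Longrightarrow> integrable (dOmega N) f"
  by (rule dOmega_continuous(1)[OF smooth_continuous])

text \<open>A derivation whose values all have integral 0 is skew: it is applied to the product of
  the two functions.\<close>

lemma integral_rot_skew:
  assumes F: "smooth F" and G: "smooth G"
  shows "(\<integral>x. rot \<mu> F x * G x \<partial>dOmega N) = - (\<integral>x. F x * rot \<mu> G x \<partial>dOmega N)"
proof -
  have "0 = (\<integral>x. rot \<mu> (\<lambda>x. F x * G x) x \<partial>dOmega N)"
    using integral_rot_eq_0[OF smooth_mult[OF F G], where \<mu> = \<mu> and N = N] by simp
  also have "\<dots> = (\<integral>x. F x * rot \<mu> G x + rot \<mu> F x * G x \<partial>dOmega N)"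
    by (simp only: rot_mult[OF F G])
  also have "\<dots> = (\<integral>x. F x * rot \<mu> G x \<partial>dOmega N) + (\<integral>x. rot \<mu> F x * G x \<partial>dOmega N)"
    by (intro Bochner_Integration.integral_add integrable_dOmega smooth_mult smooth_rot F G)
  finally show ?thesis by simp
qed

lemma integral_rot_rot:
  assumes F: "smooth F" and G: "smooth G"
  shows "(\<integral>x. rot \<mu> (rot \<nu> F) x * G x \<partial>dOmega N) = (\<integral>x. F x * rot \<nu> (rot \<mu> G) x \<partial>dOmega N)"
  using integral_rot_skew[OF smooth_rot[OF F, of \<nu>] G, where \<mu> = \<mu> and N = N]
    integral_rot_skew[OF F smooth_rot[OF G, of \<mu>], where \<mu> = \<nu> and N = N]
  by simp

section \<open>The Fokker--Planck operator and its adjoint\<close>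

text \<open>The second-order part common to the forward and the backward generator. Being
  symmetrized in the two fields, it is its own adjoint up to a first-order term.\<close>

definition twist_diffusion :: "real \<Rightarrow> real \<Rightarrow> (real^3 \<Rightarrow> real) \<Rightarrow> real^3 \<Rightarrow> real" where
  "twist_diffusion \<gamma> c F x =
     \<gamma> / 2 * (rot 1 (rot 1 F) x + rot 2 (rot 2 F) x + rot 3 (rot 3 F) x)
     - c / 2 * (x $ 2 * (rot 1 (rot 3 F) x + rot 3 (rot 1 F) x)
              - x $ 3 * (rot 1 (rot 2 F) x + rot 2 (rot 1 F) x))"

definition forward_generator :: "real \<Rightarrow> real \<Rightarrow> real \<Rightarrow> (real^3 \<Rightarrow> real) \<Rightarrow> real^3 \<Rightarrow> real" where
  "forward_generator \<gamma> c S F x = (2 * S + 5 / 2) * c * (x $ 1 * rot 1 F x) + twist_diffusion \<gamma> c F x"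

definition backward_generator :: "real \<Rightarrow> real \<Rightarrow> real \<Rightarrow> (real^3 \<Rightarrow> real) \<Rightarrow> real^3 \<Rightarrow> real" where
  "backward_generator \<gamma> c S G x = - (2 * S - 1 / 2) * c * (x $ 1 * rot 1 G x) + twist_diffusion \<gamma> c G x"

lemma smooth_backward_generator: "smooth G \<Longrightarrow> smooth (backward_generator \<gamma> c S G)"
  unfolding backward_generator_def[abs_def] twist_diffusion_def
  by (intro smooth_intros smooth_rot)

text \<open>The triple product x . (x cross grad) vanishes. This relation between the three fields
  turns the first-order terms that are left over later into multiples of x_1 rot_1.\<close>

lemma rot_radial: "x $ 1 * rot 1 G x + x $ 2 * rot 2 G x + x $ 3 * rot 3 G x = 0"
  by (simp add: rot_eq algebra_simps)

text \<open>Moving two fields across reverses their order, which the symmetrized products absorb.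
  The derivatives of the coefficients x_2 and x_3 leave c (2 x_1 rot_1 - x_2 rot_2 - x_3 rot_3),
  which equals 3 c x_1 rot_1 by \<open>rot_radial\<close>. This is the difference between 2 S + 5 /
  2 and 2 S - 1 / 2.\<close>

lemma forward_backward_adjoint:
  assumes F: "smooth F" and G: "smooth G"
  shows "(\<integral>x. forward_generator \<gamma> c S F x * G x \<partial>dOmega N)
    = (\<integral>x. F x * backward_generator \<gamma> c S G x \<partial>dOmega N)"
proof -
  let ?J = "\<lambda>f. \<integral>x. f x \<partial>dOmega N"
  let ?X1 = "\<lambda>x. x $ 1 * G x" and ?X2 = "\<lambda>x. x $ 2 * G x" and ?X3 = "\<lambda>x. x $ 3 * G x"
  note sm = smooth_mult smooth_rot smooth_add smooth_diff smooth_uminus smooth_coord smooth_const F G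
  have J_add: "?J (\<lambda>x. f x + g x) = ?J f + ?J g" if "smooth f" "smooth g" for f g
    using that by (intro Bochner_Integration.integral_add integrable_dOmega)
  have J_cmult: "?J (\<lambda>x. r * f x) = r * ?J f" for r :: real and f by (rule integral_mult_right_zero)
  have "?J (\<lambda>x. forward_generator \<gamma> c S F x * G x) =
    ?J (\<lambda>x. (2 * S + 5 / 2) * c * (rot 1 F x * ?X1 x)
      + (\<gamma> / 2 * (rot 1 (rot 1 F) x * G x) + (\<gamma> / 2 * (rot 2 (rot 2 F) x * G x) + (\<gamma> / 2 * (rot 3 (rot 3 F) x * G x)
      + ((- c / 2) * (rot 1 (rot 3 F) x * ?X2 x) + ((- c / 2) * (rot 3 (rot 1 F) x * ?X2 x)
      + ((c / 2) * (rot 1 (rot 2 F) x * ?X3 x) + (c / 2) * (rot 2 (rot 1 F) x * ?X3 x))))))))"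
    by (rule arg_cong[of _ _ ?J])
      (simp add: fun_eq_iff forward_generator_def twist_diffusion_def algebra_simps)
  also have "\<dots> = (2 * S + 5 / 2) * c * ?J (\<lambda>x. rot 1 F x * ?X1 x)
      + (\<gamma> / 2 * ?J (\<lambda>x. rot 1 (rot 1 F) x * G x) + (\<gamma> / 2 * ?J (\<lambda>x. rot 2 (rot 2 F) x * G x)
      + (\<gamma> / 2 * ?J (\<lambda>x. rot 3 (rot 3 F) x * G x)
      + ((- c / 2) * ?J (\<lambda>x. rot 1 (rot 3 F) x * ?X2 x) + ((- c / 2) * ?J (\<lambda>x. rot 3 (rot 1 F) x * ?X2 x)
      + ((c / 2) * ?J (\<lambda>x. rot 1 (rot 2 F) x * ?X3 x) + (c / 2) * ?J (\<lambda>x. rot 2 (rot 1 F) x * ?X3 x)))))))"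
    by (subst J_add; (intro sm)?)+ (simp only: J_cmult)
  also have "\<dots> = - ((2 * S + 5 / 2) * c) * ?J (\<lambda>x. F x * rot 1 ?X1 x)
      + (\<gamma> / 2 * ?J (\<lambda>x. F x * rot 1 (rot 1 G) x) + (\<gamma> / 2 * ?J (\<lambda>x. F x * rot 2 (rot 2 G) x)
      + (\<gamma> / 2 * ?J (\<lambda>x. F x * rot 3 (rot 3 G) x)
      + ((- c / 2) * ?J (\<lambda>x. F x * rot 3 (rot 1 ?X2) x) + ((- c / 2) * ?J (\<lambda>x. F x * rot 1 (rot 3 ?X2) x)
      + ((c / 2) * ?J (\<lambda>x. F x * rot 2 (rot 1 ?X3) x) + (c / 2) * ?J (\<lambda>x. F x * rot 1 (rot 2 ?X3) x)))))))"
    by (subst integral_rot_rot integral_rot_skew; (intro sm)?)+ simp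
  also have "\<dots> = ?J (\<lambda>x. - ((2 * S + 5 / 2) * c) * (F x * rot 1 ?X1 x)
      + (\<gamma> / 2 * (F x * rot 1 (rot 1 G) x) + (\<gamma> / 2 * (F x * rot 2 (rot 2 G) x)
      + (\<gamma> / 2 * (F x * rot 3 (rot 3 G) x)
      + ((- c / 2) * (F x * rot 3 (rot 1 ?X2) x) + ((- c / 2) * (F x * rot 1 (rot 3 ?X2) x)
      + ((c / 2) * (F x * rot 2 (rot 1 ?X3) x) + (c / 2) * (F x * rot 1 (rot 2 ?X3) x))))))))"
    by (subst J_add; (intro sm)?)+ (simp only: J_cmult)
  also have "\<dots> = ?J (\<lambda>x. F x * backward_generator \<gamma> c S G x)"
  proof (rule arg_cong[of _ _ ?J], rule ext)
    fix x
    have r1: "rot \<mu> (\<lambda>x. x $ i * G x) = (\<lambda>x. x $ i * rot \<mu> G x + rot \<mu> (\<lambda>x. x $ i) x * G x)" for \<mu> i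
      by (rule ext, rule rot_mult) (intro sm)+
    have r2: "rot \<mu> (\<lambda>x. x $ i * rot \<nu> G x + r x * G x) x
        = (x $ i * rot \<mu> (rot \<nu> G) x + rot \<mu> (\<lambda>x. x $ i) x * rot \<nu> G x) + (r x * rot \<mu> G x + rot \<mu> r x * G x)"
      if "smooth r" for \<mu> \<nu> i r
      using that by (subst rot_add; (intro sm)?) (simp_all add: rot_mult sm)
    have r3: "rot \<mu> (\<lambda>x. x $ i * rot \<nu> G x - r x * G x) x
        = (x $ i * rot \<mu> (rot \<nu> G) x + rot \<mu> (\<lambda>x. x $ i) x * rot \<nu> G x) - (r x * rot \<mu> G x + rot \<mu> r x * G x)"
      if "smooth r" for \<mu> \<nu> i r
      using that by (subst rot_diff; (intro sm)?) (simp_all add: rot_mult sm)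
    have neg: "rot \<mu> (\<lambda>x. - x $ i) x = - rot \<mu> (\<lambda>x. x $ i) x" for \<mu> i
      using rot_cmult[of "\<lambda>x. x $ i" \<mu> "-1" x] by simp
    have "rot 1 ?X1 x = x $ 1 * rot 1 G x"
      "rot 3 (rot 1 ?X2) x = x $ 2 * rot 3 (rot 1 G) x - x $ 1 * rot 1 G x + x $ 3 * rot 3 G x"
      "rot 1 (rot 3 ?X2) x = x $ 2 * rot 1 (rot 3 G) x + x $ 3 * rot 3 G x - x $ 1 * rot 1 G x"
      "rot 2 (rot 1 ?X3) x = x $ 3 * rot 2 (rot 1 G) x + x $ 1 * rot 1 G x - x $ 2 * rot 2 G x"
      "rot 1 (rot 2 ?X3) x = x $ 3 * rot 1 (rot 2 G) x - x $ 2 * rot 2 G x + x $ 1 * rot 1 G x"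
      by (simp_all add: r1 rot_coord r2 r3 sm neg del: mult_minus_left)
    moreover have "x $ 2 * rot 2 G x = - (x $ 1 * rot 1 G x) - x $ 3 * rot 3 G x"
      using rot_radial[of x G] by simp
    ultimately show "- ((2 * S + 5 / 2) * c) * (F x * rot 1 ?X1 x)
      + (\<gamma> / 2 * (F x * rot 1 (rot 1 G) x) + (\<gamma> / 2 * (F x * rot 2 (rot 2 G) x)
      + (\<gamma> / 2 * (F x * rot 3 (rot 3 G) x)
      + ((- c / 2) * (F x * rot 3 (rot 1 ?X2) x) + ((- c / 2) * (F x * rot 1 (rot 3 ?X2) x)
      + ((c / 2) * (F x * rot 2 (rot 1 ?X3) x) + (c / 2) * (F x * rot 1 (rot 2 ?X3) x)))))))
      = F x * backward_generator \<gamma> c S G x"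
      by (simp only: backward_generator_def twist_diffusion_def) (simp add: algebra_simps add_divide_distrib diff_divide_distrib)
  qed
  finally show ?thesis .
qed

section \<open>The backward generator in Cartesian derivatives and its diffusion matrix\<close>

lemma partial_diff:
  assumes "f differentiable (at x)" "g differentiable (at x)"
  shows "partial \<mu> (\<lambda>x. f x - g x) x = partial \<mu> f x - partial \<mu> g x"
  using partial_eqI[OF has_derivative_diff[OF has_derivative_partial[OF assms(1)] has_derivative_partial[OF assms(2)]], of \<mu>]
  by (simp add: axis_def if_distrib[of "\<lambda>c. c * _"] cong: if_cong)

lemma partial_coord_mult:
  "f differentiable (at x) \<Longrightarrow>
    partial i (\<lambda>x. x $ j * f x) x = x $ j * partial i f x + (if i = j then f x else 0)"
  by (subst partial_mult) (simp_all add: partial_coord smooth_differentiable)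

lemma partial_rot:
  assumes "smooth G"
  shows "partial i (rot 1 G) x = (x $ 3 * partial i (partial 2 G) x + (if i = 3 then partial 2 G x else 0))
      - (x $ 2 * partial i (partial 3 G) x + (if i = 2 then partial 3 G x else 0))"
    "partial i (rot 2 G) x = (x $ 1 * partial i (partial 3 G) x + (if i = 1 then partial 3 G x else 0))
      - (x $ 3 * partial i (partial 1 G) x + (if i = 3 then partial 1 G x else 0))"
    "partial i (rot 3 G) x = (x $ 2 * partial i (partial 1 G) x + (if i = 2 then partial 1 G x else 0))
      - (x $ 1 * partial i (partial 2 G) x + (if i = 1 then partial 2 G x else 0))"
  unfolding rot_eq[abs_def]
  by (subst partial_diff; (intro smooth_differentiable smooth_intros assms)?;
      simp add: partial_coord_mult smooth_differentiable smooth_partial assms)+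

text \<open>The columns of a factorization of the diffusion matrix: three rotation vectors, whose
  outer products sum to the tangent projection, and one vector that carries the twist. On the unit
  sphere (x_2)^2 + (x_3)^2 is the squared length of the tangential part of the first axis; written
  as this polynomial, it makes orthogonality to \<open>x\<close> an algebraic identity.\<close>

definition walk_direction :: "real \<Rightarrow> real \<Rightarrow> nat \<Rightarrow> real^3 \<Rightarrow> real^3" where
  "walk_direction \<gamma> c i x =
    (if i < 3 then sqrt (\<gamma> - \<bar>c\<bar> * ((x $ 2)\<^sup>2 + (x $ 3)\<^sup>2)) *\<^sub>R
       (if i = 0 then vector [0, x $ 3, - x $ 2]
        else if i = 1 then vector [- x $ 3, 0, x $ 1]
        else vector [x $ 2, - x $ 1, 0])
     else sqrt \<bar>c\<bar> *\<^sub>R (vector [(x $ 2)\<^sup>2 + (x $ 3)\<^sup>2, - (x $ 1 * x $ 2), - (x $ 1 * x $ 3)]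
       - sgn c *\<^sub>R vector [0, x $ 3, - x $ 2]))"

text \<open>The constant is 2 S - 1 instead of 2 S - 1 / 2: expanded in Cartesian second
  derivatives, the symmetrized products leave the first-order remainder c / 2 times x_1
  rot_1.\<close>

definition walk_drift :: "real \<Rightarrow> real \<Rightarrow> real^3 \<Rightarrow> real^3" where
  "walk_drift c S x = (- (2 * S - 1) * c * x $ 1) *\<^sub>R vector [0, x $ 3, - x $ 2]"

lemma sphere_identities:
  fixes X Y Z :: real
  assumes "X\<^sup>2 + Y\<^sup>2 + Z\<^sup>2 = 1"
  shows "X * Y * (X * Y) + Z * Z = (Y * Y + Z * Z) * (Z * Z + X * X)"
    "X * Z * (X * Z) + Y * Y = (Y * Y + Z * Z) * (Y * Y + X * X)"
    "X * Y * (X * Z) - Y * Z = - ((Y * Y + Z * Z) * (Y * Z))"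
proof -
  have X: "X * X = 1 - Y * Y - Z * Z" using assms by (simp add: power2_eq_square)
  have "X * Y * (X * Y) = X * X * (Y * Y)" "X * Z * (X * Z) = X * X * (Z * Z)"
    "X * Y * (X * Z) = X * X * (Y * Z)" by (simp_all add: mult_ac)
  then show "X * Y * (X * Y) + Z * Z = (Y * Y + Z * Z) * (Z * Z + X * X)"
    "X * Z * (X * Z) + Y * Y = (Y * Y + Z * Z) * (Y * Y + X * X)"
    "X * Y * (X * Z) - Y * Z = - ((Y * Y + Z * Z) * (Y * Z))"
    unfolding X by (simp_all add: algebra_simps)
qed

text \<open>The diffusion matrix \<open>\<gamma> P - c (a b\<^sup>T + b a\<^sup>T)\<close> of the backward generator, where \<open>P\<close> projects to the
  tangent plane, \<open>b = x \<times> e\<^sub>1\<close> and \<open>a = P e\<^sub>1\<close>, is positive since \<open>a\<close> and \<open>b\<close> are orthogonal and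
  \<open>\<bar>a\<bar> = \<bar>b\<bar> \<le> 1\<close>. It equals \<open>(\<gamma> - \<bar>c\<bar> \<bar>a\<bar>\<^sup>2) P + \<bar>c\<bar> (a - sgn c b)(a - sgn c b)\<^sup>T\<close>, so that this is
  where the threshold \<open>\<gamma> \<ge> \<bar>c\<bar>\<close> enters.\<close>

lemma walk_covariance:
  fixes j k :: 3
  assumes x: "(x $ 1)\<^sup>2 + (x $ 2)\<^sup>2 + (x $ 3)\<^sup>2 = 1" and c: "\<bar>c\<bar> \<le> \<gamma>"
  defines "a \<equiv> vector [(x $ 2)\<^sup>2 + (x $ 3)\<^sup>2, - (x $ 1 * x $ 2), - (x $ 1 * x $ 3)] :: real^3"
    and "b1 \<equiv> vector [0, x $ 3, - x $ 2] :: real^3"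
    and "b2 \<equiv> vector [- x $ 3, 0, x $ 1] :: real^3"
    and "b3 \<equiv> vector [x $ 2, - x $ 1, 0] :: real^3"
  shows "(\<Sum>i<4. walk_direction \<gamma> c i x $ j * walk_direction \<gamma> c i x $ k)
    = \<gamma> * (b1 $ j * b1 $ k + b2 $ j * b2 $ k + b3 $ j * b3 $ k) - c * (a $ j * b1 $ k + b1 $ j * a $ k)"
proof -
  define s where "s = (x $ 2)\<^sup>2 + (x $ 3)\<^sup>2"
  have a_s: "a = vector [s, - (x $ 1 * x $ 2), - (x $ 1 * x $ 3)]" by (simp add: a_def s_def)
  have x1: "(x $ 1)\<^sup>2 = 1 - s" using x by (simp add: s_def)
  have "\<bar>c\<bar> * s \<le> \<bar>c\<bar> * 1"
    using x1 zero_le_power2[of "x $ 1"] by (intro mult_left_mono) auto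
  then have g: "sqrt (\<gamma> - \<bar>c\<bar> * s) * sqrt (\<gamma> - \<bar>c\<bar> * s) = \<gamma> - \<bar>c\<bar> * s" using c by simp
  have sg: "\<bar>c\<bar> * (sgn c * sgn c) = \<bar>c\<bar>" "\<bar>c\<bar> * sgn c = c" by (auto simp: sgn_if)
  have sum4: "(\<Sum>i<4. f i) = f 0 + f 1 + f 2 + f (3::nat)" for f :: "nat \<Rightarrow> real"
    by (simp add: eval_nat_numeral)
  \<comment> \<open>\<open>a\<close> and \<open>b1\<close> are orthogonal tangent vectors of the
    same squared length \<open>s\<close>, so their outer products sum to \<open>s\<close> times the
    tangent projection; the outer products of the three rotation vectors sum to the same
    projection.\<close>
  have P: "a $ j * a $ k + b1 $ j * b1 $ k = s * (b1 $ j * b1 $ k + b2 $ j * b2 $ k + b3 $ j * b3 $ k)" for j k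
  proof (rule rot_cases[of _ j]; rule rot_cases[of _ k])
    show "a $ 1 * a $ 1 + b1 $ 1 * b1 $ 1 = s * (b1 $ 1 * b1 $ 1 + b2 $ 1 * b2 $ 1 + b3 $ 1 * b3 $ 1)"
      by (simp add: a_def b1_def b2_def b3_def s_def[symmetric]) (simp add: s_def power2_eq_square algebra_simps)
    show "a $ 1 * a $ 2 + b1 $ 1 * b1 $ 2 = s * (b1 $ 1 * b1 $ 2 + b2 $ 1 * b2 $ 2 + b3 $ 1 * b3 $ 2)"
      "a $ 1 * a $ 3 + b1 $ 1 * b1 $ 3 = s * (b1 $ 1 * b1 $ 3 + b2 $ 1 * b2 $ 3 + b3 $ 1 * b3 $ 3)"
      "a $ 2 * a $ 1 + b1 $ 2 * b1 $ 1 = s * (b1 $ 2 * b1 $ 1 + b2 $ 2 * b2 $ 1 + b3 $ 2 * b3 $ 1)"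
      "a $ 3 * a $ 1 + b1 $ 3 * b1 $ 1 = s * (b1 $ 3 * b1 $ 1 + b2 $ 3 * b2 $ 1 + b3 $ 3 * b3 $ 1)"
      by (simp_all add: a_def b1_def b2_def b3_def s_def[symmetric])
    show "a $ 2 * a $ 2 + b1 $ 2 * b1 $ 2 = s * (b1 $ 2 * b1 $ 2 + b2 $ 2 * b2 $ 2 + b3 $ 2 * b3 $ 2)"
      "a $ 2 * a $ 3 + b1 $ 2 * b1 $ 3 = s * (b1 $ 2 * b1 $ 3 + b2 $ 2 * b2 $ 3 + b3 $ 2 * b3 $ 3)"
      "a $ 3 * a $ 2 + b1 $ 3 * b1 $ 2 = s * (b1 $ 3 * b1 $ 2 + b2 $ 3 * b2 $ 2 + b3 $ 3 * b3 $ 2)"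
      "a $ 3 * a $ 3 + b1 $ 3 * b1 $ 3 = s * (b1 $ 3 * b1 $ 3 + b2 $ 3 * b2 $ 3 + b3 $ 3 * b3 $ 3)"
      using sphere_identities[OF x]
      by (simp_all add: a_def b1_def b2_def b3_def s_def power2_eq_square algebra_simps)
  qed
  have "(\<Sum>i<4. walk_direction \<gamma> c i x $ j * walk_direction \<gamma> c i x $ k)
    = sqrt (\<gamma> - \<bar>c\<bar> * s) * sqrt (\<gamma> - \<bar>c\<bar> * s) * (b1 $ j * b1 $ k + b2 $ j * b2 $ k + b3 $ j * b3 $ k)
      + sqrt \<bar>c\<bar> * sqrt \<bar>c\<bar> * ((a $ j - sgn c * b1 $ j) * (a $ k - sgn c * b1 $ k))"
    unfolding sum4 by (simp add: walk_direction_def flip: s_def a_s b1_def b2_def b3_def) (simp add: algebra_simps)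
  also have "\<dots> = (\<gamma> - \<bar>c\<bar> * s) * (b1 $ j * b1 $ k + b2 $ j * b2 $ k + b3 $ j * b3 $ k)
      + (\<bar>c\<bar> * (a $ j * a $ k) + \<bar>c\<bar> * (sgn c * sgn c) * (b1 $ j * b1 $ k)
         - \<bar>c\<bar> * sgn c * (a $ j * b1 $ k + b1 $ j * a $ k))"
    unfolding g by (simp add: algebra_simps)
  also have "\<dots> = (\<gamma> - \<bar>c\<bar> * s) * (b1 $ j * b1 $ k + b2 $ j * b2 $ k + b3 $ j * b3 $ k)
      + (\<bar>c\<bar> * (a $ j * a $ k + b1 $ j * b1 $ k) - c * (a $ j * b1 $ k + b1 $ j * a $ k))"
    unfolding sg by (simp add: algebra_simps)
  finally show ?thesis unfolding P by (simp add: algebra_simps)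
qed

lemma backward_generator_walk:
  assumes G: "smooth G" and x: "norm x = 1" and c: "\<bar>c\<bar> \<le> \<gamma>"
  shows "backward_generator \<gamma> c S G x = dir_deriv (walk_drift c S x) G x
    + (\<Sum>i<4. dir_deriv (walk_direction \<gamma> c i x) (dir_deriv (walk_direction \<gamma> c i x) G) x / 2
         - walk_direction \<gamma> c i x \<bullet> walk_direction \<gamma> c i x / 2 * dir_deriv x G x)"
proof -
  have x2: "(x $ 1)\<^sup>2 + (x $ 2)\<^sup>2 + (x $ 3)\<^sup>2 = 1"
    using x by (simp add: norm_eq_sqrt_inner inner_vec_def sum_3 power2_eq_square)
  note cov = walk_covariance[OF x2 c]
  define h where "h i j = partial i (partial j G) x" for i j
  define M where "M j k = (\<Sum>i<4. walk_direction \<gamma> c i x $ j * walk_direction \<gamma> c i x $ k)" for j k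
  have quad: "(\<Sum>i<4. dir_deriv (walk_direction \<gamma> c i x) (dir_deriv (walk_direction \<gamma> c i x) G) x)
      = (\<Sum>j\<in>UNIV. \<Sum>k\<in>UNIV. M j k * h j k)"
    unfolding dir_deriv_dir_deriv[OF G] M_def h_def sum_distrib_right
    by (simp add: sum_3 sum.distrib)
  have "(\<Sum>i<4. walk_direction \<gamma> c i x \<bullet> walk_direction \<gamma> c i x) = M 1 1 + M 2 2 + M 3 3"
    unfolding M_def by (simp add: inner_vec_def sum_3 sum.distrib)
  also have "\<dots> = 2 * \<gamma> * ((x $ 1)\<^sup>2 + (x $ 2)\<^sup>2 + (x $ 3)\<^sup>2)"
    unfolding M_def cov by (simp add: power2_eq_square algebra_simps)
  \<comment> \<open>The trace 2 \<gamma> makes the curvature correction equal to -\<gamma> times the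
    radial derivative, which is the first-order part of \<gamma> / 2 times the sum of the squared
    rotation fields.\<close>
  finally have tr: "(\<Sum>i<4. walk_direction \<gamma> c i x \<bullet> walk_direction \<gamma> c i x) = 2 * \<gamma>" using x2 by simp
  have "(\<Sum>i<4. dir_deriv (walk_direction \<gamma> c i x) (dir_deriv (walk_direction \<gamma> c i x) G) x / 2
         - walk_direction \<gamma> c i x \<bullet> walk_direction \<gamma> c i x / 2 * dir_deriv x G x)
     = (\<Sum>j\<in>UNIV. \<Sum>k\<in>UNIV. M j k * h j k) / 2 - \<gamma> * dir_deriv x G x"
    unfolding sum_subtractf by (simp add: quad tr flip: sum_divide_distrib sum_distrib_right)
  moreover have "backward_generator \<gamma> c S G x = dir_deriv (walk_drift c S x) G x
      + ((\<Sum>j\<in>UNIV. \<Sum>k\<in>UNIV. M j k * h j k) / 2 - \<gamma> * dir_deriv x G x)"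
    unfolding M_def cov backward_generator_def twist_diffusion_def
    by (simp add: rot_eq partial_rot[OF G] walk_drift_def dir_deriv_def sum_3 flip: h_def)
      (simp add: power2_eq_square algebra_simps add_divide_distrib diff_divide_distrib)
  ultimately show ?thesis by simp
qed

lemma continuous_vector3:
  assumes "continuous_on A f" "continuous_on A g" "continuous_on A h"
  shows "continuous_on A (\<lambda>x. vector [f x, g x, h x] :: real^3)"
proof -
  have "(\<lambda>x. vector [f x, g x, h x] :: real^3) = (\<lambda>x. \<chi> i. if i = 1 then f x else if i = 2 then g x else h x)"
    by (rule ext) (simp add: Finite_Cartesian_Product.vec_eq_iff forall_3)
  moreover have "continuous_on A (\<lambda>x. if i = (1::3) then f x else if i = 2 then g x else h x)" for i
    using assms by (cases "i = 1"; cases "i = 2") auto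
  ultimately show ?thesis by (simp only:) (rule continuous_on_vec_lambda)
qed

lemma continuous_walk_direction: "continuous_on A (walk_direction \<gamma> c i)"
  unfolding walk_direction_def[abs_def]
  by (cases "i < 3"; cases "i = 0"; cases "i = 1") (auto intro!: continuous_intros continuous_vector3)

lemma continuous_walk_drift: "continuous_on A (walk_drift c S)"
  unfolding walk_drift_def[abs_def] by (intro continuous_intros continuous_vector3)

lemma walk_tangential:
  assumes "norm x = 1"
  shows "walk_direction \<gamma> c i x \<bullet> x = 0" "walk_drift c S x \<bullet> x = 0"
proof -
  show "walk_direction \<gamma> c i x \<bullet> x = 0"
    by (simp add: walk_direction_def inner_vec_def sum_3 power2_eq_square algebra_simps)
  show "walk_drift c S x \<bullet> x = 0"
    by (simp add: walk_drift_def inner_vec_def sum_3 algebra_simps)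
qed

text \<open>The eight moves are two signs for each of four directions.\<close>

theorem random_walk_backward_generator:
  assumes c: "\<bar>c\<bar> \<le> \<gamma>"
  shows "random_walk (sphere 0 1) {g. smooth g} (backward_generator \<gamma> c S) 8
    (walk_step 4 (walk_direction \<gamma> c) (walk_drift c S))"
proof
  fix h :: real and i :: nat and x :: "real^3" and g :: "real^3 \<Rightarrow> real"
  show "walk_step 4 (walk_direction \<gamma> c) (walk_drift c S) h i \<in> borel_measurable borel"
  proof (rule borel_measurable_continuous_onI)
    have "1 + v \<bullet> v / 4 \<noteq> 0" for v :: "real^3"
      using inner_ge_zero[of v] by linarith
    then show "continuous_on UNIV (walk_step 4 (walk_direction \<gamma> c) (walk_drift c S) h i)"
      unfolding walk_step_def[abs_def] sphere_step_def
      by (intro continuous_intros continuous_walk_direction continuous_walk_drift) auto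
  qed
  show "walk_step 4 (walk_direction \<gamma> c) (walk_drift c S) h i x \<in> sphere 0 1" if "x \<in> sphere 0 1"
  proof -
    have "norm x = 1" using that by simp
    then show ?thesis
      unfolding walk_step_def by (simp add: norm_sphere_step walk_tangential inner_add_left)
  qed
  show "\<exists>C. \<forall>h\<in>{0<..1}. \<forall>x\<in>sphere 0 1.
      \<bar>(\<Sum>i<8. g (walk_step 4 (walk_direction \<gamma> c) (walk_drift c S) h i x)) / real 8 - g x
        - h * backward_generator \<gamma> c S g x\<bar> \<le> C * (h * sqrt h)" if "g \<in> {g. smooth g}"
  proof -
    have g: "smooth g" using that by simp
    show ?thesis
      using walk_consistent[OF g, of 4 "walk_direction \<gamma> c" "walk_drift c S"]
        continuous_walk_direction continuous_walk_drift walk_tangential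
      by (simp add: backward_generator_walk[OF g _ c])
  qed
qed (auto simp: smooth_continuous smooth_backward_generator)

section \<open>Complex-valued smooth functions\<close>

definition csmooth :: "(real^3 \<Rightarrow> complex) \<Rightarrow> bool" where
  "csmooth f \<longleftrightarrow> smooth (\<lambda>x. Re (f x)) \<and> smooth (\<lambda>x. Im (f x))"

definition crot :: "3 \<Rightarrow> (real^3 \<Rightarrow> complex) \<Rightarrow> real^3 \<Rightarrow> complex" where
  "crot \<mu> f x = Complex (rot \<mu> (\<lambda>x. Re (f x)) x) (rot \<mu> (\<lambda>x. Im (f x)) x)"

lemma csmooth_const [simp]: "csmooth (\<lambda>x. c)"
  by (simp add: csmooth_def)

lemma csmooth_of_real: "smooth f \<Longrightarrow> csmooth (\<lambda>x. complex_of_real (f x))"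
  by (simp add: csmooth_def)

lemma csmooth_Complex: "smooth f \<Longrightarrow> smooth g \<Longrightarrow> csmooth (\<lambda>x. Complex (f x) (g x))"
  by (simp add: csmooth_def)

lemma csmooth_add: "csmooth f \<Longrightarrow> csmooth g \<Longrightarrow> csmooth (\<lambda>x. f x + g x)"
  by (simp add: csmooth_def smooth_add)

lemma csmooth_diff: "csmooth f \<Longrightarrow> csmooth g \<Longrightarrow> csmooth (\<lambda>x. f x - g x)"
  by (simp add: csmooth_def smooth_diff)

lemma csmooth_mult: "csmooth f \<Longrightarrow> csmooth g \<Longrightarrow> csmooth (\<lambda>x. f x * g x)"
  by (simp add: csmooth_def smooth_add smooth_diff smooth_mult)

lemma csmooth_power: "csmooth f \<Longrightarrow> csmooth (\<lambda>x. f x ^ n)"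
  by (induction n) (auto intro: csmooth_mult)

lemma csmooth_sum: "(\<And>i. i \<in> I \<Longrightarrow> csmooth (f i)) \<Longrightarrow> csmooth (\<lambda>x. \<Sum>i\<in>I. f i x)"
  by (induction I rule: infinite_finite_induct) (auto intro: csmooth_add)

lemma csmooth_crot: "csmooth f \<Longrightarrow> csmooth (crot \<mu> f)"
  by (simp add: csmooth_def crot_def smooth_rot)

lemma crot_add: "csmooth f \<Longrightarrow> csmooth g \<Longrightarrow> crot \<mu> (\<lambda>x. f x + g x) x = crot \<mu> f x + crot \<mu> g x"
  by (simp add: csmooth_def crot_def rot_add complex_eq_iff)

lemma crot_diff: "csmooth f \<Longrightarrow> csmooth g \<Longrightarrow> crot \<mu> (\<lambda>x. f x - g x) x = crot \<mu> f x - crot \<mu> g x"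
  by (simp add: csmooth_def crot_def rot_diff complex_eq_iff)

lemma crot_mult:
  "csmooth f \<Longrightarrow> csmooth g \<Longrightarrow> crot \<mu> (\<lambda>x. f x * g x) x = f x * crot \<mu> g x + crot \<mu> f x * g x"
  by (simp add: csmooth_def crot_def rot_add rot_diff rot_mult smooth_mult complex_eq_iff algebra_simps)

lemma crot_const [simp]: "crot \<mu> (\<lambda>x. c) x = 0"
  by (simp add: crot_def complex_eq_iff)

lemma crot_cmult: "csmooth f \<Longrightarrow> crot \<mu> (\<lambda>x. c * f x) x = c * crot \<mu> f x"
  by (simp add: crot_mult)

lemma crot_multc: "csmooth f \<Longrightarrow> crot \<mu> (\<lambda>x. f x * c) x = crot \<mu> f x * c"
  by (simp add: crot_mult)

lemma crot_sum: "finite I \<Longrightarrow> (\<And>i. i \<in> I \<Longrightarrow> csmooth (f i)) \<Longrightarrow>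
    crot \<mu> (\<lambda>x. \<Sum>i\<in>I. f i x) x = (\<Sum>i\<in>I. crot \<mu> (f i) x)"
  by (induction I rule: finite_induct) (simp_all add: crot_add csmooth_sum)

section \<open>Differentiation along rotations of the sphere\<close>

definition axis_rotate :: "3 \<Rightarrow> real \<Rightarrow> real^3 \<Rightarrow> real^3" where
  "axis_rotate \<mu> s x =
    (if \<mu> = 1 then vector [x $ 1, cos s * x $ 2 - sin s * x $ 3, sin s * x $ 2 + cos s * x $ 3]
     else if \<mu> = 2 then vector [cos s * x $ 1 + sin s * x $ 3, x $ 2, cos s * x $ 3 - sin s * x $ 1]
     else vector [cos s * x $ 1 - sin s * x $ 2, sin s * x $ 1 + cos s * x $ 2, x $ 3])"

lemma axis_rotate_0 [simp]: "axis_rotate \<mu> 0 x = x"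
  by (rule rot_cases[of _ \<mu>]) (simp_all add: axis_rotate_def Finite_Cartesian_Product.vec_eq_iff forall_3)

lemma sin_cos_axis_rotate: "(cos s * a - sin s * b)\<^sup>2 + (sin s * a + cos s * b)\<^sup>2 = a\<^sup>2 + b\<^sup>2" for s :: real
proof -
  have "(c * a - t * b)\<^sup>2 + (t * a + c * b)\<^sup>2 = (t\<^sup>2 + c\<^sup>2) * (a\<^sup>2 + b\<^sup>2)" for c t :: real
    by (simp add: power2_eq_square algebra_simps)
  then show ?thesis by simp
qed

lemma norm_axis_rotate: "norm (axis_rotate \<mu> s x) = norm x"
proof -
  have "norm y = sqrt ((y $ 1)\<^sup>2 + (y $ 2)\<^sup>2 + (y $ 3)\<^sup>2)" for y :: "real^3"
    by (simp add: norm_eq_sqrt_inner inner_vec_def sum_3 power2_eq_square)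
  note n = this
  show ?thesis
    unfolding n
    by (rule rot_cases[of _ \<mu>])
      (use sin_cos_axis_rotate[of s "x $ 2" "x $ 3"] sin_cos_axis_rotate[of s "x $ 3" "x $ 1"]
        sin_cos_axis_rotate[of s "x $ 1" "x $ 2"] in \<open>simp_all add: axis_rotate_def add_ac\<close>)
qed

text \<open>The minus sign reflects that the bracket with a spin component on the left generates the
  rotation about its axis in the negative sense.\<close>

lemma rot_along_axis_rotate:
  assumes "smooth f"
  shows "((\<lambda>s. f (axis_rotate \<mu> s x)) has_real_derivative - rot \<mu> f x) (at 0)"
proof (rule rot_cases[of _ \<mu>])
  have "((\<lambda>s. axis_rotate 1 s x $ i) has_real_derivative vector [0, - x $ 3, x $ 2] $ i) (at 0)" for i
    by (rule rot_cases[of _ i]) (auto simp: axis_rotate_def intro!: derivative_eq_intros)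
  from smooth_along_curve[OF assms this]
  show "((\<lambda>s. f (axis_rotate 1 s x)) has_real_derivative - rot 1 f x) (at 0)"
    by (simp add: dir_deriv_def sum_3 rot_eq)
  have "((\<lambda>s. axis_rotate 2 s x $ i) has_real_derivative vector [x $ 3, 0, - x $ 1] $ i) (at 0)" for i
    by (rule rot_cases[of _ i]) (auto simp: axis_rotate_def intro!: derivative_eq_intros)
  from smooth_along_curve[OF assms this]
  show "((\<lambda>s. f (axis_rotate 2 s x)) has_real_derivative - rot 2 f x) (at 0)"
    by (simp add: dir_deriv_def sum_3 rot_eq)
  have "((\<lambda>s. axis_rotate 3 s x $ i) has_real_derivative vector [- x $ 2, x $ 1, 0] $ i) (at 0)" for i
    by (rule rot_cases[of _ i]) (auto simp: axis_rotate_def intro!: derivative_eq_intros)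
  from smooth_along_curve[OF assms this]
  show "((\<lambda>s. f (axis_rotate 3 s x)) has_real_derivative - rot 3 f x) (at 0)"
    by (simp add: dir_deriv_def sum_3 rot_eq)
qed

text \<open>The derivative is taken along a circle inside the sphere, so only the values there
  count. Identities that hold on the sphere alone, such as those for coherent projectors, may
  therefore be differentiated again.\<close>

lemma rot_cong_sphere:
  assumes "smooth f" "smooth g" "\<And>y. y \<in> sphere 0 1 \<Longrightarrow> f y = g y" "x \<in> sphere 0 1"
  shows "rot \<mu> f x = rot \<mu> g x"
proof -
  have "f (axis_rotate \<mu> s x) = g (axis_rotate \<mu> s x)" for s
    using assms(3,4) by (simp add: norm_axis_rotate)
  then show ?thesis
    using rot_along_axis_rotate[OF assms(1), of \<mu> x] rot_along_axis_rotate[OF assms(2), of \<mu> x]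
    by (auto dest: DERIV_unique)
qed

lemma crot_cong_sphere:
  assumes "csmooth f" "csmooth g" "\<And>y. y \<in> sphere 0 1 \<Longrightarrow> f y = g y" "x \<in> sphere 0 1"
  shows "crot \<mu> f x = crot \<mu> g x"
  using assms unfolding csmooth_def crot_def by (auto intro!: rot_cong_sphere)

lemma crot_along_axis_rotate:
  assumes f: "csmooth f" and d: "((\<lambda>s. f (axis_rotate \<mu> s x)) has_vector_derivative d) (at 0)"
  shows "crot \<mu> f x = - d"
proof -
  have "((\<lambda>s. Re (f (axis_rotate \<mu> s x))) has_real_derivative Re d) (at 0)"
    "((\<lambda>s. Im (f (axis_rotate \<mu> s x))) has_real_derivative Im d) (at 0)"
    using bounded_linear.has_vector_derivative[OF bounded_linear_Re d]
      bounded_linear.has_vector_derivative[OF bounded_linear_Im d]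
    by (simp_all add: has_real_derivative_iff_has_vector_derivative)
  moreover have "((\<lambda>s. Re (f (axis_rotate \<mu> s x))) has_real_derivative - Re (crot \<mu> f x)) (at 0)"
    "((\<lambda>s. Im (f (axis_rotate \<mu> s x))) has_real_derivative - Im (crot \<mu> f x)) (at 0)"
    using f rot_along_axis_rotate[of "\<lambda>x. Re (f x)" \<mu> x] rot_along_axis_rotate[of "\<lambda>x. Im (f x)" \<mu> x]
    by (simp_all add: csmooth_def crot_def)
  ultimately have "- Re (crot \<mu> f x) = Re d" "- Im (crot \<mu> f x) = Im d"
    by (auto dest: DERIV_unique)
  then show ?thesis by (simp add: complex_eq_iff)
qed

section \<open>Spin matrices\<close>

text \<open>The matrix element between the basis states \<open>i - 1\<close> and \<open>i\<close>: S
  (S + 1) - m (m + 1) with m = S - i equals i (N + 1 - i).\<close>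

definition ladder :: "nat \<Rightarrow> nat \<Rightarrow> real" where
  "ladder N i = sqrt (real i * (real N + 1 - real i))"

lemma ladder_0 [simp]: "ladder N 0 = 0" and ladder_Suc_N [simp]: "ladder N (Suc N) = 0"
  by (simp_all add: ladder_def)

lemma mat_adjoint_index:
  "A \<in> carrier_mat n m \<Longrightarrow> i < m \<Longrightarrow> j < n \<Longrightarrow> mat_adjoint A $$ (i, j) = cnj (A $$ (j, i))"
  by (simp add: mat_adjoint_def mat_of_rows_def)

lemma mat_adjoint_carrier: "A \<in> carrier_mat n m \<Longrightarrow> mat_adjoint A \<in> carrier_mat m n"
  by (rule carrier_matI) (simp_all add: mat_adjoint_def)

lemma spin_raise_carrier: "spin_raise N \<in> carrier_mat (Suc N) (Suc N)"
  by (simp add: spin_raise_def)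

lemma spin_lower_carrier: "spin_lower N \<in> carrier_mat (Suc N) (Suc N)"
  unfolding spin_lower_def by (rule mat_adjoint_carrier[OF spin_raise_carrier])

lemma spin_op_carrier [simp]: "spin_op N \<mu> \<in> carrier_mat (Suc N) (Suc N)"
  using spin_raise_carrier[of N] spin_lower_carrier[of N] by (auto simp: spin_op_def)

lemma spin_raise_index:
  assumes "i \<le> N" "j \<le> N"
  shows "spin_raise N $$ (i, j) = (if Suc i = j then complex_of_real (ladder N j) else 0)"
proof -
  have N2: "real N = 2 * spin N" by (simp add: spin_def)
  have "spin N * (spin N + 1) - (spin N - real j) * (spin N - real j + 1) = real j * (real N + 1 - real j)"
    unfolding N2 by (simp add: algebra_simps)
  then show ?thesis using assms by (simp add: spin_raise_def ladder_def Let_def)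
qed

lemma spin_lower_index:
  assumes "i \<le> N" "j \<le> N"
  shows "spin_lower N $$ (i, j) = (if Suc j = i then complex_of_real (ladder N i) else 0)"
  unfolding spin_lower_def
  by (subst mat_adjoint_index[OF spin_raise_carrier]) (use assms in \<open>auto simp: spin_raise_index\<close>)

lemma spin_op_index:
  assumes "i \<le> N" "j \<le> N"
  shows "spin_op N 1 $$ (i, j) = ((if Suc i = j then complex_of_real (ladder N j) else 0)
      + (if Suc j = i then complex_of_real (ladder N i) else 0)) / 2"
    "spin_op N 2 $$ (i, j) = ((if Suc i = j then complex_of_real (ladder N j) else 0)
      - (if Suc j = i then complex_of_real (ladder N i) else 0)) / (2 * \<i>)"
    "spin_op N 3 $$ (i, j) = (if i = j then complex_of_real (spin N - real j) else 0)"
  using assms spin_raise_carrier[of N] spin_lower_carrier[of N]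
  by (simp_all add: spin_op_def spin_raise_index[OF assms] spin_lower_index[OF assms])

lemma spin_op_hermitian:
  assumes "i \<le> N" "j \<le> N"
  shows "cnj (spin_op N \<mu> $$ (i, j)) = spin_op N \<mu> $$ (j, i)"
  by (rule rot_cases[of _ \<mu>]) (use assms in \<open>auto simp: spin_op_index\<close>)

text \<open>Acts on sequences over all natural numbers. At \<open>i = 0\<close> the truncated
  \<open>f (i - 1)\<close> is \<open>f 0\<close>, and at \<open>i = N\<close> the value
  \<open>f (Suc i)\<close> lies outside the space; both are multiplied by a vanishing
  \<open>ladder\<close>.\<close>

definition spin_act :: "nat \<Rightarrow> 3 \<Rightarrow> (nat \<Rightarrow> complex) \<Rightarrow> nat \<Rightarrow> complex" where
  "spin_act N \<mu> f i =
    (if \<mu> = 1 then (complex_of_real (ladder N (Suc i)) * f (Suc i) + complex_of_real (ladder N i) * f (i - 1)) / 2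
     else if \<mu> = 2 then (complex_of_real (ladder N (Suc i)) * f (Suc i) - complex_of_real (ladder N i) * f (i - 1)) / (2 * \<i>)
     else complex_of_real (spin N - real i) * f i)"

lemma sum_spin_op:
  assumes "i \<le> N"
  shows "(\<Sum>k<Suc N. spin_op N \<mu> $$ (i, k) * f k) = spin_act N \<mu> f i"
proof -
  have r: "(\<Sum>k<Suc N. (if Suc i = k then complex_of_real (ladder N k) else 0) * f k)
      = ladder N (Suc i) * f (Suc i)"
    using assms by (cases "i = N") (simp_all add: if_distrib[of "\<lambda>a. a * _"] sum.delta' cong: if_cong)
  have l: "(\<Sum>k<Suc N. (if Suc k = i then complex_of_real (ladder N i) else 0) * f k)
      = ladder N i * f (i - 1)"
    using assms by (cases i) (simp_all add: if_distrib[of "\<lambda>a. a * _"] cong: if_cong)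
  have d: "(\<Sum>k<Suc N. (if i = k then complex_of_real (spin N - real k) else 0) * f k)
      = complex_of_real (spin N - real i) * f i"
    using assms by (simp add: if_distrib[of "\<lambda>a. a * _"] sum.delta' del: sum.lessThan_Suc cong: if_cong)
  show ?thesis
  proof (rule rot_cases[of _ \<mu>])
    have "(\<Sum>k<Suc N. spin_op N 1 $$ (i, k) * f k)
      = ((\<Sum>k<Suc N. (if Suc i = k then complex_of_real (ladder N k) else 0) * f k)
        + (\<Sum>k<Suc N. (if Suc k = i then complex_of_real (ladder N i) else 0) * f k)) / 2"
      unfolding sum_divide_distrib sum.distrib[symmetric]
      by (intro sum.cong refl) (simp add: spin_op_index assms algebra_simps add_divide_distrib)
    then show "(\<Sum>k<Suc N. spin_op N 1 $$ (i, k) * f k) = spin_act N 1 f i"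
      unfolding r l by (simp add: spin_act_def)
    have "(\<Sum>k<Suc N. spin_op N 2 $$ (i, k) * f k)
      = ((\<Sum>k<Suc N. (if Suc i = k then complex_of_real (ladder N k) else 0) * f k)
        - (\<Sum>k<Suc N. (if Suc k = i then complex_of_real (ladder N i) else 0) * f k)) / (2 * \<i>)"
      unfolding sum_divide_distrib sum_subtractf[symmetric]
      by (intro sum.cong refl) (simp add: spin_op_index assms algebra_simps diff_divide_distrib)
    then show "(\<Sum>k<Suc N. spin_op N 2 $$ (i, k) * f k) = spin_act N 2 f i"
      unfolding r l by (simp add: spin_act_def)
    have "(\<Sum>k<Suc N. spin_op N 3 $$ (i, k) * f k)
      = (\<Sum>k<Suc N. (if i = k then complex_of_real (spin N - real k) else 0) * f k)"
      by (intro sum.cong refl) (simp add: spin_op_index assms)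
    then show "(\<Sum>k<Suc N. spin_op N 3 $$ (i, k) * f k) = spin_act N 3 f i"
      unfolding d by (simp add: spin_act_def)
  qed
qed

section \<open>Spinors and coherent states\<close>

text \<open>The Bloch vector of the spin-1/2 state with components \<alpha> and \<beta>; coherent
  states of every spin are parametrized through it.\<close>

definition hopf :: "complex \<Rightarrow> complex \<Rightarrow> real^3" where
  "hopf \<alpha> \<beta> = vector [2 * Re (\<alpha> * cnj \<beta>), - 2 * Im (\<alpha> * cnj \<beta>), (cmod \<alpha>)\<^sup>2 - (cmod \<beta>)\<^sup>2]"

lemma hopf_components:
  "hopf \<alpha> \<beta> $ 1 = 2 * Re (\<alpha> * cnj \<beta>)" "hopf \<alpha> \<beta> $ 2 = - 2 * Im (\<alpha> * cnj \<beta>)"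
  "hopf \<alpha> \<beta> $ 3 = (cmod \<alpha>)\<^sup>2 - (cmod \<beta>)\<^sup>2"
  by (simp_all add: hopf_def)

text \<open>The usual section with real \<alpha> = cos (\<theta> / 2). Its formula divides by
  \<alpha>, so at the south pole the pair (0, 1) is taken instead.\<close>

lemma hopf_surj:
  assumes "x \<in> sphere 0 1"
  obtains \<alpha> \<beta> where "(cmod \<alpha>)\<^sup>2 + (cmod \<beta>)\<^sup>2 = 1" "hopf \<alpha> \<beta> = x"
proof -
  have x: "(x $ 1)\<^sup>2 + (x $ 2)\<^sup>2 + (x $ 3)\<^sup>2 = 1"
    using assms by (simp add: norm_eq_sqrt_inner inner_vec_def sum_3 power2_eq_square)
  show ?thesis
  proof (cases "x $ 3 = -1")
    case True
    then have "(x $ 1)\<^sup>2 + (x $ 2)\<^sup>2 = 0" using x by simp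
    then have "x $ 1 = 0" "x $ 2 = 0" by (simp_all add: sum_power2_eq_zero_iff)
    then have "hopf 0 1 = x"
      using True by (simp add: hopf_def Finite_Cartesian_Product.vec_eq_iff forall_3)
    then show ?thesis by (intro that[of 0 1]) auto
  next
    case False
    have "(x $ 3)\<^sup>2 \<le> 1" using x sum_power2_ge_zero[of "x $ 1" "x $ 2"] by linarith
    then have "-1 \<le> x $ 3" by (simp add: abs_square_le_1 abs_le_iff)
    with False have z: "1 + x $ 3 > 0" by simp
    define a where "a = sqrt ((1 + x $ 3) / 2)"
    have a: "a > 0" "a\<^sup>2 = (1 + x $ 3) / 2" using z by (simp_all add: a_def)
    define b where "b = Complex (x $ 1 / (2 * a)) (x $ 2 / (2 * a))"
    have "(cmod b)\<^sup>2 = ((x $ 1)\<^sup>2 + (x $ 2)\<^sup>2) / (4 * a\<^sup>2)"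
      by (simp add: b_def cmod_power2 power_divide power_mult_distrib add_divide_distrib)
    also have "(x $ 1)\<^sup>2 + (x $ 2)\<^sup>2 = (1 + x $ 3) * (1 - x $ 3)"
      using x by (simp add: power2_eq_square algebra_simps)
    also have "(1 + x $ 3) * (1 - x $ 3) / (4 * a\<^sup>2) = (1 - x $ 3) / 2"
      unfolding a(2) using z by (simp add: field_simps)
    finally have b: "(cmod b)\<^sup>2 = (1 - x $ 3) / 2" .
    have "hopf (complex_of_real a) b = x"
      using a b by (simp add: hopf_def Finite_Cartesian_Product.vec_eq_iff forall_3 b_def[symmetric])
        (simp add: b_def)
    moreover have "(cmod (complex_of_real a))\<^sup>2 + (cmod b)\<^sup>2 = 1"
      using a b by (simp add: field_simps)
    ultimately show ?thesis by (rule that[rotated])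
  qed
qed

text \<open>First component of exp (-\<i> s \<sigma> / 2) applied to (\<alpha>, \<beta>), with
  \<sigma> the Pauli matrix of the axis. The parameter is complex so that the chain rule for
  holomorphic functions applies; real values give rotations.\<close>

definition su_fst :: "3 \<Rightarrow> complex \<Rightarrow> complex \<Rightarrow> complex \<Rightarrow> complex" where
  "su_fst \<mu> s \<alpha> \<beta> = cos (s / 2) * \<alpha>
     + sin (s / 2) * (if \<mu> = 1 then - \<i> * \<beta> else if \<mu> = 2 then - \<beta> else - \<i> * \<alpha>)"

definition su_snd :: "3 \<Rightarrow> complex \<Rightarrow> complex \<Rightarrow> complex \<Rightarrow> complex" where
  "su_snd \<mu> s \<alpha> \<beta> = cos (s / 2) * \<beta>
     + sin (s / 2) * (if \<mu> = 1 then - \<i> * \<alpha> else if \<mu> = 2 then \<alpha> else \<i> * \<beta>)"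

text \<open>The double cover of the rotation group, checked in real coordinates: the double-angle
  formulas express the rotation through half angles, and \<open>one'\<close> eliminates squares of
  the cosine.\<close>

lemma su_norm_hopf:
  fixes s :: real and \<mu> :: 3 and \<alpha> \<beta> :: complex
  defines "\<alpha>' \<equiv> su_fst \<mu> (of_real s) \<alpha> \<beta>" and "\<beta>' \<equiv> su_snd \<mu> (of_real s) \<alpha> \<beta>"
  shows "(cmod \<alpha>')\<^sup>2 + (cmod \<beta>')\<^sup>2 = (cmod \<alpha>)\<^sup>2 + (cmod \<beta>)\<^sup>2" "hopf \<alpha>' \<beta>' = axis_rotate \<mu> s (hopf \<alpha> \<beta>)"
proof -
  obtain a b d e where ab: "\<alpha> = Complex a b" "\<beta> = Complex d e" by (metis complex.exhaust)
  define c where "c = cos (s / 2)"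
  define t where "t = sin (s / 2)"
  have ct: "cos (of_real s / 2) = complex_of_real c" "sin (of_real s / 2) = complex_of_real t"
    unfolding c_def t_def by (simp_all flip: cos_of_real sin_of_real)
  have one: "c * c = 1 - t * t" using sin_cos_squared_add[of "s / 2"] by (simp add: c_def t_def power2_eq_square)
  have one': "c * (c * r) = r - t * (t * r)" for r
    using one by (simp add: left_diff_distrib flip: mult.assoc)
  have cs: "cos s = 1 - 2 * (t * t)" "sin s = 2 * (t * c)"
    using cos_double_sin[of "s / 2"] sin_double[of "s / 2"] by (simp_all add: c_def t_def power2_eq_square)
  show "(cmod \<alpha>')\<^sup>2 + (cmod \<beta>')\<^sup>2 = (cmod \<alpha>)\<^sup>2 + (cmod \<beta>)\<^sup>2"
    by (rule rot_cases[of _ \<mu>])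
      (simp_all add: \<alpha>'_def \<beta>'_def su_fst_def su_snd_def ab ct cmod_power2,
        simp_all add: power2_eq_square algebra_simps one one')
  show "hopf \<alpha>' \<beta>' = axis_rotate \<mu> s (hopf \<alpha> \<beta>)"
    unfolding Finite_Cartesian_Product.vec_eq_iff forall_3
    by (rule rot_cases[of _ \<mu>])
      (simp_all add: \<alpha>'_def \<beta>'_def su_fst_def su_snd_def ab ct hopf_def axis_rotate_def cs cmod_power2,
        simp_all add: power2_eq_square algebra_simps one one')
qed

text \<open>The N-fold symmetric power of (\<alpha>, \<beta>) in the orthonormal basis of the spin
  space; the root of the binomial coefficient normalizes the monomial.\<close>

definition spinor :: "nat \<Rightarrow> complex \<Rightarrow> complex \<Rightarrow> nat \<Rightarrow> complex" where
  "spinor N \<alpha> \<beta> j = complex_of_real (sqrt (real (N choose j))) * \<alpha> ^ (N - j) * \<beta> ^ j"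

definition spinor_d1 :: "nat \<Rightarrow> complex \<Rightarrow> complex \<Rightarrow> nat \<Rightarrow> complex" where
  "spinor_d1 N \<alpha> \<beta> j = complex_of_real (sqrt (real (N choose j))) * (of_nat (N - j) * \<alpha> ^ (N - j - 1)) * \<beta> ^ j"

definition spinor_d2 :: "nat \<Rightarrow> complex \<Rightarrow> complex \<Rightarrow> nat \<Rightarrow> complex" where
  "spinor_d2 N \<alpha> \<beta> j = complex_of_real (sqrt (real (N choose j))) * \<alpha> ^ (N - j) * (of_nat j * \<beta> ^ (j - 1))"

lemma DERIV_spinor:
  assumes "(a has_field_derivative a') (at z)" "(b has_field_derivative b') (at z)"
  shows "((\<lambda>z. spinor N (a z) (b z) j) has_field_derivative
    spinor_d1 N (a z) (b z) j * a' + spinor_d2 N (a z) (b z) j * b') (at z)"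
  unfolding spinor_def
  by (rule derivative_eq_intros assms refl)+ (simp add: spinor_d1_def spinor_d2_def algebra_simps)

lemma spinor_euler:
  assumes "j \<le> N"
  shows "\<alpha> * spinor_d1 N \<alpha> \<beta> j = of_nat (N - j) * spinor N \<alpha> \<beta> j"
    "\<beta> * spinor_d2 N \<alpha> \<beta> j = of_nat j * spinor N \<alpha> \<beta> j"
proof -
  show "\<alpha> * spinor_d1 N \<alpha> \<beta> j = of_nat (N - j) * spinor N \<alpha> \<beta> j"
    by (cases "N - j") (simp_all add: spinor_d1_def spinor_def)
  show "\<beta> * spinor_d2 N \<alpha> \<beta> j = of_nat j * spinor N \<alpha> \<beta> j"
    by (cases j) (simp_all add: spinor_d2_def spinor_def)
qed

lemma ladder_binomial:
  assumes "j \<le> N"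
  shows "ladder N (Suc j) * sqrt (real (N choose Suc j)) = real (N - j) * sqrt (real (N choose j))"
    "ladder N j * sqrt (real (N choose (j - 1))) = real j * sqrt (real (N choose j))"
proof -
  have b: "real (Suc j) * real (N choose Suc j) = real (N - j) * real (N choose j)" for j
    by (simp only: of_nat_mult[symmetric] binomial_absorption binomial_absorb_comp)
  have nn: "real N + 1 - real (Suc j) = real (N - j)" if "j \<le> N" for j using that by simp
  have l: "ladder N (Suc j) * sqrt (real (N choose Suc j)) = real (N - j) * sqrt (real (N choose j))"
    if "j \<le> N" for j
  proof -
    have "ladder N (Suc j) * sqrt (real (N choose Suc j))
        = sqrt (real (N - j) * (real (Suc j) * real (N choose Suc j)))"
      unfolding ladder_def nn[OF that] by (simp only: real_sqrt_mult[symmetric] mult_ac)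
    also have "\<dots> = sqrt (real (N - j) * real (N - j)) * sqrt (real (N choose j))"
      unfolding b by (simp only: real_sqrt_mult[symmetric] mult_ac)
    finally show ?thesis by simp
  qed
  then show "ladder N (Suc j) * sqrt (real (N choose Suc j)) = real (N - j) * sqrt (real (N choose j))"
    using assms by blast
  show "ladder N j * sqrt (real (N choose (j - 1))) = real j * sqrt (real (N choose j))"
  proof (cases j)
    case (Suc i)
    then have i: "i \<le> N" "real N + 1 - real (Suc i) = real (N - i)" using assms by auto
    have "ladder N (Suc i) * sqrt (real (N choose i))
        = sqrt (real (Suc i) * (real (N - i) * real (N choose i)))"
      unfolding ladder_def i(2) by (simp only: real_sqrt_mult[symmetric] mult_ac)
    also have "\<dots> = sqrt (real (Suc i) * real (Suc i)) * sqrt (real (N choose Suc i))"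
      unfolding b[symmetric] by (simp only: real_sqrt_mult[symmetric] mult_ac)
    finally show ?thesis by (simp add: Suc)
  qed simp
qed

text \<open>Together with the binomial roots the ladder coefficients turn the matrices into
  first-order differential operators in \<alpha> and \<beta>, as in Schwinger's representation.
  Identities for coherent states thereby become polynomial algebra in \<open>spinor_d1\<close> and
  \<open>spinor_d2\<close>.\<close>

lemma spin_act_spinor:
  assumes "j \<le> N"
  shows "spin_act N 1 (spinor N \<alpha> \<beta>) j = (\<beta> * spinor_d1 N \<alpha> \<beta> j + \<alpha> * spinor_d2 N \<alpha> \<beta> j) / 2"
    "spin_act N 2 (spinor N \<alpha> \<beta>) j = (\<beta> * spinor_d1 N \<alpha> \<beta> j - \<alpha> * spinor_d2 N \<alpha> \<beta> j) / (2 * \<i>)"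
    "spin_act N 3 (spinor N \<alpha> \<beta>) j = (\<alpha> * spinor_d1 N \<alpha> \<beta> j - \<beta> * spinor_d2 N \<alpha> \<beta> j) / 2"
proof -
  have r: "ladder N (Suc j) * spinor N \<alpha> \<beta> (Suc j) = \<beta> * spinor_d1 N \<alpha> \<beta> j"
  proof -
    have "ladder N (Suc j) * spinor N \<alpha> \<beta> (Suc j)
        = complex_of_real (ladder N (Suc j) * sqrt (real (N choose Suc j))) * \<alpha> ^ (N - Suc j) * \<beta> ^ Suc j"
      by (simp add: spinor_def mult_ac)
    then show ?thesis unfolding ladder_binomial[OF assms] by (simp add: spinor_d1_def mult_ac)
  qed
  have l: "ladder N j * spinor N \<alpha> \<beta> (j - 1) = \<alpha> * spinor_d2 N \<alpha> \<beta> j"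
  proof (cases j)
    case (Suc i)
    then have "\<alpha> ^ (N - i) = \<alpha> * \<alpha> ^ (N - j)" using assms by (simp flip: power_Suc add: Suc_diff_Suc)
    have "ladder N j * spinor N \<alpha> \<beta> (j - 1)
        = complex_of_real (ladder N j * sqrt (real (N choose (j - 1)))) * \<alpha> ^ (N - i) * \<beta> ^ i"
      by (simp add: spinor_def mult_ac Suc)
    also have "\<dots> = \<alpha> * spinor_d2 N \<alpha> \<beta> j"
      unfolding ladder_binomial[OF assms] \<open>\<alpha> ^ (N - i) = _\<close> by (simp add: spinor_d2_def mult_ac Suc)
    finally show ?thesis .
  qed (simp add: spinor_d2_def)
  show "spin_act N 1 (spinor N \<alpha> \<beta>) j = (\<beta> * spinor_d1 N \<alpha> \<beta> j + \<alpha> * spinor_d2 N \<alpha> \<beta> j) / 2"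
    "spin_act N 2 (spinor N \<alpha> \<beta>) j = (\<beta> * spinor_d1 N \<alpha> \<beta> j - \<alpha> * spinor_d2 N \<alpha> \<beta> j) / (2 * \<i>)"
    by (simp_all add: spin_act_def r l[unfolded One_nat_def])
  have "complex_of_real (spin N - real j) = (of_nat (N - j) - of_nat j) / 2"
    using assms by (simp add: spin_def of_nat_diff)
  then show "spin_act N 3 (spinor N \<alpha> \<beta>) j = (\<alpha> * spinor_d1 N \<alpha> \<beta> j - \<beta> * spinor_d2 N \<alpha> \<beta> j) / 2"
    unfolding spinor_euler[OF assms] by (simp add: spin_act_def left_diff_distrib diff_divide_distrib)
qed

lemma spinor_homogeneous:
  assumes "j \<le> N"
  shows "2 * complex_of_real (spin N) * spinor N \<alpha> \<beta> j = \<alpha> * spinor_d1 N \<alpha> \<beta> j + \<beta> * spinor_d2 N \<alpha> \<beta> j"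
  unfolding spinor_euler[OF assms] using assms by (simp add: spin_def of_nat_diff algebra_simps)

lemma hopf_complex:
  "complex_of_real (hopf \<alpha> \<beta> $ 1) = \<alpha> * cnj \<beta> + cnj \<alpha> * \<beta>"
  "complex_of_real (hopf \<alpha> \<beta> $ 2) = \<i> * (\<alpha> * cnj \<beta> - cnj \<alpha> * \<beta>)"
  "complex_of_real (hopf \<alpha> \<beta> $ 3) = \<alpha> * cnj \<alpha> - \<beta> * cnj \<beta>"
  unfolding hopf_components cmod_power2 by (simp_all add: complex_eq_iff power2_eq_square algebra_simps)

lemma norm_spinor_complex:
  assumes "(cmod \<alpha>)\<^sup>2 + (cmod \<beta>)\<^sup>2 = 1"
  shows "\<beta> * cnj \<beta> = 1 - \<alpha> * cnj \<alpha>"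
  using assms unfolding cmod_power2 by (simp add: complex_eq_iff power2_eq_square algebra_simps)

text \<open>With P and Q for the two derivatives, the left side is half of (|\<alpha>|^2 +
  |\<beta>|^2) (\<alpha> P + \<beta> Q), and Euler's identity for the degree N = 2 S evaluates
  it.\<close>

lemma spinor_eigen:
  assumes n: "(cmod \<alpha>)\<^sup>2 + (cmod \<beta>)\<^sup>2 = 1" and j: "j \<le> N"
  shows "hopf \<alpha> \<beta> $ 1 * spin_act N 1 (spinor N \<alpha> \<beta>) j + hopf \<alpha> \<beta> $ 2 * spin_act N 2 (spinor N \<alpha> \<beta>) j
      + hopf \<alpha> \<beta> $ 3 * spin_act N 3 (spinor N \<alpha> \<beta>) j = spin N * spinor N \<alpha> \<beta> j"
proof -
  define P where "P = spinor_d1 N \<alpha> \<beta> j"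
  define Q where "Q = spinor_d2 N \<alpha> \<beta> j"
  have i: "\<i> * a * (b / (2 * \<i>)) = a * b / 2" for a b :: complex by (simp add: field_simps)
  have "2 * (hopf \<alpha> \<beta> $ 1 * spin_act N 1 (spinor N \<alpha> \<beta>) j + hopf \<alpha> \<beta> $ 2 * spin_act N 2 (spinor N \<alpha> \<beta>) j
      + hopf \<alpha> \<beta> $ 3 * spin_act N 3 (spinor N \<alpha> \<beta>) j)
     = (\<alpha> * cnj \<beta> + cnj \<alpha> * \<beta>) * (\<beta> * P + \<alpha> * Q) + (\<alpha> * cnj \<beta> - cnj \<alpha> * \<beta>) * (\<beta> * P - \<alpha> * Q)
       + (\<alpha> * cnj \<alpha> - \<beta> * cnj \<beta>) * (\<alpha> * P - \<beta> * Q)"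
    unfolding hopf_complex spin_act_spinor[OF j] P_def[symmetric] Q_def[symmetric] i by (simp add: field_simps)
  also have "\<dots> = (\<alpha> * cnj \<alpha> + \<beta> * cnj \<beta>) * (\<alpha> * P + \<beta> * Q)" by (simp add: algebra_simps)
  also have "\<dots> = 2 * (spin N * spinor N \<alpha> \<beta> j)"
    using spinor_homogeneous[OF j, of \<alpha> \<beta>] unfolding norm_spinor_complex[OF n] P_def Q_def by (simp add: mult.assoc)
  finally show ?thesis by (simp only: mult_cancel_left) simp
qed

text \<open>The raising operators along \<open>\<Omega>\<close> annihilate the coherent state; this is their first component.\<close>

lemma spinor_raising:
  assumes n: "(cmod \<alpha>)\<^sup>2 + (cmod \<beta>)\<^sup>2 = 1" and j: "j \<le> N"
  shows "spin_act N 1 (spinor N \<alpha> \<beta>) j = spin N * hopf \<alpha> \<beta> $ 1 * spinor N \<alpha> \<beta> j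
    + \<i> * (hopf \<alpha> \<beta> $ 2 * spin_act N 3 (spinor N \<alpha> \<beta>) j - hopf \<alpha> \<beta> $ 3 * spin_act N 2 (spinor N \<alpha> \<beta>) j)"
proof -
  define P where "P = spinor_d1 N \<alpha> \<beta> j"
  define Q where "Q = spinor_d2 N \<alpha> \<beta> j"
  have i: "\<i> * (\<i> * a * (b / 2) - c * (d / (2 * \<i>))) = - (a * b / 2) - c * d / 2" for a b c d
    by (simp add: field_simps)
  have h: "complex_of_real (spin N) * spinor N \<alpha> \<beta> j = (\<alpha> * P + \<beta> * Q) / 2"
    using spinor_homogeneous[OF j, of \<alpha> \<beta>] by (simp add: P_def Q_def field_simps)
  have "spin N * hopf \<alpha> \<beta> $ 1 * spinor N \<alpha> \<beta> j
    + \<i> * (hopf \<alpha> \<beta> $ 2 * spin_act N 3 (spinor N \<alpha> \<beta>) j - hopf \<alpha> \<beta> $ 3 * spin_act N 2 (spinor N \<alpha> \<beta>) j)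
    = (\<alpha> * cnj \<beta> + cnj \<alpha> * \<beta>) * (complex_of_real (spin N) * spinor N \<alpha> \<beta> j)
     - (\<alpha> * cnj \<beta> - cnj \<alpha> * \<beta>) * (\<alpha> * P - \<beta> * Q) / 2 - (\<alpha> * cnj \<alpha> - \<beta> * cnj \<beta>) * (\<beta> * P - \<alpha> * Q) / 2"
    unfolding of_real_mult hopf_complex spin_act_spinor[OF j] P_def[symmetric] Q_def[symmetric] i by (simp add: algebra_simps)
  also have "\<dots> = (\<alpha> * cnj \<alpha> + \<beta> * cnj \<beta>) * (\<beta> * P + \<alpha> * Q) / 2"
    unfolding h by (simp add: field_simps)
  also have "\<dots> = spin_act N 1 (spinor N \<alpha> \<beta>) j"
    unfolding norm_spinor_complex[OF n] spin_act_spinor[OF j] P_def Q_def by simp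
  finally show ?thesis ..
qed

lemma norm_spinor_vec:
  assumes n: "(cmod \<alpha>)\<^sup>2 + (cmod \<beta>)\<^sup>2 = 1"
  shows "(\<Sum>j<Suc N. spinor N \<alpha> \<beta> j * cnj (spinor N \<alpha> \<beta> j)) = 1"
proof -
  have "(\<Sum>j<Suc N. spinor N \<alpha> \<beta> j * cnj (spinor N \<alpha> \<beta> j))
      = (\<Sum>j\<le>N. of_nat (N choose j) * (\<beta> * cnj \<beta>) ^ j * (\<alpha> * cnj \<alpha>) ^ (N - j))"
    unfolding lessThan_Suc_atMost
  proof (intro sum.cong refl)
    fix j
    have "complex_of_real (sqrt (real (N choose j))) * complex_of_real (sqrt (real (N choose j))) = of_nat (N choose j)"
      by (simp flip: of_real_mult)
    moreover have "spinor N \<alpha> \<beta> j * cnj (spinor N \<alpha> \<beta> j)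
        = (complex_of_real (sqrt (real (N choose j))) * complex_of_real (sqrt (real (N choose j))))
          * (\<beta> * cnj \<beta>) ^ j * (\<alpha> * cnj \<alpha>) ^ (N - j)"
      by (simp add: spinor_def power_mult_distrib mult_ac)
    ultimately show "spinor N \<alpha> \<beta> j * cnj (spinor N \<alpha> \<beta> j)
        = of_nat (N choose j) * (\<beta> * cnj \<beta>) ^ j * (\<alpha> * cnj \<alpha>) ^ (N - j)" by simp
  qed
  also have "\<dots> = (\<beta> * cnj \<beta> + \<alpha> * cnj \<alpha>) ^ N" by (simp add: binomial_ring)
  finally show ?thesis by (simp add: norm_spinor_complex[OF n])
qed

lemma is_coherent_iff:
  assumes v: "v \<in> carrier_vec (N + 1)"
  shows "is_coherent N \<Omega> v \<longleftrightarrow> (\<Sum>j<Suc N. vec_index v j * cnj (vec_index v j)) = 1 \<and>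
    (\<forall>i\<le>N. \<Omega> $ 1 * spin_act N 1 (vec_index v) i + \<Omega> $ 2 * spin_act N 2 (vec_index v) i
      + \<Omega> $ 3 * spin_act N 3 (vec_index v) i = spin N * vec_index v i)"
proof -
  have norm: "v \<bullet>c v = (\<Sum>j<Suc N. vec_index v j * cnj (vec_index v j))"
    using v by (simp add: Matrix.scalar_prod_def atLeast0LessThan)
  define M where "M = complex_of_real (\<Omega> $ 1) \<cdot>\<^sub>m spin_op N 1 + complex_of_real (\<Omega> $ 2) \<cdot>\<^sub>m spin_op N 2
        + complex_of_real (\<Omega> $ 3) \<cdot>\<^sub>m spin_op N 3"
  have c: "spin_op N \<mu> \<in> carrier_mat (Suc N) (Suc N)" for \<mu> by simp
  have M: "M \<in> carrier_mat (Suc N) (Suc N)" unfolding M_def using c by auto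
  have Mi: "M $$ (i, k) = \<Omega> $ 1 * spin_op N 1 $$ (i, k) + \<Omega> $ 2 * spin_op N 2 $$ (i, k) + \<Omega> $ 3 * spin_op N 3 $$ (i, k)"
    if "i \<le> N" "k \<le> N" for i k
    using that c[of 1, THEN carrier_matD(1)] c[of 1, THEN carrier_matD(2)] c[of 2, THEN carrier_matD(1)]
      c[of 2, THEN carrier_matD(2)] c[of 3, THEN carrier_matD(1)] c[of 3, THEN carrier_matD(2)]
    unfolding M_def by simp
  have "vec_index (M *\<^sub>v v) i = \<Omega> $ 1 * spin_act N 1 (vec_index v) i + \<Omega> $ 2 * spin_act N 2 (vec_index v) i
      + \<Omega> $ 3 * spin_act N 3 (vec_index v) i" if i: "i \<le> N" for i
  proof -
    have "vec_index (M *\<^sub>v v) i = (\<Sum>k<Suc N. M $$ (i, k) * vec_index v k)"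
      using M v i by (simp add: Matrix.scalar_prod_def atLeast0LessThan)
    also have "\<dots> = (\<Sum>k<Suc N. \<Omega> $ 1 * (spin_op N 1 $$ (i, k) * vec_index v k)
        + \<Omega> $ 2 * (spin_op N 2 $$ (i, k) * vec_index v k) + \<Omega> $ 3 * (spin_op N 3 $$ (i, k) * vec_index v k))"
      by (intro sum.cong refl) (use i in \<open>simp add: Mi algebra_simps\<close>)
    finally show ?thesis
      unfolding sum.distrib sum_distrib_left[symmetric] sum_spin_op[OF i] .
  qed
  then have "M *\<^sub>v v = complex_of_real (spin N) \<cdot>\<^sub>v v \<longleftrightarrow>
    (\<forall>i\<le>N. \<Omega> $ 1 * spin_act N 1 (vec_index v) i + \<Omega> $ 2 * spin_act N 2 (vec_index v) i
      + \<Omega> $ 3 * spin_act N 3 (vec_index v) i = spin N * vec_index v i)"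
    using M v by (auto simp: Matrix.vec_eq_iff less_Suc_eq_le)
  then show ?thesis
    using v norm unfolding is_coherent_def M_def by simp
qed

text \<open>A solution of the three-term recursion given by the eigenvalue equation is determined by its
  first entry, or by its only nonzero entry if \<open>\<Omega>\<close> is a pole.\<close>

lemma eigen_unique:
  fixes f :: "nat \<Rightarrow> complex"
  assumes n: "(cmod \<alpha>)\<^sup>2 + (cmod \<beta>)\<^sup>2 = 1"
    and f: "\<And>i. i \<le> N \<Longrightarrow> hopf \<alpha> \<beta> $ 1 * spin_act N 1 f i + hopf \<alpha> \<beta> $ 2 * spin_act N 2 f i
      + hopf \<alpha> \<beta> $ 3 * spin_act N 3 f i = spin N * f i"
  shows "\<exists>c. \<forall>i\<le>N. f i = c * spinor N \<alpha> \<beta> i"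
proof -
  let ?\<psi> = "spinor N \<alpha> \<beta>"
  have rec: "\<alpha> * cnj \<beta> * (ladder N (Suc i) * g (Suc i)) + cnj \<alpha> * \<beta> * (ladder N i * g (i - 1))
      + (\<alpha> * cnj \<alpha> - \<beta> * cnj \<beta>) * ((spin N - real i) * g i) = spin N * g i"
    if "hopf \<alpha> \<beta> $ 1 * spin_act N 1 g i + hopf \<alpha> \<beta> $ 2 * spin_act N 2 g i
      + hopf \<alpha> \<beta> $ 3 * spin_act N 3 g i = spin N * g i" for g :: "nat \<Rightarrow> complex" and i
  proof -
    have "hopf \<alpha> \<beta> $ 1 * spin_act N 1 g i + hopf \<alpha> \<beta> $ 2 * spin_act N 2 g i
        = \<alpha> * cnj \<beta> * (ladder N (Suc i) * g (Suc i)) + cnj \<alpha> * \<beta> * (ladder N i * g (i - 1))"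
      unfolding hopf_complex spin_act_def by (simp add: field_simps)
    then show ?thesis
      using that unfolding hopf_complex(3) by (simp add: spin_act_def)
  qed
  note rf = rec[OF f] and r\<psi> = rec[OF spinor_eigen[OF n]]
  show ?thesis
  proof (cases "\<alpha> = 0 \<or> \<beta> = 0")
    case False
    then have nz: "\<alpha> * cnj \<beta> \<noteq> 0" "?\<psi> 0 \<noteq> 0" by (auto simp: spinor_def)
    \<comment> \<open>Proportionality in cross-multiplied form. Both sequences satisfy the same
      recursion, and its leading coefficient, \<alpha> times \<open>cnj \<beta>\<close> times
      \<open>ladder N (Suc k)\<close>, is nonzero as long as \<open>k < N\<close>.\<close>
    have "i \<le> N \<Longrightarrow> f i * ?\<psi> 0 = ?\<psi> i * f 0" for i
    proof (induction i rule: less_induct)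
      case (less i)
      show ?case
      proof (cases i)
        case (Suc k)
        then have k: "k \<le> N" "k < i" using less.prems by auto
        have IH: "f k * ?\<psi> 0 = ?\<psi> k * f 0" "f (k - 1) * ?\<psi> 0 = ?\<psi> (k - 1) * f 0"
          using less.IH[of k] less.IH[of "k - 1"] k less.prems Suc by auto
        have lad: "ladder N (Suc k) \<noteq> 0" using less.prems Suc by (simp add: ladder_def)
        have step: "\<alpha> * cnj \<beta> * (ladder N (Suc k) * (g (Suc k) * w))
          = spin N * (g k * w) - cnj \<alpha> * \<beta> * (ladder N k * (g (k - 1) * w))
              - (\<alpha> * cnj \<alpha> - \<beta> * cnj \<beta>) * ((spin N - real k) * (g k * w))"
          if "\<alpha> * cnj \<beta> * (ladder N (Suc k) * g (Suc k)) + cnj \<alpha> * \<beta> * (ladder N k * g (k - 1))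
            + (\<alpha> * cnj \<alpha> - \<beta> * cnj \<beta>) * ((spin N - real k) * g k) = spin N * g k" for g :: "nat \<Rightarrow> complex" and w :: complex
        proof -
          have "\<alpha> * cnj \<beta> * (ladder N (Suc k) * (g (Suc k) * w))
            = (\<alpha> * cnj \<beta> * (ladder N (Suc k) * g (Suc k))) * w" by (simp add: mult_ac)
          also have "\<alpha> * cnj \<beta> * (ladder N (Suc k) * g (Suc k)) = spin N * g k
              - cnj \<alpha> * \<beta> * (ladder N k * g (k - 1)) - (\<alpha> * cnj \<alpha> - \<beta> * cnj \<beta>) * ((spin N - real k) * g k)"
            using that by (simp add: algebra_simps)
          finally show ?thesis by (simp add: left_diff_distrib mult.assoc)
        qed
        have "\<alpha> * cnj \<beta> * (ladder N (Suc k) * (f (Suc k) * ?\<psi> 0))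
            = \<alpha> * cnj \<beta> * (ladder N (Suc k) * (?\<psi> (Suc k) * f 0))"
          unfolding step[OF rf[OF k(1)]] step[OF r\<psi>[OF k(1)]] IH ..
        then show ?thesis using nz lad Suc by (auto simp only: mult_cancel_left of_real_eq_0_iff)
      qed simp
    qed
    then show ?thesis
      using nz(2) by (intro exI[of _ "f 0 / ?\<psi> 0"]) (simp add: field_simps)
  next
    case True
    \<comment> \<open>At a pole the recursion decouples, and the eigenvalue S leaves a single
      nonzero entry: the first at the north pole, the last at the south pole.\<close>
    define k where "k = (if \<beta> = 0 then 0 else N)"
    have z: "f i = 0 \<and> ?\<psi> i = 0" if i: "i \<le> N" "i \<noteq> k" for i
    proof (cases "\<beta> = 0")
      case b: True
      then have "\<alpha> * cnj \<alpha> = 1" using norm_spinor_complex[OF n] by simp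
      then have "(spin N - real i) * f i = spin N * f i" using rf[OF i(1)] b by simp
      then have "complex_of_real (real i) * f i = 0" by (simp add: algebra_simps)
      then show ?thesis using i b by (simp add: k_def spinor_def)
    next
      case False
      then have a: "\<alpha> = 0" using \<open>\<alpha> = 0 \<or> \<beta> = 0\<close> by simp
      then have "\<beta> * cnj \<beta> = 1" using norm_spinor_complex[OF n] by simp
      then have "- ((spin N - real i) * f i) = spin N * f i" using rf[OF i(1)] a by simp
      then have "(2 * spin N - real i) * f i = 0" by (auto simp: algebra_simps)
      then have "complex_of_real (real N - real i) * f i = 0" by (simp add: spin_def)
      then show ?thesis using i a False by (simp add: k_def spinor_def)
    qed
    have "?\<psi> k \<noteq> 0"
      using n True by (auto simp: k_def spinor_def split: if_splits)
    then show ?thesis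
      using z by (intro exI[of _ "f k / ?\<psi> k"]) (metis nonzero_eq_divide_eq mult_zero_right)
  qed
qed

text \<open>Whatever vector \<open>SOME\<close> picks is a multiple \<open>c\<close> of the spinor
  by uniqueness, with \<open>c * cnj c = 1\<close> by normalization, so \<open>c\<close> cancels in
  the projector.\<close>

lemma coherent_proj_hopf:
  assumes n: "(cmod \<alpha>)\<^sup>2 + (cmod \<beta>)\<^sup>2 = 1" and ij: "i \<le> N" "j \<le> N"
  shows "coherent_proj N (hopf \<alpha> \<beta>) $$ (i, j) = spinor N \<alpha> \<beta> i * cnj (spinor N \<alpha> \<beta> j)"
proof -
  let ?v = "Matrix.vec (Suc N) (spinor N \<alpha> \<beta>)"
  have act: "spin_act N \<mu> (vec_index ?v) i = spin_act N \<mu> (spinor N \<alpha> \<beta>) i" if "i \<le> N" for \<mu> i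
    using that sum_spin_op[OF that, of \<mu> "vec_index ?v"] sum_spin_op[OF that, of \<mu> "spinor N \<alpha> \<beta>"]
    by simp
  have "is_coherent N (hopf \<alpha> \<beta>) ?v"
    using norm_spinor_vec[OF n, of N] spinor_eigen[OF n]
    by (subst is_coherent_iff) (simp_all add: act)
  then have coh: "is_coherent N (hopf \<alpha> \<beta>) (coherent N (hopf \<alpha> \<beta>))"
    unfolding coherent_def by (rule someI)
  then have car: "coherent N (hopf \<alpha> \<beta>) \<in> carrier_vec (N + 1)" by (simp add: is_coherent_def)
  define f where "f = vec_index (coherent N (hopf \<alpha> \<beta>))"
  obtain c where c: "\<And>i. i \<le> N \<Longrightarrow> f i = c * spinor N \<alpha> \<beta> i"
    using eigen_unique[OF n, of N f] coh unfolding is_coherent_iff[OF car] f_def by blast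
  have "1 = (\<Sum>j<Suc N. f j * cnj (f j))"
    using coh unfolding is_coherent_iff[OF car] f_def by simp
  also have "\<dots> = (\<Sum>j<Suc N. (c * cnj c) * (spinor N \<alpha> \<beta> j * cnj (spinor N \<alpha> \<beta> j)))"
    by (intro sum.cong refl) (simp add: c)
  also have "\<dots> = c * cnj c"
    unfolding sum_distrib_left[symmetric] norm_spinor_vec[OF n] by simp
  finally have "c * cnj c = 1" by simp
  then have "f i * cnj (f j) = spinor N \<alpha> \<beta> i * cnj (spinor N \<alpha> \<beta> j)"
    using c[OF ij(1)] c[OF ij(2)] by (simp add: mult_ac)
  then show ?thesis using ij by (simp add: coherent_proj_def f_def)
qed

text \<open>A polynomial in \<open>x\<close> that gives the projector on the sphere: there (1 + x_3)
  / 2 and (1 - x_3) / 2 are the squared moduli of \<alpha> and \<beta>, and (x_1 - \<i> x_2) / 2 is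
  \<alpha> times the conjugate of \<beta>. Unlike \<open>coherent_proj\<close> it involves no choice
  and is visibly smooth on all of space.\<close>

definition coh :: "nat \<Rightarrow> nat \<Rightarrow> nat \<Rightarrow> real^3 \<Rightarrow> complex" where
  "coh N i j x = complex_of_real (sqrt (real (N choose i)) * sqrt (real (N choose j))) *
    (if i \<le> j
     then complex_of_real (((1 + x $ 3) / 2) ^ (N - j) * ((1 - x $ 3) / 2) ^ i) * Complex (x $ 1 / 2) (- x $ 2 / 2) ^ (j - i)
     else complex_of_real (((1 + x $ 3) / 2) ^ (N - i) * ((1 - x $ 3) / 2) ^ j) * Complex (x $ 1 / 2) (x $ 2 / 2) ^ (i - j))"

lemma csmooth_coh: "csmooth (coh N i j)"
proof -
  have h: "smooth (\<lambda>x. f x / 2)" if "smooth f" for f :: "real^3 \<Rightarrow> real"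
    using smooth_mult[OF that smooth_const[of "1 / 2"]] by simp
  have p: "csmooth (\<lambda>x. complex_of_real (((1 + x $ 3) / 2) ^ a * ((1 - x $ 3) / 2) ^ b))" for a b
    by (intro csmooth_of_real smooth_mult smooth_power h smooth_add smooth_diff smooth_const smooth_coord)
  have r: "csmooth (\<lambda>x. Complex (x $ 1 / 2) (- x $ 2 / 2) ^ a)" "csmooth (\<lambda>x. Complex (x $ 1 / 2) (x $ 2 / 2) ^ a)" for a
    by (intro csmooth_power csmooth_Complex h smooth_uminus smooth_coord)+
  show ?thesis
  proof (cases "i \<le> j")
    case True
    show ?thesis
      unfolding coh_def[abs_def] if_P[OF True] by (rule csmooth_mult[OF csmooth_const csmooth_mult[OF p r(1)]])
  next
    case False
    show ?thesis
      unfolding coh_def[abs_def] if_not_P[OF False] by (rule csmooth_mult[OF csmooth_const csmooth_mult[OF p r(2)]])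
  qed
qed

lemma coh_hopf:
  assumes n: "(cmod \<alpha>)\<^sup>2 + (cmod \<beta>)\<^sup>2 = 1" and ij: "i \<le> N" "j \<le> N"
  shows "coh N i j (hopf \<alpha> \<beta>) = spinor N \<alpha> \<beta> i * cnj (spinor N \<alpha> \<beta> j)"
proof -
  have p: "complex_of_real ((1 + hopf \<alpha> \<beta> $ 3) / 2) = \<alpha> * cnj \<alpha>" "complex_of_real ((1 - hopf \<alpha> \<beta> $ 3) / 2) = \<beta> * cnj \<beta>"
    unfolding of_real_divide of_real_add of_real_diff hopf_complex by (simp_all add: norm_spinor_complex[OF n])
  have r: "Complex (hopf \<alpha> \<beta> $ 1 / 2) (- hopf \<alpha> \<beta> $ 2 / 2) = \<alpha> * cnj \<beta>"
    "Complex (hopf \<alpha> \<beta> $ 1 / 2) (hopf \<alpha> \<beta> $ 2 / 2) = cnj \<alpha> * \<beta>"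
    by (simp_all add: hopf_components complex_eq_iff)
  show ?thesis
  proof (cases "i \<le> j")
    case True
    then obtain d where j: "j = i + d" using le_Suc_ex by blast
    obtain e where N: "N = i + d + e" using ij(2) j le_Suc_ex by blast
    show ?thesis
      unfolding coh_def of_real_mult of_real_power p r using True
      by (simp add: spinor_def j N power_add power_mult_distrib mult_ac)
  next
    case False
    then obtain d where i: "i = j + d" using le_Suc_ex nat_le_linear by blast
    obtain e where N: "N = j + d + e" using ij(1) i le_Suc_ex by blast
    show ?thesis
      unfolding coh_def of_real_mult of_real_power p r using False
      by (simp add: spinor_def i N power_add power_mult_distrib mult_ac)
  qed
qed

lemma coherent_proj_eq_coh:
  assumes "x \<in> sphere 0 1" "i \<le> N" "j \<le> N"
  shows "coherent_proj N x $$ (i, j) = coh N i j x"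
  using hopf_surj[OF assms(1)] coherent_proj_hopf coh_hopf assms(2,3) by metis

lemma su_derivative:
  "((\<lambda>s. su_fst \<mu> s \<alpha> \<beta>) has_field_derivative (if \<mu> = 1 then - \<i> * \<beta> else if \<mu> = 2 then - \<beta> else - \<i> * \<alpha>) / 2) (at 0)"
  "((\<lambda>s. su_snd \<mu> s \<alpha> \<beta>) has_field_derivative (if \<mu> = 1 then - \<i> * \<alpha> else if \<mu> = 2 then \<alpha> else \<i> * \<beta>) / 2) (at 0)"
  unfolding su_fst_def su_snd_def by (auto intro!: derivative_eq_intros)

lemma spinor_su_derivative:
  assumes "j \<le> N"
  shows "((\<lambda>s. spinor N (su_fst \<mu> (of_real s) \<alpha> \<beta>) (su_snd \<mu> (of_real s) \<alpha> \<beta>) j)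
    has_vector_derivative - \<i> * spin_act N \<mu> (spinor N \<alpha> \<beta>) j) (at 0)"
proof -
  have su0: "su_fst \<mu> 0 \<alpha> \<beta> = \<alpha>" "su_snd \<mu> 0 \<alpha> \<beta> = \<beta>" by (simp_all add: su_fst_def su_snd_def)
  have "spinor_d1 N \<alpha> \<beta> j * ((if \<mu> = 1 then - \<i> * \<beta> else if \<mu> = 2 then - \<beta> else - \<i> * \<alpha>) / 2)
      + spinor_d2 N \<alpha> \<beta> j * ((if \<mu> = 1 then - \<i> * \<alpha> else if \<mu> = 2 then \<alpha> else \<i> * \<beta>) / 2)
      = - \<i> * spin_act N \<mu> (spinor N \<alpha> \<beta>) j"
    by (rule rot_cases[of _ \<mu>]) (simp_all add: spin_act_spinor[OF assms] field_simps)
  then have "((\<lambda>z. spinor N (su_fst \<mu> z \<alpha> \<beta>) (su_snd \<mu> z \<alpha> \<beta>) j) has_field_derivative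
      - \<i> * spin_act N \<mu> (spinor N \<alpha> \<beta>) j) (at (of_real 0))"
    using DERIV_spinor[OF su_derivative[of \<mu> \<alpha> \<beta>], of N j] by (simp add: su0)
  then show ?thesis by (rule has_vector_derivative_real_field)
qed

text \<open>Rotating the point rotates the pair (\<alpha>, \<beta>), under which the spinor has the
  derivative -\<i> S_\<mu>; the projector then has -\<i> times its commutator as derivative. The
  minus sign of \<open>rot_along_axis_rotate\<close> turns this into +\<i>.\<close>

lemma crot_coh:
  assumes x: "x \<in> sphere 0 1" and ij: "i \<le> N" "j \<le> N"
  shows "crot \<mu> (coh N i j) x = \<i> * (\<Sum>k<Suc N. spin_op N \<mu> $$ (i, k) * coh N k j x - coh N i k x * spin_op N \<mu> $$ (k, j))"
proof -
  obtain \<alpha> \<beta> where n: "(cmod \<alpha>)\<^sup>2 + (cmod \<beta>)\<^sup>2 = 1" and xh: "hopf \<alpha> \<beta> = x" using hopf_surj[OF x] .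
  let ?\<psi> = "spinor N \<alpha> \<beta>"
  let ?a = "\<lambda>s. su_fst \<mu> (complex_of_real s) \<alpha> \<beta>" and ?b = "\<lambda>s. su_snd \<mu> (complex_of_real s) \<alpha> \<beta>"
  have "coh N i j (axis_rotate \<mu> s x) = spinor N (?a s) (?b s) i * cnj (spinor N (?a s) (?b s) j)" for s
    unfolding xh[symmetric] su_norm_hopf(2)[symmetric]
    by (rule coh_hopf) (use n ij su_norm_hopf(1)[of \<mu> s \<alpha> \<beta>] in simp_all)
  moreover have "((\<lambda>s. spinor N (?a s) (?b s) i * cnj (spinor N (?a s) (?b s) j)) has_vector_derivative
      ?\<psi> i * cnj (- \<i> * spin_act N \<mu> ?\<psi> j) + (- \<i> * spin_act N \<mu> ?\<psi> i) * cnj (?\<psi> j)) (at 0)"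
    using has_vector_derivative_mult[OF spinor_su_derivative[OF ij(1), of \<mu> \<alpha> \<beta>]
        bounded_linear.has_vector_derivative[OF bounded_linear_cnj spinor_su_derivative[OF ij(2), of \<mu> \<alpha> \<beta>]]]
    by (simp add: su_fst_def su_snd_def)
  ultimately have "crot \<mu> (coh N i j) x
      = - (?\<psi> i * cnj (- \<i> * spin_act N \<mu> ?\<psi> j) + (- \<i> * spin_act N \<mu> ?\<psi> i) * cnj (?\<psi> j))"
    by (intro crot_along_axis_rotate[OF csmooth_coh]) simp
  also have "\<dots> = \<i> * (spin_act N \<mu> ?\<psi> i * cnj (?\<psi> j) - ?\<psi> i * cnj (spin_act N \<mu> ?\<psi> j))"
    by (simp add: algebra_simps)
  also have "spin_act N \<mu> ?\<psi> i * cnj (?\<psi> j) = (\<Sum>k<Suc N. spin_op N \<mu> $$ (i, k) * coh N k j x)"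
    unfolding sum_spin_op[OF ij(1), symmetric] sum_distrib_right xh[symmetric]
    by (intro sum.cong refl) (simp add: coh_hopf[OF n _ ij(2)])
  also have "?\<psi> i * cnj (spin_act N \<mu> ?\<psi> j) = (\<Sum>k<Suc N. coh N i k x * spin_op N \<mu> $$ (k, j))"
    unfolding sum_spin_op[OF ij(2), symmetric] cnj_sum sum_distrib_left xh[symmetric]
    by (intro sum.cong refl) (use ij in \<open>simp add: coh_hopf[OF n ij(1)] spin_op_hermitian\<close>)
  finally show ?thesis by (simp only: sum_subtractf)
qed

text \<open>\<open>spinor_raising\<close> is applied to the ket and, conjugated, to the bra. The
  parts with S add up to 2 S x_1, while the opposite signs of \<i> combine the rest into commutators
  with S_z and S_y, that is, into rotation fields.\<close>

lemma anticommutator_coh: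
  assumes x: "x \<in> sphere 0 1" and ij: "i \<le> N" "j \<le> N"
  shows "(\<Sum>k<Suc N. spin_op N 1 $$ (i, k) * coh N k j x + coh N i k x * spin_op N 1 $$ (k, j))
    = 2 * spin N * (x $ 1 * coh N i j x) + x $ 2 * crot 3 (coh N i j) x - x $ 3 * crot 2 (coh N i j) x"
proof -
  obtain \<alpha> \<beta> where n: "(cmod \<alpha>)\<^sup>2 + (cmod \<beta>)\<^sup>2 = 1" and xh: "hopf \<alpha> \<beta> = x" using hopf_surj[OF x] .
  let ?\<psi> = "spinor N \<alpha> \<beta>"
  have l: "(\<Sum>k<Suc N. spin_op N \<mu> $$ (i, k) * coh N k j x) = spin_act N \<mu> ?\<psi> i * cnj (?\<psi> j)" for \<mu>
    unfolding sum_spin_op[OF ij(1), symmetric] sum_distrib_right xh[symmetric]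
    by (intro sum.cong refl) (simp add: coh_hopf[OF n _ ij(2)])
  have r: "(\<Sum>k<Suc N. coh N i k x * spin_op N \<mu> $$ (k, j)) = ?\<psi> i * cnj (spin_act N \<mu> ?\<psi> j)" for \<mu>
    unfolding sum_spin_op[OF ij(2), symmetric] cnj_sum sum_distrib_left xh[symmetric]
    by (intro sum.cong refl) (use ij in \<open>simp add: coh_hopf[OF n ij(1)] spin_op_hermitian\<close>)
  note rs = spinor_raising[OF n ij(1), unfolded xh] spinor_raising[OF n ij(2), unfolded xh]
  show ?thesis
    unfolding crot_coh[OF x ij] sum.distrib sum_subtractf l r rs
    by (simp add: coh_hopf[OF n ij, unfolded xh] algebra_simps)
qed

section \<open>The Lindblad generator on coherent projectors\<close>

text \<open>Matrices are handled through their entry functions, so that derivatives and integrals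
  act entrywise and carrier conditions stay in one place.\<close>

definition square :: "nat \<Rightarrow> (nat \<Rightarrow> nat \<Rightarrow> complex) \<Rightarrow> complex mat" where
  "square N F = Matrix.mat (Suc N) (Suc N) (\<lambda>(i, j). F i j)"

definition spin_com :: "nat \<Rightarrow> 3 \<Rightarrow> (nat \<Rightarrow> nat \<Rightarrow> complex) \<Rightarrow> nat \<Rightarrow> nat \<Rightarrow> complex" where
  "spin_com N \<mu> F i j = (\<Sum>k<Suc N. spin_op N \<mu> $$ (i, k) * F k j - F i k * spin_op N \<mu> $$ (k, j))"

definition spin_anti :: "nat \<Rightarrow> 3 \<Rightarrow> (nat \<Rightarrow> nat \<Rightarrow> complex) \<Rightarrow> nat \<Rightarrow> nat \<Rightarrow> complex" where
  "spin_anti N \<mu> F i j = (\<Sum>k<Suc N. spin_op N \<mu> $$ (i, k) * F k j + F i k * spin_op N \<mu> $$ (k, j))"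

lemma square_carrier [simp]: "square N F \<in> carrier_mat (Suc N) (Suc N)"
  by (simp add: square_def)

lemma square_index [simp]: "i \<le> N \<Longrightarrow> j \<le> N \<Longrightarrow> square N F $$ (i, j) = F i j"
  by (simp add: square_def)

lemma square_of_mat: "A \<in> carrier_mat (Suc N) (Suc N) \<Longrightarrow> square N (\<lambda>i j. A $$ (i, j)) = A"
  by (rule eq_matI) (auto simp: square_def)

lemma spin_op_dim [simp]: "dim_row (spin_op N \<mu>) = Suc N" "dim_col (spin_op N \<mu>) = Suc N"
  by (rule carrier_matD[OF spin_op_carrier])+

lemma times_mat_index:
  assumes "A \<in> carrier_mat (Suc N) (Suc N)" "B \<in> carrier_mat (Suc N) (Suc N)" "i \<le> N" "j \<le> N"
  shows "(A * B) $$ (i, j) = (\<Sum>k<Suc N. A $$ (i, k) * B $$ (k, j))"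
  using assms by (simp add: Matrix.scalar_prod_def atLeast0LessThan del: sum.lessThan_Suc)

lemma commutator_carrier:
  "A \<in> carrier_mat n n \<Longrightarrow> B \<in> carrier_mat n n \<Longrightarrow> commutator A B \<in> carrier_mat n n"
  by (simp add: commutator_def minus_carrier_mat)

lemma commutator_square: "commutator (spin_op N \<mu>) (square N F) = square N (spin_com N \<mu> F)"
proof (rule eq_matI)
  fix i j assume "i < dim_row (square N (spin_com N \<mu> F))" "j < dim_col (square N (spin_com N \<mu> F))"
  then have ij: "i \<le> N" "j \<le> N" by (simp_all add: square_def)
  have "commutator (spin_op N \<mu>) (square N F) $$ (i, j)
      = (spin_op N \<mu> * square N F) $$ (i, j) - (square N F * spin_op N \<mu>) $$ (i, j)"
    unfolding commutator_def
    by (rule index_minus_mat) (use ij spin_op_carrier[of N \<mu>] in \<open>auto simp: square_def\<close>)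
  then show "commutator (spin_op N \<mu>) (square N F) $$ (i, j) = square N (spin_com N \<mu> F) $$ (i, j)"
    using ij by (simp add: times_mat_index[where N = N] less_Suc_eq_le spin_com_def sum_subtractf del: sum.lessThan_Suc)
qed (use commutator_carrier[OF spin_op_carrier square_carrier, of N \<mu> F] in \<open>auto simp: square_def\<close>)

lemma anticommutator_square:
  "spin_op N \<mu> * square N F + square N F * spin_op N \<mu> = square N (spin_anti N \<mu> F)"
proof (rule eq_matI)
  fix i j assume "i < dim_row (square N (spin_anti N \<mu> F))" "j < dim_col (square N (spin_anti N \<mu> F))"
  then have ij: "i \<le> N" "j \<le> N" by (simp_all add: square_def)
  have "(spin_op N \<mu> * square N F + square N F * spin_op N \<mu>) $$ (i, j)
      = (spin_op N \<mu> * square N F) $$ (i, j) + (square N F * spin_op N \<mu>) $$ (i, j)"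
    by (rule index_add_mat) (use ij spin_op_carrier[of N \<mu>] in \<open>auto simp: square_def\<close>)
  then show "(spin_op N \<mu> * square N F + square N F * spin_op N \<mu>) $$ (i, j) = square N (spin_anti N \<mu> F) $$ (i, j)"
    using ij by (simp add: times_mat_index[where N = N] less_Suc_eq_le spin_anti_def sum.distrib del: sum.lessThan_Suc)
qed (use spin_op_carrier[of N \<mu>] in \<open>auto simp: square_def\<close>)

text \<open>[A^2, B] is AAB - BAA; in [A, {A, B}] and in {A, [A, B]} the terms ABA cancel. Both
  factorizations are used, one for each order of commutator and anticommutator.\<close>

lemma commutator_power2:
  assumes A: "A \<in> carrier_mat n n" and B: "B \<in> carrier_mat n n"
  shows "commutator (A * A) B = commutator A (A * B + B * A)"
    "A * commutator A B + commutator A B * A = commutator A (A * B + B * A)"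
proof -
  note c = A B mult_carrier_mat[OF A A] mult_carrier_mat[OF A B] mult_carrier_mat[OF B A]
    mult_carrier_mat[OF A mult_carrier_mat[OF A B]] mult_carrier_mat[OF A mult_carrier_mat[OF B A]]
    mult_carrier_mat[OF mult_carrier_mat[OF B A] A] mult_carrier_mat[OF mult_carrier_mat[OF A B] A]
  have 1: "A * A * B = A * (A * B)" "B * (A * A) = B * A * A" "A * B * A = A * (B * A)"
    by (rule assoc_mult_mat[OF A A B] assoc_mult_mat[OF B A A, symmetric] assoc_mult_mat[OF A B A])+
  have 2: "commutator A (A * B + B * A) = (A * (A * B) + A * (B * A)) - (A * B * A + B * A * A)"
    unfolding commutator_def
    by (simp add: mult_add_distrib_mat[OF A c(4,5)] add_mult_distrib_mat[OF c(4,5) A])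
  have 3: "A * commutator A B + commutator A B * A = (A * (A * B) - A * (B * A)) + (A * B * A - B * A * A)"
    unfolding commutator_def
    by (simp add: mult_minus_distrib_mat[OF A c(4,5)] minus_mult_distrib_mat[OF c(4,5) A])
  have XYZ: "(X + Y) - (Y + Z) = X - Z" "(X - Y) + (Y - Z) = X - Z"
    if "X \<in> carrier_mat n n" "Y \<in> carrier_mat n n" "Z \<in> carrier_mat n n" for X Y Z :: "complex mat"
    by (rule eq_matI; use that in auto)+
  show "commutator (A * A) B = commutator A (A * B + B * A)"
    unfolding 2 1(3) XYZ(1)[OF c(6-8)] by (simp only: commutator_def 1(1,2))
  show "A * commutator A B + commutator A B * A = commutator A (A * B + B * A)"
    unfolding 2 3 1(3) XYZ[OF c(6-8)] ..
qed

lemma spin_anti_com: "i \<le> N \<Longrightarrow> j \<le> N \<Longrightarrow>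
    spin_anti N \<mu> (spin_com N \<mu> F) i j = spin_com N \<mu> (spin_anti N \<mu> F) i j"
  using arg_cong[of _ _ "\<lambda>M. M $$ (i, j)", OF commutator_power2(2)[OF spin_op_carrier square_carrier, of N \<mu> F]]
  unfolding commutator_square anticommutator_square by simp

lemma commutator_smult:
  assumes "A \<in> carrier_mat n n" "B \<in> carrier_mat n n"
  shows "commutator (k \<cdot>\<^sub>m A) B = k \<cdot>\<^sub>m commutator A B"
  unfolding commutator_def
  by (rule eq_matI) (use assms in \<open>auto simp: right_diff_distrib\<close>)

lemma lindblad_rhs_square:
  assumes "i \<le> N" "j \<le> N"
  shows "lindblad_rhs N \<kappa> \<gamma> (square N F) $$ (i, j) =
    - \<i> * (complex_of_real (\<kappa> / (2 * spin N + 1)) * spin_com N 1 (spin_anti N 1 F) i j)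
    - complex_of_real (\<gamma> / 2) * (spin_com N 1 (spin_com N 1 F) i j + spin_com N 2 (spin_com N 2 F) i j
        + spin_com N 3 (spin_com N 3 F) i j)"
proof -
  have A: "spin_op N \<mu> \<in> carrier_mat (Suc N) (Suc N)" for \<mu> by simp
  have "lindblad_rhs N \<kappa> \<gamma> (square N F) =
    - \<i> \<cdot>\<^sub>m (complex_of_real (\<kappa> / (2 * spin N + 1)) \<cdot>\<^sub>m square N (spin_com N 1 (spin_anti N 1 F)))
    - complex_of_real (\<gamma> / 2) \<cdot>\<^sub>m (square N (spin_com N 1 (spin_com N 1 F)) + square N (spin_com N 2 (spin_com N 2 F))
        + square N (spin_com N 3 (spin_com N 3 F)))"
    unfolding lindblad_rhs_def commutator_smult[OF mult_carrier_mat[OF A A] square_carrier]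
      commutator_power2(1)[OF A square_carrier] anticommutator_square commutator_square ..
  then show ?thesis using assms by (simp add: square_def)
qed

lemma spin_com_cong:
  "(\<And>k l. k \<le> N \<Longrightarrow> l \<le> N \<Longrightarrow> F k l = G k l) \<Longrightarrow> i \<le> N \<Longrightarrow> j \<le> N \<Longrightarrow> spin_com N \<mu> F i j = spin_com N \<mu> G i j"
  unfolding spin_com_def by (intro sum.cong refl) simp

lemma spin_anti_cong:
  "(\<And>k l. k \<le> N \<Longrightarrow> l \<le> N \<Longrightarrow> F k l = G k l) \<Longrightarrow> i \<le> N \<Longrightarrow> j \<le> N \<Longrightarrow> spin_anti N \<mu> F i j = spin_anti N \<mu> G i j"
  unfolding spin_anti_def by (intro sum.cong refl) simp

lemma spin_com_cmult: "spin_com N \<mu> (\<lambda>k l. c * F k l) i j = c * spin_com N \<mu> F i j"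
  unfolding spin_com_def sum_distrib_left by (intro sum.cong refl) (simp add: algebra_simps)

lemma spin_anti_cmult: "spin_anti N \<mu> (\<lambda>k l. c * F k l) i j = c * spin_anti N \<mu> F i j"
  unfolding spin_anti_def sum_distrib_left by (intro sum.cong refl) (simp add: algebra_simps)

lemma spin_com_add: "spin_com N \<mu> (\<lambda>k l. F k l + G k l) i j = spin_com N \<mu> F i j + spin_com N \<mu> G i j"
  unfolding spin_com_def sum.distrib[symmetric] by (intro sum.cong refl) (simp add: algebra_simps)

lemma spin_com_diff: "spin_com N \<mu> (\<lambda>k l. F k l - G k l) i j = spin_com N \<mu> F i j - spin_com N \<mu> G i j"
  unfolding spin_com_def sum_subtractf[symmetric] by (intro sum.cong refl) (simp add: algebra_simps)

lemma csmooth_spin_com: "(\<And>k l. csmooth (q k l)) \<Longrightarrow> csmooth (\<lambda>x. spin_com N \<mu> (\<lambda>k l. q k l x) i j)"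
  unfolding spin_com_def by (intro csmooth_sum csmooth_diff csmooth_mult csmooth_const)

lemma csmooth_spin_anti: "(\<And>k l. csmooth (q k l)) \<Longrightarrow> csmooth (\<lambda>x. spin_anti N \<mu> (\<lambda>k l. q k l x) i j)"
  unfolding spin_anti_def by (intro csmooth_sum csmooth_add csmooth_mult csmooth_const)

lemma crot_spin_com:
  assumes q: "\<And>k l. csmooth (q k l)"
  shows "crot \<nu> (\<lambda>x. spin_com N \<mu> (\<lambda>k l. q k l x) i j) x = spin_com N \<mu> (\<lambda>k l. crot \<nu> (q k l) x) i j"
  unfolding spin_com_def
  by (subst crot_sum) (auto intro!: csmooth_diff csmooth_mult q simp: crot_diff crot_cmult crot_multc csmooth_mult q
      simp del: sum.lessThan_Suc)

lemma crot_spin_anti: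
  assumes q: "\<And>k l. csmooth (q k l)"
  shows "crot \<nu> (\<lambda>x. spin_anti N \<mu> (\<lambda>k l. q k l x) i j) x = spin_anti N \<mu> (\<lambda>k l. crot \<nu> (q k l) x) i j"
  unfolding spin_anti_def
  by (subst crot_sum) (auto intro!: csmooth_add csmooth_mult q simp: crot_add crot_cmult crot_multc csmooth_mult q
      simp del: sum.lessThan_Suc)

lemma crot_coh_com:
  "x \<in> sphere 0 1 \<Longrightarrow> i \<le> N \<Longrightarrow> j \<le> N \<Longrightarrow>
    crot \<mu> (coh N i j) x = \<i> * spin_com N \<mu> (\<lambda>k l. coh N k l x) i j"
  unfolding spin_com_def by (rule crot_coh)

text \<open>The inner derivative is replaced by its commutator, which is legitimate on the sphere by
  \<open>crot_cong_sphere\<close>; the outer one then passes through the constant matrices. The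
  outer commutator thus belongs to the inner field: the order is reversed.\<close>

lemma crot_crot_coh:
  assumes x: "x \<in> sphere 0 1" and ij: "i \<le> N" "j \<le> N"
  shows "crot \<nu> (crot \<mu> (coh N i j)) x = \<i> * spin_com N \<mu> (\<lambda>k l. crot \<nu> (coh N k l) x) i j"
proof -
  have "crot \<nu> (crot \<mu> (coh N i j)) x = crot \<nu> (\<lambda>x. \<i> * spin_com N \<mu> (\<lambda>k l. coh N k l x) i j) x"
    by (rule crot_cong_sphere) (use x ij in \<open>auto intro!: csmooth_crot csmooth_coh csmooth_mult csmooth_spin_com simp: crot_coh_com\<close>)
  then show ?thesis by (simp add: crot_cmult csmooth_spin_com csmooth_coh crot_spin_com)
qed

lemma crot_radial: "x $ 1 * crot 1 f x + x $ 2 * crot 2 f x + x $ 3 * crot 3 f x = 0"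
  using rot_radial[of x "\<lambda>x. Re (f x)"] rot_radial[of x "\<lambda>x. Im (f x)"]
  by (simp add: crot_def complex_eq_iff)

lemma crot_coord: "crot \<mu> (\<lambda>x. complex_of_real (x $ i)) x = complex_of_real (rot \<mu> (\<lambda>x. x $ i) x)"
  by (simp add: crot_def complex_eq_iff)

text \<open>The twist term acts on the symbol in two ways, according to the order in which the commutator
  and the anticommutator with \<open>S\<^sub>x\<close> are turned into differential operators. Their average is the
  symmetric form of the generator.\<close>

lemma twist_coh:
  assumes x: "x \<in> sphere 0 1" and ij: "i \<le> N" "j \<le> N"
  shows "\<i> * spin_com N 1 (spin_anti N 1 (\<lambda>k l. coh N k l x)) i j
    = (2 * spin N - 1 / 2) * (x $ 1 * crot 1 (coh N i j) x)
      + (x $ 2 * (crot 1 (crot 3 (coh N i j)) x + crot 3 (crot 1 (coh N i j)) x)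
        - x $ 3 * (crot 1 (crot 2 (coh N i j)) x + crot 2 (crot 1 (coh N i j)) x)) / 2"
proof -
  let ?q = "coh N" and ?T = "spin_com N 1 (spin_anti N 1 (\<lambda>k l. coh N k l x)) i j"
  have anti: "spin_anti N 1 (\<lambda>k l. ?q k l y) k l
      = 2 * spin N * (y $ 1 * ?q k l y) + y $ 2 * crot 3 (?q k l) y - y $ 3 * crot 2 (?q k l) y"
    if "y \<in> sphere 0 1" "k \<le> N" "l \<le> N" for y k l
    unfolding spin_anti_def by (rule anticommutator_coh[OF that])
  note sm = csmooth_add csmooth_diff csmooth_mult csmooth_const csmooth_of_real csmooth_crot csmooth_coh smooth_coord
  have "?T = spin_com N 1 (\<lambda>k l. 2 * spin N * x $ 1 * ?q k l x + x $ 2 * crot 3 (?q k l) x - x $ 3 * crot 2 (?q k l) x) i j"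
    by (rule spin_com_cong) (use anti[OF x] ij in \<open>simp_all add: mult.assoc\<close>)
  also have "\<dots> = 2 * spin N * x $ 1 * spin_com N 1 (\<lambda>k l. ?q k l x) i j
      + x $ 2 * spin_com N 1 (\<lambda>k l. crot 3 (?q k l) x) i j - x $ 3 * spin_com N 1 (\<lambda>k l. crot 2 (?q k l) x) i j"
    unfolding spin_com_add spin_com_diff spin_com_cmult ..
  finally have T: "?T = 2 * spin N * x $ 1 * spin_com N 1 (\<lambda>k l. ?q k l x) i j
      + x $ 2 * spin_com N 1 (\<lambda>k l. crot 3 (?q k l) x) i j - x $ 3 * spin_com N 1 (\<lambda>k l. crot 2 (?q k l) x) i j" .
  \<comment> \<open>Commutator outermost: the anticommutator formula is inserted inside it, where
    the coordinates are constants, and the coefficient of the drift stays 2 S.\<close>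
  have 1: "\<i> * ?T = 2 * spin N * (x $ 1 * crot 1 (?q i j) x)
      + x $ 2 * crot 3 (crot 1 (?q i j)) x - x $ 3 * crot 2 (crot 1 (?q i j)) x"
    unfolding crot_crot_coh[OF x ij] crot_coh_com[OF x ij] T by (simp add: algebra_simps)
  have "\<i> * ?T = spin_anti N 1 (\<lambda>k l. \<i> * spin_com N 1 (\<lambda>k l. ?q k l x) k l) i j"
    unfolding spin_anti_cmult spin_anti_com[OF ij] ..
  also have "\<dots> = spin_anti N 1 (\<lambda>k l. crot 1 (?q k l) x) i j"
    by (rule spin_anti_cong) (use x ij in \<open>simp_all add: crot_coh_com\<close>)
  also have "\<dots> = crot 1 (\<lambda>y. spin_anti N 1 (\<lambda>k l. ?q k l y) i j) x"
    by (rule crot_spin_anti[OF csmooth_coh, symmetric])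
  also have "\<dots> = crot 1 (\<lambda>y. 2 * spin N * (complex_of_real (y $ 1) * ?q i j y)
      + complex_of_real (y $ 2) * crot 3 (?q i j) y - complex_of_real (y $ 3) * crot 2 (?q i j) y) x"
    by (rule crot_cong_sphere) (use x ij in \<open>auto intro!: sm csmooth_spin_anti simp: anti\<close>)
  also have "\<dots> = 2 * spin N * (x $ 1 * crot 1 (?q i j) x)
      + (x $ 2 * crot 1 (crot 3 (?q i j)) x + x $ 3 * crot 3 (?q i j) x)
      - (x $ 3 * crot 1 (crot 2 (?q i j)) x - x $ 2 * crot 2 (?q i j) x)"
    by (simp add: crot_add crot_diff crot_mult crot_coord rot_coord sm)
  \<comment> \<open>Anticommutator outermost: \<open>crot 1\<close> now also hits the coefficients
    x_2 and x_3 and adds x_2 rot_2 + x_3 rot_3. Completing this to the radial combination, which is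
    0, lowers the coefficient of the drift to 2 S - 1.\<close>
  finally have 2: "\<i> * ?T = (2 * spin N - 1) * (x $ 1 * crot 1 (?q i j) x)
      + x $ 2 * crot 1 (crot 3 (?q i j)) x - x $ 3 * crot 1 (crot 2 (?q i j)) x
      + (x $ 1 * crot 1 (?q i j) x + x $ 2 * crot 2 (?q i j) x + x $ 3 * crot 3 (?q i j) x)"
    by (simp add: algebra_simps)
  have "\<i> * ?T = (\<i> * ?T + \<i> * ?T) / 2" by simp
  also have "\<dots> = (2 * spin N - 1 / 2) * (x $ 1 * crot 1 (coh N i j) x)
      + (x $ 2 * (crot 1 (crot 3 (coh N i j)) x + crot 3 (crot 1 (coh N i j)) x)
        - x $ 3 * (crot 1 (crot 2 (coh N i j)) x + crot 2 (crot 1 (coh N i j)) x)) / 2"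
    by (subst (1) 1, subst 2) (simp add: crot_radial[unfolded add.assoc] algebra_simps add_divide_distrib diff_divide_distrib)
  finally show ?thesis .
qed

definition cbackward :: "real \<Rightarrow> real \<Rightarrow> real \<Rightarrow> (real^3 \<Rightarrow> complex) \<Rightarrow> real^3 \<Rightarrow> complex" where
  "cbackward \<gamma> c S q x = Complex (backward_generator \<gamma> c S (\<lambda>x. Re (q x)) x) (backward_generator \<gamma> c S (\<lambda>x. Im (q x)) x)"

lemma cbackward_eq:
  "cbackward \<gamma> c S q x = - (2 * S - 1 / 2) * c * (x $ 1 * crot 1 q x)
    + \<gamma> / 2 * (crot 1 (crot 1 q) x + crot 2 (crot 2 q) x + crot 3 (crot 3 q) x)
    - c / 2 * (x $ 2 * (crot 1 (crot 3 q) x + crot 3 (crot 1 q) x)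
              - x $ 3 * (crot 1 (crot 2 q) x + crot 2 (crot 1 q) x))"
  by (simp add: cbackward_def backward_generator_def twist_diffusion_def crot_def complex_eq_iff)

text \<open>The hinge between the quantum and the classical side. Since \<open>crot\<close> is \<i>
  times a commutator, its square is minus a double commutator, and the dissipator becomes \<gamma> /
  2 times the sum of the squared fields; the twist is \<open>twist_coh\<close>. Integration over a
  measure then transfers the generator from projectors to distributions.\<close>

theorem cbackward_coh:
  assumes x: "x \<in> sphere 0 1" and ij: "i \<le> N" "j \<le> N"
  shows "cbackward \<gamma> (\<kappa> / (2 * spin N + 1)) (spin N) (coh N i j) x
    = lindblad_rhs N \<kappa> \<gamma> (square N (\<lambda>k l. coh N k l x)) $$ (i, j)"
proof -
  have d: "crot \<mu> (crot \<mu> (coh N i j)) x = - spin_com N \<mu> (spin_com N \<mu> (\<lambda>k l. coh N k l x)) i j" for \<mu>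
  proof -
    have "spin_com N \<mu> (\<lambda>k l. crot \<mu> (coh N k l) x) i j
        = spin_com N \<mu> (\<lambda>k l. \<i> * spin_com N \<mu> (\<lambda>k l. coh N k l x) k l) i j"
      by (rule spin_com_cong) (use x ij in \<open>simp_all add: crot_coh_com\<close>)
    then show ?thesis unfolding crot_crot_coh[OF x ij] spin_com_cmult by simp
  qed
  have "cbackward \<gamma> c (spin N) (coh N i j) x = - c * ((2 * spin N - 1 / 2) * (x $ 1 * crot 1 (coh N i j) x)
      + (x $ 2 * (crot 1 (crot 3 (coh N i j)) x + crot 3 (crot 1 (coh N i j)) x)
        - x $ 3 * (crot 1 (crot 2 (coh N i j)) x + crot 2 (crot 1 (coh N i j)) x)) / 2)
      + \<gamma> / 2 * (crot 1 (crot 1 (coh N i j)) x + crot 2 (crot 2 (coh N i j)) x + crot 3 (crot 3 (coh N i j)) x)" for c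
    unfolding cbackward_eq by (simp add: algebra_simps add_divide_distrib diff_divide_distrib)
  then show ?thesis
    unfolding lindblad_rhs_square[OF ij] twist_coh[OF x ij, symmetric] d
    by (simp add: algebra_simps)
qed

section \<open>Uniqueness for linear systems and the kicks\<close>

text \<open>Gronwall's argument for the sum \<open>E\<close> of squared moduli: exp (-L t) E(t) does
  not increase, with \<open>L\<close> equal to 2 K times the number of components by Cauchy-Schwarz.
  Derivatives within a half-open interval fit the segments between kicks, where only a right
  derivative is available at the left end.\<close>

lemma linear_ode_zero:
  fixes d :: "'i \<Rightarrow> real \<Rightarrow> complex"
  assumes I: "finite I"
    and d: "\<And>i t. i \<in> I \<Longrightarrow> a \<le> t \<Longrightarrow> t < b \<Longrightarrow> (d i has_vector_derivative d' i t) (at t within {a..<b})"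
    and bound: "\<And>i t. i \<in> I \<Longrightarrow> a \<le> t \<Longrightarrow> t < b \<Longrightarrow> cmod (d' i t) \<le> K * (\<Sum>j\<in>I. cmod (d j t))"
    and K: "K \<ge> 0" and init: "\<And>i. i \<in> I \<Longrightarrow> d i a = 0"
    and it: "i \<in> I" "a \<le> t" "t < b"
  shows "d i t = 0"
proof -
  define E where "E t = (\<Sum>i\<in>I. (Re (d i t))\<^sup>2 + (Im (d i t))\<^sup>2)" for t
  define E' where "E' t = (\<Sum>i\<in>I. 2 * (Re (d i t) * Re (d' i t) + Im (d i t) * Im (d' i t)))" for t
  define L where "L = 2 * K * card I"
  have E0: "E t \<ge> 0" for t unfolding E_def by (intro sum_nonneg) auto
  have dE: "(E has_real_derivative E' t) (at t within {a..<b})" if t: "a \<le> t" "t < b" for t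
  proof -
    have "((\<lambda>t. (Re (d i t))\<^sup>2 + (Im (d i t))\<^sup>2) has_real_derivative
        2 * (Re (d i t) * Re (d' i t) + Im (d i t) * Im (d' i t))) (at t within {a..<b})" if "i \<in> I" for i
    proof -
      have r: "((\<lambda>t. Re (d i t)) has_real_derivative Re (d' i t)) (at t within {a..<b})"
        and im: "((\<lambda>t. Im (d i t)) has_real_derivative Im (d' i t)) (at t within {a..<b})"
        using d[OF that t] by (simp_all add: has_vector_derivative_complex_iff has_real_derivative_iff_has_vector_derivative)
      show ?thesis
        using DERIV_add[OF DERIV_power[OF r, of 2] DERIV_power[OF im, of 2]] by (simp add: algebra_simps)
    qed
    then show ?thesis unfolding E_def E'_def by (intro DERIV_sum)
  qed
  have E'_le: "E' t \<le> L * E t" if t: "a \<le> t" "t < b" for t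
  proof -
    have "E' t \<le> (\<Sum>i\<in>I. 2 * (cmod (d i t) * cmod (d' i t)))"
      unfolding E'_def
    proof (intro sum_mono mult_left_mono)
      fix i
      have "Re (d i t) * Re (d' i t) + Im (d i t) * Im (d' i t) = Re (d i t * cnj (d' i t))" by simp
      also have "\<dots> \<le> cmod (d i t) * cmod (d' i t)"
        using complex_Re_le_cmod[of "d i t * cnj (d' i t)"] by (simp add: norm_mult)
      finally show "Re (d i t) * Re (d' i t) + Im (d i t) * Im (d' i t) \<le> cmod (d i t) * cmod (d' i t)" .
    qed simp
    also have "\<dots> \<le> (\<Sum>i\<in>I. 2 * (cmod (d i t) * (K * (\<Sum>j\<in>I. cmod (d j t)))))"
      by (intro sum_mono mult_left_mono bound t) auto
    also have "\<dots> = 2 * K * (\<Sum>j\<in>I. cmod (d j t))\<^sup>2"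
      by (simp add: power2_eq_square sum_distrib_left sum_distrib_right mult_ac)
    also have "\<dots> \<le> 2 * K * ((\<Sum>j\<in>I. (cmod (d j t))\<^sup>2) * card I)"
      using K by (intro mult_left_mono sum_squared_le_sum_of_squares) auto
    also have "\<dots> = L * E t" by (simp add: L_def E_def cmod_power2)
    finally show ?thesis .
  qed
  define g where "g s = exp (- L * s) * E s" for s
  have dg: "(g has_real_derivative exp (- L * s) * (E' s - L * E s)) (at s within {a..<b})"
    if "a \<le> s" "s < b" for s
    unfolding g_def by (rule derivative_eq_intros dE that refl | simp)+ (simp add: algebra_simps)
  have "g t \<le> g a"
  proof (rule DERIV_nonpos_imp_decreasing_open[OF it(2)])
    fix x assume x: "a < x" "x < t"
    have "at x within {a..<b} = at x"
      using x it by (intro at_within_interior) auto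
    then have "DERIV g x :> exp (- L * x) * (E' x - L * E x)" using dg[of x] x it by simp
    moreover have "exp (- L * x) * (E' x - L * E x) \<le> 0"
      using E'_le[of x] x it by (intro mult_nonneg_nonpos) auto
    ultimately show "\<exists>y. DERIV g x :> y \<and> y \<le> 0" by blast
  next
    show "continuous_on {a..t} g"
      by (rule DERIV_continuous_on) (rule DERIV_subset[OF dg], use it in auto)
  qed
  moreover have "g a = 0" by (simp add: g_def E_def init)
  ultimately have "exp (- L * t) * E t \<le> 0" by (simp add: g_def)
  then have "E t \<le> 0" by (simp add: mult_le_0_iff)
  then have "E t = 0" using E0[of t] by simp
  then have "(Re (d i t))\<^sup>2 + (Im (d i t))\<^sup>2 = 0"
    using I it(1) unfolding E_def by (subst (asm) sum_nonneg_eq_0_iff) auto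
  then show ?thesis by (simp add: complex_eq_iff sum_power2_eq_zero_iff)
qed

section \<open>The kick as a classical flow and as a unitary\<close>

lemma hamiltonian_orbit_kick:
  "hamiltonian_orbit (H_kick p) c \<longleftrightarrow> (\<forall>s. ((\<lambda>s. c s $ 1) has_real_derivative - p * c s $ 2) (at s) \<and>
     ((\<lambda>s. c s $ 2) has_real_derivative p * c s $ 1) (at s) \<and> ((\<lambda>s. c s $ 3) has_real_derivative 0) (at s))"
  unfolding hamiltonian_orbit_def has_vector_derivative_vec3 forall_3
  by (simp add: poisson_H_kick rot_coord)

lemma time_one_flow_kick: "time_one_flow (H_kick p) x = axis_rotate 3 p x"
  unfolding time_one_flow_def
proof (rule the_equality)
  have "hamiltonian_orbit (H_kick p) (\<lambda>s. axis_rotate 3 (p * s) x)"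
    unfolding hamiltonian_orbit_kick axis_rotate_def
    by (auto intro!: derivative_eq_intros simp: algebra_simps)
  then show "\<exists>c. hamiltonian_orbit (H_kick p) c \<and> c 0 = x \<and> c 1 = axis_rotate 3 p x"
    by (intro exI[of _ "\<lambda>s. axis_rotate 3 (p * s) x"]) simp
next
  fix y assume "\<exists>c. hamiltonian_orbit (H_kick p) c \<and> c 0 = x \<and> c 1 = y"
  then obtain c where c: "hamiltonian_orbit (H_kick p) c" and c0: "c 0 = x" "c 1 = y" by blast
  have d: "((\<lambda>s. c s $ 1) has_real_derivative - p * c s $ 2) (at s)"
    "((\<lambda>s. c s $ 2) has_real_derivative p * c s $ 1) (at s)" "((\<lambda>s. c s $ 3) has_real_derivative 0) (at s)" for s
    using c unfolding hamiltonian_orbit_kick by auto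
  \<comment> \<open>\<open>THE\<close> demands uniqueness: in the frame that rotates with angular
    velocity \<open>p\<close> every orbit is at rest.\<close>
  define e1 where "e1 s = cos (p * s) * c s $ 1 + sin (p * s) * c s $ 2" for s
  define e2 where "e2 s = cos (p * s) * c s $ 2 - sin (p * s) * c s $ 1" for s
  have "DERIV e1 s :> 0" "DERIV e2 s :> 0" for s
    unfolding e1_def e2_def by (auto intro!: derivative_eq_intros d simp: algebra_simps)
  then have e: "e1 1 = e1 0" "e2 1 = e2 0" using DERIV_isconst_all by blast+
  have 3: "c 1 $ 3 = c 0 $ 3" using DERIV_isconst_all[of "\<lambda>s. c s $ 3" 1 0] d(3) by blast
  have one: "cos p * (cos p * r) = r - sin p * (sin p * r)" for r by (rule cos_cos_mult)
  have "y $ 1 = cos p * e1 1 - sin p * e2 1" "y $ 2 = sin p * e1 1 + cos p * e2 1"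
    by (simp_all add: e1_def e2_def c0 algebra_simps one)
  moreover have "e1 0 = x $ 1" "e2 0 = x $ 2" "y $ 3 = x $ 3"
    using 3 by (simp_all add: e1_def e2_def c0)
  ultimately have "y $ 1 = cos p * x $ 1 - sin p * x $ 2" "y $ 2 = sin p * x $ 1 + cos p * x $ 2" "y $ 3 = x $ 3"
    unfolding e by simp_all
  then show "y = axis_rotate 3 p x"
    by (simp add: axis_rotate_def Finite_Cartesian_Product.vec_eq_iff forall_3)
qed

lemma bounded_linear_axis_rotate: "bounded_linear (axis_rotate \<mu> s)"
proof -
  have "linear (axis_rotate \<mu> s)"
    by (rule rot_cases[of _ \<mu>]; rule linearI)
      (simp_all add: axis_rotate_def Finite_Cartesian_Product.vec_eq_iff forall_3 algebra_simps)
  then show ?thesis by (simp add: linear_conv_bounded_linear)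
qed

definition kick_phase :: "nat \<Rightarrow> real \<Rightarrow> nat \<Rightarrow> complex" where
  "kick_phase N p i = exp (- \<i> * complex_of_real p * complex_of_real (spin N - real i))"

lemma kick_unitary_index:
  assumes "i \<le> N" "j \<le> N"
  shows "kick_unitary N p $$ (i, j) = (if i = j then kick_phase N p i else 0)"
proof -
  define A where "A = (- \<i> * complex_of_real p) \<cdot>\<^sub>m spin_op N 3"
  define a where "a i = - \<i> * complex_of_real p * complex_of_real (spin N - real i)" for i
  have A: "A \<in> carrier_mat (Suc N) (Suc N)" by (simp add: A_def)
  have Ai: "A $$ (i, j) = (if i = j then a i else 0)" if "i \<le> N" "j \<le> N" for i j
    using that by (simp add: A_def a_def spin_op_index)
  have pow: "(A ^\<^sub>m k) $$ (i, j) = (if i = j then a i ^ k else 0)" if "i \<le> N" "j \<le> N" for i j k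
    using that
  proof (induction k arbitrary: i j)
    case 0
    then show ?case using A by simp
  next
    case (Suc k)
    have "(A ^\<^sub>m Suc k) $$ (i, j) = (\<Sum>l<Suc N. (A ^\<^sub>m k) $$ (i, l) * A $$ (l, j))"
      by (simp only: pow_mat.simps) (rule times_mat_index[OF pow_carrier_mat[OF A] A Suc.prems])
    also have "\<dots> = (\<Sum>l<Suc N. if i = l then a i ^ k * A $$ (i, j) else 0)"
      by (intro sum.cong refl) (use Suc in \<open>auto simp: less_Suc_eq_le\<close>)
    also have "\<dots> = a i ^ k * A $$ (i, j)" using Suc.prems by (simp add: sum.delta' del: sum.lessThan_Suc)
    finally show ?case using Suc.prems by (simp add: Ai mult.commute)
  qed
  have "kick_unitary N p $$ (i, j) = (\<Sum>k. (A ^\<^sub>m k) $$ (i, j) / fact k)"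
    using assms A unfolding kick_unitary_def mat_exp_def A_def[symmetric] by simp
  also have "\<dots> = (if i = j then (\<Sum>k. a i ^ k / fact k) else 0)" using assms by (simp add: pow)
  also have "(\<Sum>k. a i ^ k / fact k) = exp (a i)"
    by (simp add: exp_def scaleR_conv_of_real divide_inverse mult.commute)
  finally show ?thesis by (simp add: a_def kick_phase_def)
qed

lemma kick_unitary_carrier: "kick_unitary N p \<in> carrier_mat (Suc N) (Suc N)"
  by (simp add: kick_unitary_def mat_exp_def)

lemma kick_conjugation_index:
  assumes \<sigma>: "\<sigma> \<in> carrier_mat (Suc N) (Suc N)" and ij: "i \<le> N" "j \<le> N"
  shows "(kick_unitary N p * \<sigma> * mat_adjoint (kick_unitary N p)) $$ (i, j)
    = kick_phase N p i * cnj (kick_phase N p j) * \<sigma> $$ (i, j)"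
proof -
  note U = kick_unitary_carrier[of N p]
  have U\<sigma>: "(kick_unitary N p * \<sigma>) $$ (i, k) = kick_phase N p i * \<sigma> $$ (i, k)" if "k \<le> N" for k
  proof -
    have "(kick_unitary N p * \<sigma>) $$ (i, k) = (\<Sum>l<Suc N. kick_unitary N p $$ (i, l) * \<sigma> $$ (l, k))"
      using times_mat_index[OF U \<sigma> ij(1) that] .
    also have "\<dots> = (\<Sum>l<Suc N. if i = l then kick_phase N p i * \<sigma> $$ (i, k) else 0)"
      by (intro sum.cong refl) (use ij in \<open>auto simp: less_Suc_eq_le kick_unitary_index\<close>)
    finally show ?thesis using ij by (simp add: sum.delta' del: sum.lessThan_Suc)
  qed
  have "(kick_unitary N p * \<sigma> * mat_adjoint (kick_unitary N p)) $$ (i, j)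
      = (\<Sum>k<Suc N. (kick_unitary N p * \<sigma>) $$ (i, k) * mat_adjoint (kick_unitary N p) $$ (k, j))"
    using times_mat_index[OF mult_carrier_mat[OF U \<sigma>] mat_adjoint_carrier[OF U] ij] .
  also have "\<dots> = (\<Sum>k<Suc N. if j = k then kick_phase N p i * cnj (kick_phase N p j) * \<sigma> $$ (i, j) else 0)"
  proof (intro sum.cong refl)
    fix k assume "k \<in> {..<Suc N}"
    then have k: "k \<le> N" by simp
    have "mat_adjoint (kick_unitary N p) $$ (k, j) = cnj (kick_unitary N p $$ (j, k))"
      by (rule mat_adjoint_index[OF U]) (use k ij in auto)
    then show "(kick_unitary N p * \<sigma>) $$ (i, k) * mat_adjoint (kick_unitary N p) $$ (k, j)
        = (if j = k then kick_phase N p i * cnj (kick_phase N p j) * \<sigma> $$ (i, j) else 0)"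
      using k ij by (simp add: U\<sigma> kick_unitary_index)
  qed
  finally show ?thesis using ij by (simp add: sum.delta' del: sum.lessThan_Suc)
qed

text \<open>On spinors the kick multiplies \<alpha> by w = exp (-\<i> p / 2) and \<beta> by the
  inverse of w. Component \<open>k\<close> thus gains w^(N - 2 k), which is the phase exp (-\<i> p
  (S - k)) of the unitary, so the classical and the quantum kick agree exactly.\<close>

lemma coh_axis_rotate_kick:
  assumes x: "x \<in> sphere 0 1" and ij: "i \<le> N" "j \<le> N"
  shows "coh N i j (axis_rotate 3 p x) = kick_phase N p i * cnj (kick_phase N p j) * coh N i j x"
proof -
  obtain \<alpha> \<beta> where n: "(cmod \<alpha>)\<^sup>2 + (cmod \<beta>)\<^sup>2 = 1" and xh: "hopf \<alpha> \<beta> = x" using hopf_surj[OF x] .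
  define w where "w = exp (- \<i> * complex_of_real p / 2)"
  have iw: "inverse w = exp (\<i> * complex_of_real p / 2)" by (simp add: w_def exp_minus)
  have w: "w = cos (complex_of_real p / 2) - \<i> * sin (complex_of_real p / 2)"
    using exp_Euler[of "- (complex_of_real p / 2)"] by (simp add: w_def)
  have w': "inverse w = cos (complex_of_real p / 2) + \<i> * sin (complex_of_real p / 2)"
    using exp_Euler[of "complex_of_real p / 2"] by (simp add: iw)
  have a: "su_fst 3 (of_real p) \<alpha> \<beta> = w * \<alpha>" "su_snd 3 (of_real p) \<alpha> \<beta> = inverse w * \<beta>"
    unfolding w' unfolding w by (simp_all add: su_fst_def su_snd_def algebra_simps)
  have sp: "spinor N (w * \<alpha>) (inverse w * \<beta>) k = kick_phase N p k * spinor N \<alpha> \<beta> k" if "k \<le> N" for k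
  proof -
    have "w ^ (N - k) * inverse w ^ k = exp (of_nat (N - k) * (- \<i> * complex_of_real p / 2))
        * exp (of_nat k * (\<i> * complex_of_real p / 2))"
      unfolding iw exp_of_nat_mult unfolding w_def ..
    also have "\<dots> = kick_phase N p k"
      unfolding kick_phase_def exp_add[symmetric]
      by (rule arg_cong[of _ _ exp]) (use that in \<open>simp add: spin_def of_nat_diff field_simps\<close>)
    finally have k: "w ^ (N - k) * inverse w ^ k = kick_phase N p k" .
    show ?thesis unfolding spinor_def power_mult_distrib k[symmetric] by (simp add: mult_ac)
  qed
  have "coh N i j (axis_rotate 3 p x) = spinor N (w * \<alpha>) (inverse w * \<beta>) i * cnj (spinor N (w * \<alpha>) (inverse w * \<beta>) j)"
    unfolding xh[symmetric] su_norm_hopf(2)[symmetric] a[symmetric]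
    by (rule coh_hopf) (use n ij su_norm_hopf(1)[of 3 p \<alpha> \<beta>] in simp_all)
  then show ?thesis
    unfolding sp[OF ij(1)] sp[OF ij(2)] xh[symmetric] coh_hopf[OF n ij] by simp
qed

text \<open>Stated within an arbitrary set, so that it covers the one-sided derivative at the start
  of a segment as well as the approach to its right end.\<close>

lemma quadratic_imp_derivative:
  fixes f :: "real \<Rightarrow> real"
  assumes "\<And>s. s \<in> A \<Longrightarrow> \<bar>s - t\<bar> \<le> 1 \<Longrightarrow> \<bar>f s - f t - (s - t) * d\<bar> \<le> K * (s - t)\<^sup>2"
  shows "(f has_real_derivative d) (at t within A)"
proof -
  have "((\<lambda>s. (f s - f t) / (s - t) - d) \<longlongrightarrow> 0) (at t within A)"
  proof (rule Lim_null_comparison)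
    show "\<forall>\<^sub>F s in at t within A. norm ((f s - f t) / (s - t) - d) \<le> K * \<bar>s - t\<bar>"
      unfolding eventually_at
    proof (intro exI[of _ 1] conjI ballI impI)
      fix s assume s: "s \<in> A" "s \<noteq> t \<and> dist s t < 1"
      then have nz: "s - t \<noteq> 0" by simp
      have "norm ((f s - f t) / (s - t) - d) = \<bar>f s - f t - (s - t) * d\<bar> / \<bar>s - t\<bar>"
        using nz by (simp add: diff_divide_distrib flip: abs_divide)
      also have "\<dots> \<le> K * (s - t)\<^sup>2 / \<bar>s - t\<bar>"
        using assms[of s] s by (intro divide_right_mono) (simp_all add: dist_real_def)
      also have "K * (s - t)\<^sup>2 = (K * \<bar>s - t\<bar>) * \<bar>s - t\<bar>"
        by (simp add: power2_eq_square mult.assoc flip: abs_mult)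
      finally show "norm ((f s - f t) / (s - t) - d) \<le> K * \<bar>s - t\<bar>"
        using nz by simp
    qed simp
    have "((\<lambda>s. K * \<bar>s - t\<bar>) \<longlongrightarrow> K * \<bar>t - t\<bar>) (at t within A)"
      by (intro tendsto_intros)
    then show "((\<lambda>s. K * \<bar>s - t\<bar>) \<longlongrightarrow> 0) (at t within A)" by simp
  qed
  then show ?thesis
    unfolding has_field_derivative_iff by (rule LIM_zero_cancel)
qed

section \<open>Boundedness and linearity of the Lindblad generator\<close>

definition mat_l1 :: "nat \<Rightarrow> (nat \<Rightarrow> nat \<Rightarrow> complex) \<Rightarrow> real" where
  "mat_l1 N F = (\<Sum>ij\<in>{..<Suc N} \<times> {..<Suc N}. cmod (F (fst ij) (snd ij)))"

lemma entry_le_mat_l1: "i \<le> N \<Longrightarrow> j \<le> N \<Longrightarrow> cmod (F i j) \<le> mat_l1 N F"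
  unfolding mat_l1_def
  using member_le_sum[of "(i, j)" "{..<Suc N} \<times> {..<Suc N}" "\<lambda>ij. cmod (F (fst ij) (snd ij))"] by simp

lemma mat_l1_nonneg: "mat_l1 N F \<ge> 0"
  unfolding mat_l1_def by (intro sum_nonneg) auto

lemma mat_l1_le:
  assumes "\<And>i j. i \<le> N \<Longrightarrow> j \<le> N \<Longrightarrow> cmod (F i j) \<le> b"
  shows "mat_l1 N F \<le> (real (Suc N))\<^sup>2 * b"
proof -
  have "mat_l1 N F \<le> (\<Sum>ij\<in>{..<Suc N} \<times> {..<Suc N}. b)"
    unfolding mat_l1_def by (intro sum_mono) (auto intro: assms)
  then show ?thesis
    by (simp only: sum_constant card_cartesian_product card_lessThan of_nat_mult power2_eq_square)
qed

lemma spin_com_anti_bounded: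
  "\<exists>K\<ge>0. \<forall>F. mat_l1 N (spin_com N \<mu> F) \<le> K * mat_l1 N F \<and> mat_l1 N (spin_anti N \<mu> F) \<le> K * mat_l1 N F"
proof -
  define s where "s = mat_l1 N (\<lambda>i j. spin_op N \<mu> $$ (i, j))"
  have s: "cmod (spin_op N \<mu> $$ (i, j)) \<le> s" if "i \<le> N" "j \<le> N" for i j
    unfolding s_def using entry_le_mat_l1[OF that, of "\<lambda>i j. spin_op N \<mu> $$ (i, j)"] .
  have s0: "s \<ge> 0" unfolding s_def by (rule mat_l1_nonneg)
  define K where "K = (real (Suc N))\<^sup>2 * (real (Suc N) * (2 * s))"
  have m: "cmod (spin_op N \<mu> $$ (i, k) * F k j) \<le> s * mat_l1 N F"
    "cmod (F i k * spin_op N \<mu> $$ (k, j)) \<le> s * mat_l1 N F" if "i \<le> N" "j \<le> N" "k \<le> N" for F i j k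
    using mult_mono[OF s[OF that(1,3)] entry_le_mat_l1[OF that(3,2), of F]]
      mult_mono[OF entry_le_mat_l1[OF that(1,3), of F] s[OF that(3,2)]] s0 mat_l1_nonneg[of N F]
    by (simp_all add: norm_mult mult.commute)
  have "mat_l1 N (spin_com N \<mu> F) \<le> K * mat_l1 N F" for F
  proof -
    have "cmod (spin_com N \<mu> F i j) \<le> real (Suc N) * (2 * s * mat_l1 N F)" if "i \<le> N" "j \<le> N" for i j
    proof -
      have "cmod (spin_com N \<mu> F i j) \<le> (\<Sum>k<Suc N. 2 * s * mat_l1 N F)"
        unfolding spin_com_def
      proof (rule sum_norm_le)
        fix k assume "k \<in> {..<Suc N}"
        then have "k \<le> N" by simp
        from m[OF that this, of F] show "cmod (spin_op N \<mu> $$ (i, k) * F k j - F i k * spin_op N \<mu> $$ (k, j)) \<le> 2 * s * mat_l1 N F"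
          using norm_triangle_ineq4[of "spin_op N \<mu> $$ (i, k) * F k j" "F i k * spin_op N \<mu> $$ (k, j)"] by linarith
      qed
      then show ?thesis by simp
    qed
    from mat_l1_le[of N "spin_com N \<mu> F", OF this] show ?thesis by (simp add: K_def mult_ac del: of_nat_Suc)
  qed
  moreover have "mat_l1 N (spin_anti N \<mu> F) \<le> K * mat_l1 N F" for F
  proof -
    have "cmod (spin_anti N \<mu> F i j) \<le> real (Suc N) * (2 * s * mat_l1 N F)" if "i \<le> N" "j \<le> N" for i j
    proof -
      have "cmod (spin_anti N \<mu> F i j) \<le> (\<Sum>k<Suc N. 2 * s * mat_l1 N F)"
        unfolding spin_anti_def
      proof (rule sum_norm_le)
        fix k assume "k \<in> {..<Suc N}"
        then have "k \<le> N" by simp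
        from m[OF that this, of F] show "cmod (spin_op N \<mu> $$ (i, k) * F k j + F i k * spin_op N \<mu> $$ (k, j)) \<le> 2 * s * mat_l1 N F"
          using norm_triangle_ineq[of "spin_op N \<mu> $$ (i, k) * F k j" "F i k * spin_op N \<mu> $$ (k, j)"] by linarith
      qed
      then show ?thesis by simp
    qed
    from mat_l1_le[of N "spin_anti N \<mu> F", OF this] show ?thesis by (simp add: K_def mult_ac del: of_nat_Suc)
  qed
  moreover have "K \<ge> 0" using s0 by (simp add: K_def)
  ultimately show ?thesis by blast
qed

text \<open>Supplies the constant of the uniqueness argument; the entrywise norm has the shape of
  the sum over components in \<open>linear_ode_zero\<close>.\<close>

lemma lindblad_rhs_bounded:
  "\<exists>K\<ge>0. \<forall>F i j. i \<le> N \<longrightarrow> j \<le> N \<longrightarrow> cmod (lindblad_rhs N \<kappa> \<gamma> (square N F) $$ (i, j)) \<le> K * mat_l1 N F"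
proof -
  have "\<forall>\<mu>. \<exists>K\<ge>0. \<forall>F. mat_l1 N (spin_com N \<mu> F) \<le> K * mat_l1 N F \<and> mat_l1 N (spin_anti N \<mu> F) \<le> K * mat_l1 N F"
    using spin_com_anti_bounded by blast
  from choice[OF this] obtain K where K: "\<And>\<mu>. K \<mu> \<ge> 0"
    "\<And>\<mu> F. mat_l1 N (spin_com N \<mu> F) \<le> K \<mu> * mat_l1 N F" "\<And>\<mu> F. mat_l1 N (spin_anti N \<mu> F) \<le> K \<mu> * mat_l1 N F"
    by blast
  define L where "L = \<bar>\<kappa> / (2 * spin N + 1)\<bar> * (K 1 * K 1) + \<bar>\<gamma> / 2\<bar> * (K 1 * K 1 + K 2 * K 2 + K 3 * K 3)"
  have cc: "cmod (spin_com N \<mu> (spin_com N \<mu> F) i j) \<le> K \<mu> * K \<mu> * mat_l1 N F"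
    "cmod (spin_com N \<mu> (spin_anti N \<mu> F) i j) \<le> K \<mu> * K \<mu> * mat_l1 N F" if "i \<le> N" "j \<le> N" for F i j \<mu>
  proof -
    have "cmod (spin_com N \<mu> G i j) \<le> K \<mu> * mat_l1 N G" for G
      using entry_le_mat_l1[OF that, of "spin_com N \<mu> G"] K(2)[of \<mu> G] by linarith
    from this[of "spin_com N \<mu> F"] this[of "spin_anti N \<mu> F"]
    show "cmod (spin_com N \<mu> (spin_com N \<mu> F) i j) \<le> K \<mu> * K \<mu> * mat_l1 N F"
      "cmod (spin_com N \<mu> (spin_anti N \<mu> F) i j) \<le> K \<mu> * K \<mu> * mat_l1 N F"
      using mult_left_mono[OF K(2)[of \<mu> F] K(1)[of \<mu>]] mult_left_mono[OF K(3)[of \<mu> F] K(1)[of \<mu>]]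
      by (simp_all add: mult.assoc)
  qed
  have "cmod (lindblad_rhs N \<kappa> \<gamma> (square N F) $$ (i, j)) \<le> L * mat_l1 N F" if ij: "i \<le> N" "j \<le> N" for F i j
  proof -
    have "cmod (lindblad_rhs N \<kappa> \<gamma> (square N F) $$ (i, j))
      \<le> \<bar>\<kappa> / (2 * spin N + 1)\<bar> * cmod (spin_com N 1 (spin_anti N 1 F) i j)
        + \<bar>\<gamma> / 2\<bar> * cmod (spin_com N 1 (spin_com N 1 F) i j + spin_com N 2 (spin_com N 2 F) i j
          + spin_com N 3 (spin_com N 3 F) i j)"
      unfolding lindblad_rhs_square[OF ij]
      by (rule order_trans[OF norm_triangle_ineq4]) (simp only: norm_mult norm_minus_cancel norm_of_real norm_ii mult_1 order_refl)
    also have "\<dots> \<le> \<bar>\<kappa> / (2 * spin N + 1)\<bar> * (K 1 * K 1 * mat_l1 N F)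
        + \<bar>\<gamma> / 2\<bar> * (K 1 * K 1 * mat_l1 N F + K 2 * K 2 * mat_l1 N F + K 3 * K 3 * mat_l1 N F)"
      by (intro add_mono mult_left_mono cc[OF ij] norm_triangle_mono) auto
    finally show ?thesis by (simp add: L_def algebra_simps)
  qed
  moreover have "L \<ge> 0" unfolding L_def using K(1) by (intro add_nonneg_nonneg mult_nonneg_nonneg) auto
  ultimately show ?thesis by blast
qed

lemma spin_anti_diff: "spin_anti N \<mu> (\<lambda>k l. F k l - G k l) = (\<lambda>k l. spin_anti N \<mu> F k l - spin_anti N \<mu> G k l)"
  unfolding spin_anti_def sum_subtractf[symmetric] by (intro ext sum.cong refl) (simp add: algebra_simps)

lemma spin_com_diff_fun: "spin_com N \<mu> (\<lambda>k l. F k l - G k l) = (\<lambda>k l. spin_com N \<mu> F k l - spin_com N \<mu> G k l)"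
  by (intro ext spin_com_diff)

lemma lindblad_rhs_diff:
  assumes "i \<le> N" "j \<le> N"
  shows "lindblad_rhs N \<kappa> \<gamma> (square N (\<lambda>k l. F k l - G k l)) $$ (i, j)
    = lindblad_rhs N \<kappa> \<gamma> (square N F) $$ (i, j) - lindblad_rhs N \<kappa> \<gamma> (square N G) $$ (i, j)"
  unfolding lindblad_rhs_square[OF assms] spin_anti_diff spin_com_diff_fun by (simp add: algebra_simps)

lemma integral_spin_com:
  assumes "\<And>k l. integrable M (q k l)"
  shows "(\<integral>x. spin_com N \<mu> (\<lambda>k l. q k l x) i j \<partial>M) = spin_com N \<mu> (\<lambda>k l. \<integral>x. q k l x \<partial>M) i j"
    "integrable M (\<lambda>x. spin_com N \<mu> (\<lambda>k l. q k l x) i j)"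
  unfolding spin_com_def using assms by (simp_all del: sum.lessThan_Suc)

lemma integral_spin_anti:
  assumes "\<And>k l. integrable M (q k l)"
  shows "(\<integral>x. spin_anti N \<mu> (\<lambda>k l. q k l x) i j \<partial>M) = spin_anti N \<mu> (\<lambda>k l. \<integral>x. q k l x \<partial>M) i j"
    "integrable M (\<lambda>x. spin_anti N \<mu> (\<lambda>k l. q k l x) i j)"
  unfolding spin_anti_def using assms by (simp_all del: sum.lessThan_Suc)

lemma integral_lindblad_rhs:
  assumes q: "\<And>k l. integrable M (q k l)" and ij: "i \<le> N" "j \<le> N"
  shows "(\<integral>x. lindblad_rhs N \<kappa> \<gamma> (square N (\<lambda>k l. q k l x)) $$ (i, j) \<partial>M)
    = lindblad_rhs N \<kappa> \<gamma> (square N (\<lambda>k l. \<integral>x. q k l x \<partial>M)) $$ (i, j)"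
proof -
  note sa = integral_spin_anti[of M q, OF q] and sc = integral_spin_com[of M q, OF q]
  have "(\<integral>x. spin_com N 1 (spin_anti N 1 (\<lambda>k l. q k l x)) i j \<partial>M)
      = spin_com N 1 (spin_anti N 1 (\<lambda>k l. \<integral>x. q k l x \<partial>M)) i j"
    "integrable M (\<lambda>x. spin_com N 1 (spin_anti N 1 (\<lambda>k l. q k l x)) i j)"
    using integral_spin_com[of M "\<lambda>k l x. spin_anti N 1 (\<lambda>k l. q k l x) k l", OF sa(2)] by (simp_all add: sa(1))
  moreover have "(\<integral>x. spin_com N \<mu> (spin_com N \<mu> (\<lambda>k l. q k l x)) i j \<partial>M)
      = spin_com N \<mu> (spin_com N \<mu> (\<lambda>k l. \<integral>x. q k l x \<partial>M)) i j"
    "integrable M (\<lambda>x. spin_com N \<mu> (spin_com N \<mu> (\<lambda>k l. q k l x)) i j)" for \<mu>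
    using integral_spin_com[of M "\<lambda>k l x. spin_com N \<mu> (\<lambda>k l. q k l x) k l", OF sc(2)] by (simp_all add: sc(1))
  ultimately show ?thesis
    unfolding lindblad_rhs_square[OF ij] by simp
qed

section \<open>The mixture of coherent states\<close>

text \<open>Measures on all of space that are carried by the sphere, so that smooth functions on
  space are integrated as they are. The passage to measures on the space \<open>unit_sphere\<close>
  is a restriction made at the end.\<close>

definition sphere_prob :: "(real^3) measure \<Rightarrow> bool" where
  "sphere_prob M \<longleftrightarrow> prob_space M \<and> sets M = sets borel \<and> (AE x in M. x \<in> sphere 0 1)"

lemma sphere_prob_integrable:
  fixes g :: "real^3 \<Rightarrow> real"
  assumes M: "sphere_prob M" and g: "continuous_on UNIV g"
  shows "integrable M g"
proof -
  interpret prob_space M using M by (simp add: sphere_prob_def)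
  have s: "sets M = sets borel" and ae: "AE x in M. x \<in> sphere 0 1" using M by (simp_all add: sphere_prob_def)
  have "bounded (g ` sphere 0 1)"
    by (intro compact_imp_bounded compact_continuous_image continuous_on_subset[OF g]) auto
  then obtain b where "\<forall>y\<in>g ` sphere 0 1. \<bar>y\<bar> \<le> b" by (auto simp: bounded_real)
  then have b: "\<bar>g x\<bar> \<le> b" if "x \<in> sphere 0 1" for x using that by blast
  show ?thesis
  proof (rule integrable_const_bound)
    show "AE x in M. norm (g x) \<le> b" using ae by eventually_elim (use b in auto)
    show "g \<in> borel_measurable M"
      using borel_measurable_continuous_onI[OF g] by (simp add: measurable_cong_sets[OF s refl])
  qed
qed

lemma complex_integrable_Re_Im:
  fixes f :: "'a \<Rightarrow> complex"
  assumes "integrable M (\<lambda>x. Re (f x))" "integrable M (\<lambda>x. Im (f x))"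
  shows "integrable M f"
proof -
  have "integrable M (\<lambda>x. complex_of_real (Re (f x)) + \<i> * complex_of_real (Im (f x)))"
    using assms by simp
  then show ?thesis by (simp flip: complex_eq)
qed

lemma sphere_prob_integrable_complex: "sphere_prob M \<Longrightarrow> csmooth q \<Longrightarrow> integrable M q"
  unfolding csmooth_def
  by (auto intro!: complex_integrable_Re_Im sphere_prob_integrable smooth_continuous)

lemma integral_restrict_sphere:
  fixes f :: "real^3 \<Rightarrow> 'a::{banach, second_countable_topology}"
  assumes M: "sphere_prob M" and f: "f \<in> borel_measurable borel"
  shows "(\<integral>x. f x \<partial>restrict_space M (sphere 0 1)) = (\<integral>x. f x \<partial>M)"
proof -
  have s[measurable_cong]: "sets M = sets borel" and ae: "AE x in M. x \<in> sphere 0 1"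
    using M by (simp_all add: sphere_prob_def)
  have sp: "space M = UNIV" using sets_eq_imp_space_eq[OF s] by simp
  have [measurable]: "sphere 0 1 \<in> sets (borel :: (real^3) measure)" by simp
  note f[measurable]
  have "(\<integral>x. f x \<partial>restrict_space M (sphere 0 1)) = (\<integral>x. indicator (sphere 0 1) x *\<^sub>R f x \<partial>M)"
    by (rule integral_restrict_space) (simp add: s sp)
  also have "\<dots> = (\<integral>x. f x \<partial>M)"
  proof (rule integral_cong_AE)
    show "AE x in M. indicator (sphere 0 1) x *\<^sub>R f x = f x" using ae by eventually_elim simp
  qed measurable
  finally show ?thesis .
qed

lemma positive_distribution_restrict:
  assumes "sphere_prob M"
  shows "positive_distribution (restrict_space M (sphere 0 1))"
proof -
  have s: "sets M = sets borel" and "prob_space M" using assms by (simp_all add: sphere_prob_def)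
  then have fm: "finite_measure M" by (simp add: prob_space_def)
  have "sphere 0 1 \<in> sets M" unfolding s by simp
  then have "finite_measure (restrict_space M (sphere 0 1))" by (rule finite_measure_restrict_space[OF fm])
  moreover have "sets (restrict_space M (sphere 0 1)) = sets unit_sphere"
    by (rule sets_restrict_space_cong[OF s])
  ultimately show ?thesis by (simp add: positive_distribution_def)
qed

lemma csmooth_borel_measurable: "csmooth q \<Longrightarrow> q \<in> borel_measurable borel"
  unfolding csmooth_def borel_measurable_complex_iff by (auto intro: smooth_borel_measurable)

lemma coherent_mixture_index:
  assumes M: "sphere_prob M" and ij: "i \<le> N" "j \<le> N"
  shows "coherent_mixture N (restrict_space M (sphere 0 1)) $$ (i, j) = (\<integral>x. coh N i j x \<partial>M)"
proof -
  have "(\<integral>x. coherent_proj N x $$ (i, j) \<partial>restrict_space M (sphere 0 1))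
      = (\<integral>x. coh N i j x \<partial>restrict_space M (sphere 0 1))"
    by (rule Bochner_Integration.integral_cong[OF refl])
      (use ij in \<open>auto simp: space_restrict_space coherent_proj_eq_coh\<close>)
  also have "\<dots> = (\<integral>x. coh N i j x \<partial>M)"
    by (rule integral_restrict_sphere[OF M csmooth_borel_measurable[OF csmooth_coh]])
  finally show ?thesis using ij by (simp add: coherent_mixture_def)
qed

text \<open>One segment between two kicks. The estimate is two-sided in time, so that it yields both the
  derivative at every time and the left limit at the end of the segment.\<close>

lemma segment_exists:
  assumes c: "\<bar>c\<bar> \<le> \<gamma>" and M: "sphere_prob M"
  shows "\<exists>\<mu>. \<mu> 0 = M \<and> (\<forall>t\<ge>0. sphere_prob (\<mu> t)) \<and>
    (\<forall>G. smooth G \<longrightarrow> (\<exists>K. \<forall>s\<ge>0. \<forall>t\<ge>0. \<bar>s - t\<bar> \<le> 1 \<longrightarrow>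
      \<bar>(\<integral>x. G x \<partial>\<mu> s) - (\<integral>x. G x \<partial>\<mu> t) - (s - t) * (\<integral>x. backward_generator \<gamma> c S G x \<partial>\<mu> t)\<bar> \<le> K * (s - t)\<^sup>2))"
proof -
  interpret random_walk "sphere 0 1" "{g. smooth g}" "backward_generator \<gamma> c S" 8
    "walk_step 4 (walk_direction \<gamma> c) (walk_drift c S)"
    by (rule random_walk_backward_generator[OF c])
  have pK: "prob_on_K = sphere_prob" by (simp add: fun_eq_iff prob_on_K_def sphere_prob_def)
  let ?B = "backward_generator \<gamma> c S"
  obtain \<mu> where \<mu>: "\<mu> 0 = M" "\<forall>t\<ge>0. sphere_prob (\<mu> t)"
    and est: "\<forall>g\<in>{g. smooth g}. \<exists>C. \<forall>s t. 0 \<le> s \<longrightarrow> s \<le> t \<longrightarrow>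
      \<bar>(\<integral>x. g x \<partial>\<mu> t) - (\<integral>x. g x \<partial>\<mu> s) - (t - s) * (\<integral>x. ?B g x \<partial>\<mu> s)\<bar> \<le> C * (t - s)\<^sup>2"
    using evolution_exists[unfolded pK, OF M] by blast
  have "\<exists>K. \<forall>s\<ge>0. \<forall>t\<ge>0. \<bar>s - t\<bar> \<le> 1 \<longrightarrow>
      \<bar>(\<integral>x. G x \<partial>\<mu> s) - (\<integral>x. G x \<partial>\<mu> t) - (s - t) * (\<integral>x. ?B G x \<partial>\<mu> t)\<bar> \<le> K * (s - t)\<^sup>2"
    if G: "smooth G" for G
  proof -
    define f where "f t = (\<integral>x. G x \<partial>\<mu> t)" for t
    define f' where "f' t = (\<integral>x. ?B G x \<partial>\<mu> t)" for t
    define f'' where "f'' t = (\<integral>x. ?B (?B G) x \<partial>\<mu> t)" for t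
    note BG = smooth_backward_generator[OF G, of \<gamma> c S]
    note BBG = smooth_backward_generator[OF BG, of \<gamma> c S]
    obtain C where C: "\<And>s t. 0 \<le> s \<Longrightarrow> s \<le> t \<Longrightarrow> \<bar>f t - f s - (t - s) * f' s\<bar> \<le> C * (t - s)\<^sup>2"
      using est G unfolding f_def f'_def by blast
    obtain C' where C': "\<And>s t. 0 \<le> s \<Longrightarrow> s \<le> t \<Longrightarrow> \<bar>f' t - f' s - (t - s) * f'' s\<bar> \<le> C' * (t - s)\<^sup>2"
      using est BG unfolding f'_def f''_def by blast
    obtain b where b: "b \<ge> 0" "\<And>x. x \<in> sphere 0 1 \<Longrightarrow> \<bar>?B (?B G) x\<bar> \<le> b"
      using smooth_bounded[OF BBG compact_sphere] by blast
    have f''b: "\<bar>f'' t\<bar> \<le> b" if "t \<ge> 0" for t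
      unfolding f''_def using \<mu>(2) that b(2)
      by (intro abs_integral_on_K(1)[unfolded pK]) (auto intro: smooth_borel_measurable[OF BBG])
    \<comment> \<open>The available estimate uses the derivative at the earlier time. A Lipschitz
      bound on \<open>f'\<close>, from the same estimate applied to the generator of
      \<open>G\<close>, moves it to the later time at quadratic cost.\<close>
    have lip: "\<bar>f' t - f' s\<bar> \<le> (\<bar>C'\<bar> + b) * (t - s)" if st: "0 \<le> s" "s \<le> t" "t - s \<le> 1" for s t
    proof -
      have "C' * (t - s)\<^sup>2 \<le> \<bar>C'\<bar> * (t - s)\<^sup>2" by (intro mult_right_mono) auto
      also have "\<dots> \<le> \<bar>C'\<bar> * (t - s)"
        using st mult_left_le[of "t - s" "t - s"] by (intro mult_left_mono) (auto simp: power2_eq_square)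
      finally have "\<bar>f' t - f' s - (t - s) * f'' s\<bar> \<le> \<bar>C'\<bar> * (t - s)" using C'[OF st(1,2)] by simp
      moreover have "\<bar>(t - s) * f'' s\<bar> \<le> b * (t - s)"
        using f''b[OF st(1)] st by (simp add: abs_mult mult.commute mult_right_mono)
      ultimately show ?thesis unfolding distrib_right by arith
    qed
    have "\<bar>f s - f t - (s - t) * f' t\<bar> \<le> (\<bar>C\<bar> + (\<bar>C'\<bar> + b)) * (s - t)\<^sup>2"
      if st: "0 \<le> s" "0 \<le> t" "\<bar>s - t\<bar> \<le> 1" for s t
    proof (cases "t \<le> s")
      case True
      have "C * (s - t)\<^sup>2 \<le> (\<bar>C\<bar> + (\<bar>C'\<bar> + b)) * (s - t)\<^sup>2" using b(1) by (intro mult_right_mono) auto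
      then show ?thesis using C[OF st(2) True] by simp
    next
      case False
      then have le: "s \<le> t" "t - s \<le> 1" using st by auto
      have 1: "\<bar>(t - s) * (f' t - f' s)\<bar> \<le> (\<bar>C'\<bar> + b) * (t - s)\<^sup>2"
        using mult_left_mono[OF lip[OF st(1) le], of "t - s"] le
        by (simp add: abs_mult power2_eq_square mult_ac)
      have 2: "C * (t - s)\<^sup>2 \<le> \<bar>C\<bar> * (t - s)\<^sup>2" by (intro mult_right_mono) auto
      have "f s - f t - (s - t) * f' t = (t - s) * (f' t - f' s) - (f t - f s - (t - s) * f' s)"
        by (simp add: algebra_simps)
      then have "\<bar>f s - f t - (s - t) * f' t\<bar> \<le> \<bar>(t - s) * (f' t - f' s)\<bar> + \<bar>f t - f s - (t - s) * f' s\<bar>"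
        using abs_triangle_ineq4[of "(t - s) * (f' t - f' s)" "f t - f s - (t - s) * f' s"] by simp
      also have "\<dots> \<le> (\<bar>C'\<bar> + b) * (t - s)\<^sup>2 + \<bar>C\<bar> * (t - s)\<^sup>2"
        by (rule add_mono[OF 1 order_trans[OF C[OF st(1) le(1)] 2]])
      finally show ?thesis by (simp add: power2_commute[of s t] algebra_simps)
    qed
    then show ?thesis unfolding f_def f'_def by blast
  qed
  with \<mu> show ?thesis by (intro exI[of _ \<mu>]) simp
qed

lemma sphere_prob_distr_axis_rotate:
  assumes M: "sphere_prob M"
  shows "sphere_prob (distr M borel (axis_rotate \<mu> s))"
    and "g \<in> borel_measurable borel \<Longrightarrow>
      (\<integral>x. (g x :: 'a::{banach, second_countable_topology}) \<partial>distr M borel (axis_rotate \<mu> s)) = (\<integral>x. g (axis_rotate \<mu> s x) \<partial>M)"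
proof -
  interpret prob_space M using M by (simp add: sphere_prob_def)
  have st: "sets M = sets borel" and ae: "AE x in M. x \<in> sphere 0 1" using M by (simp_all add: sphere_prob_def)
  have m: "axis_rotate \<mu> s \<in> borel_measurable borel"
    by (intro borel_measurable_continuous_onI linear_continuous_on bounded_linear_axis_rotate)
  then have mM: "axis_rotate \<mu> s \<in> borel_measurable M" by (simp add: measurable_cong_sets[OF st refl])
  have "AE x in distr M borel (axis_rotate \<mu> s). x \<in> sphere 0 1"
    by (subst AE_distr_iff[OF mM]) (use ae in \<open>auto simp: norm_axis_rotate\<close>)
  then show "sphere_prob (distr M borel (axis_rotate \<mu> s))"
    by (simp add: sphere_prob_def prob_space_distr[OF mM])
  show "(\<integral>x. (g x :: 'a::{banach, second_countable_topology}) \<partial>distr M borel (axis_rotate \<mu> s)) = (\<integral>x. g (axis_rotate \<mu> s x) \<partial>M)"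
    if "g \<in> borel_measurable borel" by (rule integral_distr[OF mM that])
qed

text \<open>\<open>\<mu> n t\<close> is the state at the local time \<open>t\<close> since the
  integer time \<open>n\<close>. Each segment is continued beyond its end and so contains the local
  time 1, the state just before the next kick.\<close>

lemma kicked_segments_exist:
  assumes c: "\<bar>c\<bar> \<le> \<gamma>" and M: "sphere_prob M"
  shows "\<exists>\<mu>. \<mu> 0 0 = M \<and> (\<forall>n. \<mu> (Suc n) 0 = distr (\<mu> n 1) borel (axis_rotate 3 p)) \<and>
    (\<forall>n::nat. \<forall>t\<ge>0. sphere_prob (\<mu> n t)) \<and>
    (\<forall>n G. smooth G \<longrightarrow> (\<exists>K. \<forall>s\<ge>0. \<forall>t\<ge>0. \<bar>s - t\<bar> \<le> 1 \<longrightarrow>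
      \<bar>(\<integral>x. G x \<partial>\<mu> n s) - (\<integral>x. G x \<partial>\<mu> n t) - (s - t) * (\<integral>x. backward_generator \<gamma> c S G x \<partial>\<mu> n t)\<bar> \<le> K * (s - t)\<^sup>2))"
proof -
  \<comment> \<open>A segment is fixed by choice for every initial measure, which turns the passage
    through the kicks into a primitive recursion on measures.\<close>
  have "\<forall>M. \<exists>\<mu>. sphere_prob M \<longrightarrow> \<mu> 0 = M \<and> (\<forall>t\<ge>0. sphere_prob (\<mu> t)) \<and>
    (\<forall>G. smooth G \<longrightarrow> (\<exists>K. \<forall>s\<ge>0. \<forall>t\<ge>0. \<bar>s - t\<bar> \<le> 1 \<longrightarrow>
      \<bar>(\<integral>x. G x \<partial>\<mu> s) - (\<integral>x. G x \<partial>\<mu> t) - (s - t) * (\<integral>x. backward_generator \<gamma> c S G x \<partial>\<mu> t)\<bar> \<le> K * (s - t)\<^sup>2))"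
    using segment_exists[OF c] by blast
  from choice[OF this] obtain evo where evo: "\<forall>M. sphere_prob M \<longrightarrow> evo M (0::real) = M \<and> (\<forall>t\<ge>0. sphere_prob (evo M t)) \<and>
    (\<forall>G. smooth G \<longrightarrow> (\<exists>K. \<forall>s\<ge>0. \<forall>t\<ge>0. \<bar>s - t\<bar> \<le> 1 \<longrightarrow>
      \<bar>(\<integral>x. G x \<partial>evo M s) - (\<integral>x. G x \<partial>evo M t) - (s - t) * (\<integral>x. backward_generator \<gamma> c S G x \<partial>evo M t)\<bar> \<le> K * (s - t)\<^sup>2))"
    by blast
  define init where "init n = rec_nat M (\<lambda>_ M. distr (evo M 1) borel (axis_rotate 3 p)) n" for n
  have init: "init 0 = M" "init (Suc n) = distr (evo (init n) 1) borel (axis_rotate 3 p)" for n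
    by (simp_all add: init_def)
  have sp: "sphere_prob (init n)" for n
  proof (induction n)
    case (Suc n)
    then have "sphere_prob (evo (init n) 1)" using evo by simp
    then show ?case unfolding init by (rule sphere_prob_distr_axis_rotate)
  qed (simp add: init M)
  have z: "evo (init n) 0 = init n" for n using evo sp by blast
  show ?thesis
    using evo sp z[of 0] z[of "Suc _"] unfolding init
    by (intro exI[of _ "\<lambda>n. evo (init n)"]) (simp add: init)
qed

section \<open>The Fokker--Planck equation\<close>

text \<open>The twist coefficients of the diffusion divided by \<gamma>, rewritten on the sphere of
  radius S, where \<Omega> is x / S. Both orders of two fields carry the same entry, so the
  dissipator stays symmetric. For \<gamma> = 0 division by zero yields 0.\<close>

definition relative_error :: "nat \<Rightarrow> real \<Rightarrow> real \<Rightarrow> 3 \<Rightarrow> 3 \<Rightarrow> real^3 \<Rightarrow> real" where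
  "relative_error N \<kappa> \<gamma> \<mu> \<nu> x =
    (if (\<mu> = 1 \<and> \<nu> = 3) \<or> (\<mu> = 3 \<and> \<nu> = 1) then - (\<kappa> / (2 * spin N + 1) / \<gamma> / spin N) * x $ 2
     else if (\<mu> = 1 \<and> \<nu> = 2) \<or> (\<mu> = 2 \<and> \<nu> = 1) then (\<kappa> / (2 * spin N + 1) / \<gamma> / spin N) * x $ 3
     else 0)"

lemma smooth_relative_error: "smooth (relative_error N \<kappa> \<gamma> \<mu> \<nu>)"
  unfolding relative_error_def[abs_def]
  by (cases "(\<mu> = 1 \<and> \<nu> = 3) \<or> (\<mu> = 3 \<and> \<nu> = 1)"; cases "(\<mu> = 1 \<and> \<nu> = 2) \<or> (\<mu> = 2 \<and> \<nu> = 1)")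
    (simp_all only: if_True if_False, (intro smooth_mult smooth_const smooth_coord)+)

lemma relative_error_bound:
  assumes N: "N \<ge> 1" and \<gamma>: "\<gamma> \<ge> 0" and x: "x \<in> sphere 0 (spin N)"
  shows "\<bar>relative_error N \<kappa> \<gamma> \<mu> \<nu> x\<bar> \<le> gamma_star N \<kappa> / \<gamma>"
proof -
  have S: "spin N > 0" using N by (simp add: spin_def)
  have g: "gamma_star N \<kappa> / \<gamma> = \<bar>\<kappa> / (2 * spin N + 1) / \<gamma>\<bar>"
    using S \<gamma> by (simp add: gamma_star_def abs_divide)
  have "\<bar>\<kappa> / (2 * spin N + 1) / \<gamma> / spin N * x $ i\<bar> \<le> gamma_star N \<kappa> / \<gamma>" for i
  proof -
    have "\<bar>x $ i\<bar> \<le> spin N" using component_le_norm_cart[of x i] x by simp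
    then have "\<bar>x $ i\<bar> / spin N \<le> 1" using S by simp
    then have "\<bar>\<kappa> / (2 * spin N + 1) / \<gamma>\<bar> * (\<bar>x $ i\<bar> / spin N) \<le> \<bar>\<kappa> / (2 * spin N + 1) / \<gamma>\<bar> * 1"
      by (intro mult_left_mono) auto
    then show ?thesis using S unfolding g by (simp add: abs_mult abs_divide)
  qed
  moreover have "0 \<le> gamma_star N \<kappa> / \<gamma>" unfolding g by simp
  ultimately show ?thesis by (auto simp: relative_error_def)
qed

text \<open>At the point S x the classical twist is \<kappa> x_1 rot_1 = (2 S + 1) c x_1 rot_1, so
  the factor 1 + 3 / 2 / (2 S + 1) gives exactly the coefficient (2 S + 5 / 2) c.\<close>

lemma fp_rhs_forward:
  assumes N: "N \<ge> 1" and \<gamma>: "\<gamma> \<ge> gamma_star N \<kappa>" and f: "smooth f"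
  shows "fp_rhs N \<kappa> \<gamma> (3 / 2 / (2 * spin N + 1)) (relative_error N \<kappa> \<gamma>) f (spin N *\<^sub>R x)
    = forward_generator \<gamma> (\<kappa> / (2 * spin N + 1)) (spin N) (\<lambda>y. f (spin N *\<^sub>R y)) x"
proof -
  let ?S = "spin N"
  define c where "c = \<kappa> / (2 * ?S + 1)"
  have S: "?S > 0" using N by (simp add: spin_def)
  \<comment> \<open>\<gamma> = 0 forces \<kappa> = 0 through the threshold, so the quotient by
    \<gamma> in the error does no harm.\<close>
  have c0: "\<gamma> \<noteq> 0 \<or> c = 0" using \<gamma> S by (auto simp: gamma_star_def c_def divide_le_0_iff)
  then have gc: "\<gamma> * (c / \<gamma> / ?S * (?S * y)) = c * y" for y using S by auto
  define F where "F y = f (?S *\<^sub>R y)" for y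
  have r: "rot \<mu> f (?S *\<^sub>R x) = rot \<mu> F x" for \<mu>
    unfolding F_def by (rule rot_scale[OF f])
  have rr: "rot \<mu> (rot \<nu> f) (?S *\<^sub>R x) = rot \<mu> (rot \<nu> F) x" for \<mu> \<nu>
    unfolding rot_scale[OF smooth_rot[OF f]] F_def by (simp add: rot_scale[OF f])
  have H: "(1 + 3 / 2 / (2 * ?S + 1)) * poisson (H_twist N \<kappa>) f (?S *\<^sub>R x)
      = (2 * ?S + 5 / 2) * c * (x $ 1 * rot 1 F x)"
    unfolding poisson_H_twist[OF N] r c_def using S by (simp add: field_simps)
  have E: "\<gamma> * relative_error N \<kappa> \<gamma> \<mu> \<nu> (?S *\<^sub>R x) =
    (if (\<mu> = 1 \<and> \<nu> = 3) \<or> (\<mu> = 3 \<and> \<nu> = 1) then - (c * x $ 2)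
     else if (\<mu> = 1 \<and> \<nu> = 2) \<or> (\<mu> = 2 \<and> \<nu> = 1) then c * x $ 3 else 0)" for \<mu> \<nu>
    using gc[of "x $ 2"] gc[of "x $ 3"] by (simp add: relative_error_def c_def)
  have "\<gamma> / 2 * (\<Sum>\<mu>\<in>UNIV. \<Sum>\<nu>\<in>UNIV. ((if \<mu> = \<nu> then 1 else 0) + relative_error N \<kappa> \<gamma> \<mu> \<nu> (?S *\<^sub>R x))
         * rot \<mu> (rot \<nu> f) (?S *\<^sub>R x))
     = (\<Sum>\<mu>\<in>UNIV. \<Sum>\<nu>\<in>UNIV. (\<gamma> * (if \<mu> = \<nu> then 1 else 0) + \<gamma> * relative_error N \<kappa> \<gamma> \<mu> \<nu> (?S *\<^sub>R x)) / 2
         * rot \<mu> (rot \<nu> F) x)"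
    unfolding rr sum_distrib_left by (intro sum.cong refl) (simp add: algebra_simps)
  also have "\<dots> = twist_diffusion \<gamma> c F x"
    unfolding E twist_diffusion_def by (simp add: sum_3 algebra_simps add_divide_distrib diff_divide_distrib)
  finally show ?thesis
    unfolding fp_rhs_def H forward_generator_def F_def[symmetric] c_def[symmetric] by simp
qed

definition fp_adjoint :: "nat \<Rightarrow> real \<Rightarrow> real \<Rightarrow> (real^3 \<Rightarrow> real) \<Rightarrow> real^3 \<Rightarrow> real" where
  "fp_adjoint N \<kappa> \<gamma> g x =
    backward_generator \<gamma> (\<kappa> / (2 * spin N + 1)) (spin N) (\<lambda>y. g (spin N *\<^sub>R y)) ((1 / spin N) *\<^sub>R x)"

lemma fp_adjoint_scale:
  "N \<ge> 1 \<Longrightarrow> fp_adjoint N \<kappa> \<gamma> g (spin N *\<^sub>R x)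
    = backward_generator \<gamma> (\<kappa> / (2 * spin N + 1)) (spin N) (\<lambda>y. g (spin N *\<^sub>R y)) x"
  by (simp add: fp_adjoint_def spin_def)

lemma formal_adjoint_fp:
  assumes N: "N \<ge> 1" and \<gamma>: "\<gamma> \<ge> gamma_star N \<kappa>"
  shows "formal_adjoint N (fp_rhs N \<kappa> \<gamma> (3 / 2 / (2 * spin N + 1)) (relative_error N \<kappa> \<gamma>)) (fp_adjoint N \<kappa> \<gamma>)"
  unfolding formal_adjoint_def
proof (intro allI impI conjI)
  fix g :: "real^3 \<Rightarrow> real" assume g: "smooth g"
  show "continuous_on (sphere 0 (spin N)) (fp_adjoint N \<kappa> \<gamma> g)"
    unfolding fp_adjoint_def[abs_def]
    by (intro smooth_continuous smooth_scale smooth_backward_generator g)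
  fix f :: "real^3 \<Rightarrow> real" assume f: "smooth f"
  show "(\<integral>\<Omega>. fp_rhs N \<kappa> \<gamma> (3 / 2 / (2 * spin N + 1)) (relative_error N \<kappa> \<gamma>) f (spin N *\<^sub>R \<Omega>) * g (spin N *\<^sub>R \<Omega>) \<partial>dOmega N)
      = (\<integral>\<Omega>. f (spin N *\<^sub>R \<Omega>) * fp_adjoint N \<kappa> \<gamma> g (spin N *\<^sub>R \<Omega>) \<partial>dOmega N)"
    unfolding fp_rhs_forward[OF N \<gamma> f] fp_adjoint_scale[OF N]
    by (rule forward_backward_adjoint[OF smooth_scale[OF f] smooth_scale[OF g]])
qed

text \<open>The measures are built without reference to \<open>\<rho>\<close>. Their mixture
  \<open>J\<close> obeys the Lindblad equation on every segment and undergoes the same kicks, so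
  uniqueness on each segment identifies it with \<open>\<rho>\<close>.\<close>

lemma kicked_evolution:
  assumes N: "N \<ge> 1" and \<gamma>: "\<gamma> \<ge> gamma_star N \<kappa>" and \<Omega>\<^sub>0: "\<Omega>\<^sub>0 \<in> sphere 0 1"
    and \<rho>: "lindblad_solution N \<kappa> p \<gamma> \<rho>" "\<rho> 0 = coherent_proj N \<Omega>\<^sub>0"
  shows "\<exists>P :: real \<Rightarrow> (real^3) measure.
    (\<forall>t\<ge>0. positive_distribution (P t) \<and> \<rho> t = coherent_mixture N (P t)) \<and>
    P 0 = return unit_sphere \<Omega>\<^sub>0 \<and>
    weak_solution N (fp_rhs N \<kappa> \<gamma> (3 / 2 / (2 * spin N + 1)) (relative_error N \<kappa> \<gamma>)) (H_kick p) P"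
proof -
  let ?c = "\<kappa> / (2 * spin N + 1)" and ?S = "spin N"
  let ?B = "backward_generator \<gamma> ?c ?S"
  have S: "?S > 0" using N by (simp add: spin_def)
  have c: "\<bar>?c\<bar> \<le> \<gamma>" using \<gamma> S by (simp add: gamma_star_def abs_divide)
  have sp0: "sphere_prob (return borel \<Omega>\<^sub>0)"
    using \<Omega>\<^sub>0 prob_space_return[of \<Omega>\<^sub>0 borel]
    by (simp add: sphere_prob_def AE_return pred_def)
  obtain \<mu> where \<mu>0: "\<mu> 0 0 = return borel \<Omega>\<^sub>0"
    and \<mu>Suc: "\<And>n. \<mu> (Suc n) 0 = distr (\<mu> n 1) borel (axis_rotate 3 p)"
    and sp: "\<And>n t. t \<ge> 0 \<Longrightarrow> sphere_prob (\<mu> n t)"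
    and est: "\<And>n G. smooth G \<Longrightarrow> \<exists>K. \<forall>s\<ge>0. \<forall>t\<ge>0. \<bar>s - t\<bar> \<le> 1 \<longrightarrow>
      \<bar>(\<integral>x. G x \<partial>\<mu> n s) - (\<integral>x. G x \<partial>\<mu> n t) - (s - t) * (\<integral>x. ?B G x \<partial>\<mu> n t)\<bar> \<le> K * (s - t)\<^sup>2"
    using kicked_segments_exist[OF c sp0, of p ?S] by (elim exE conjE) (simp del: split_paired_All)
  \<comment> \<open>The segments are glued right-continuously, in accordance with
    \<open>lindblad_solution\<close>: at an integer time the floor already selects the new segment,
    after the kick.\<close>
  define Q where "Q t = \<mu> (nat \<lfloor>t\<rfloor>) (t - real (nat \<lfloor>t\<rfloor>))" for t
  define P where "P t = restrict_space (Q t) (sphere 0 1)" for t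
  have fl: "nat \<lfloor>t\<rfloor> = n" if "t \<in> {real n..<real n + 1}" for t n
    using that by (simp add: nat_eq_iff floor_eq_iff)
  have Qn: "Q t = \<mu> n (t - real n)" if "t \<in> {real n..<real n + 1}" for t n
    unfolding Q_def fl[OF that] ..
  have spQ: "sphere_prob (Q t)" if "t \<ge> 0" for t
    unfolding Q_def by (rule sp) (use that in linarith)
  have P_int: "(\<integral>x. g x \<partial>P t) = (\<integral>x. g x \<partial>Q t)" if "t \<ge> 0" "smooth g" for g t
    unfolding P_def by (rule integral_restrict_sphere[OF spQ[OF that(1)] smooth_borel_measurable[OF that(2)]])
  have deriv_Q: "((\<lambda>s. \<integral>x. G x \<partial>Q s) has_real_derivative (\<integral>x. ?B G x \<partial>Q t)) (at t within {real n..<real n + 1})"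
    if G: "smooth G" and t: "t \<in> {real n..<real n + 1}" for G n t
  proof -
    obtain K where K: "\<And>s t. s \<ge> 0 \<Longrightarrow> t \<ge> 0 \<Longrightarrow> \<bar>s - t\<bar> \<le> 1 \<Longrightarrow>
      \<bar>(\<integral>x. G x \<partial>\<mu> n s) - (\<integral>x. G x \<partial>\<mu> n t) - (s - t) * (\<integral>x. ?B G x \<partial>\<mu> n t)\<bar> \<le> K * (s - t)\<^sup>2"
      using est[OF G, of n] by blast
    show ?thesis
    proof (rule quadratic_imp_derivative[where K = K])
      fix s assume s: "s \<in> {real n..<real n + 1}" "\<bar>s - t\<bar> \<le> 1"
      show "\<bar>(\<integral>x. G x \<partial>Q s) - (\<integral>x. G x \<partial>Q t) - (s - t) * (\<integral>x. ?B G x \<partial>Q t)\<bar> \<le> K * (s - t)\<^sup>2"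
        unfolding Qn[OF t] Qn[OF s(1)] using K[of "s - real n" "t - real n"] s t by simp
    qed
  qed
  have left_Q: "((\<lambda>s. \<integral>x. G x \<partial>Q s) \<longlongrightarrow> (\<integral>x. G x \<partial>\<mu> n 1)) (at_left (real (Suc n)))"
    if G: "smooth G" for G n
  proof -
    obtain K where K: "\<And>s t. s \<ge> 0 \<Longrightarrow> t \<ge> 0 \<Longrightarrow> \<bar>s - t\<bar> \<le> 1 \<Longrightarrow>
      \<bar>(\<integral>x. G x \<partial>\<mu> n s) - (\<integral>x. G x \<partial>\<mu> n t) - (s - t) * (\<integral>x. ?B G x \<partial>\<mu> n t)\<bar> \<le> K * (s - t)\<^sup>2"
      using est[OF G, of n] by blast
    \<comment> \<open>Segment \<open>n\<close> including its right end. It agrees with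
      \<open>Q\<close> before the kick but not necessarily at it, so the left limit is read off from
      this continuation.\<close>
    let ?h = "\<lambda>s. \<integral>x. G x \<partial>\<mu> n (s - real n)"
    have "(?h has_real_derivative (\<integral>x. ?B G x \<partial>\<mu> n 1)) (at (real (Suc n)) within {real n..})"
    proof (rule quadratic_imp_derivative[where K = K])
      fix s assume "s \<in> {real n..}" "\<bar>s - real (Suc n)\<bar> \<le> 1"
      then show "\<bar>?h s - ?h (real (Suc n)) - (s - real (Suc n)) * (\<integral>x. ?B G x \<partial>\<mu> n 1)\<bar> \<le> K * (s - real (Suc n))\<^sup>2"
        using K[of "s - real n" 1] by (simp add: algebra_simps)
    qed
    then have "(?h \<longlongrightarrow> ?h (real (Suc n))) (at (real (Suc n)) within {real n..})"
      by (intro has_field_derivative_imp_has_derivative[THEN has_derivative_continuous, unfolded continuous_within])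
    then have "(?h \<longlongrightarrow> ?h (real (Suc n))) (at (real (Suc n)) within {real n..real (Suc n)})"
      by (rule tendsto_within_subset) auto
    then have "(?h \<longlongrightarrow> (\<integral>x. G x \<partial>\<mu> n 1)) (at_left (real (Suc n)))"
      using at_within_Icc_at_left[of "real n" "real (Suc n)"] by simp
    moreover have "\<forall>\<^sub>F s in at_left (real (Suc n)). ?h s = (\<integral>x. G x \<partial>Q s)"
      using eventually_at_left_real[of "real n" "real (Suc n)"]
      by (auto elim!: eventually_mono simp: Qn[of _ n])
    ultimately show ?thesis by (rule Lim_transform_eventually)
  qed
  have weak: "weak_solution N (fp_rhs N \<kappa> \<gamma> (3 / 2 / (2 * spin N + 1)) (relative_error N \<kappa> \<gamma>)) (H_kick p) P"
    unfolding weak_solution_def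
  proof (intro conjI exI[of _ "fp_adjoint N \<kappa> \<gamma>"] allI impI ballI)
    show "formal_adjoint N (fp_rhs N \<kappa> \<gamma> (3 / 2 / (2 * spin N + 1)) (relative_error N \<kappa> \<gamma>)) (fp_adjoint N \<kappa> \<gamma>)"
      by (rule formal_adjoint_fp[OF N \<gamma>])
  next
    fix g :: "real^3 \<Rightarrow> real" and n :: nat and t :: real
    assume g: "smooth g" and t: "t \<in> {real n..<real n + 1}"
    have t0: "s \<ge> 0" if "s \<in> {real n..<real n + 1}" for s using that by (auto intro: order_trans[of 0 "real n"])
    have "((\<lambda>s. \<integral>\<Omega>. g (?S *\<^sub>R \<Omega>) \<partial>Q s) has_real_derivative (\<integral>\<Omega>. fp_adjoint N \<kappa> \<gamma> g (?S *\<^sub>R \<Omega>) \<partial>P t))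
        (at t within {real n..<real n + 1})"
      unfolding fp_adjoint_scale[OF N] P_int[OF t0[OF t] smooth_backward_generator[OF smooth_scale[OF g]]]
      by (rule deriv_Q[OF smooth_scale[OF g] t])
    then show "((\<lambda>s. \<integral>\<Omega>. g (?S *\<^sub>R \<Omega>) \<partial>P s) has_real_derivative (\<integral>\<Omega>. fp_adjoint N \<kappa> \<gamma> g (?S *\<^sub>R \<Omega>) \<partial>P t))
        (at t within {real n..<real n + 1})"
      by (rule has_field_derivative_transform_within[where d = 1])
        (use t P_int[OF t0 smooth_scale[OF g]] in simp_all)
  next
    fix g :: "real^3 \<Rightarrow> real" and n :: nat
    assume g: "smooth g" and "n \<ge> 1"
    then obtain m where n: "n = Suc m" by (cases n) auto
    \<comment> \<open>The flow commutes with the dilation, so testing the kick on the sphere of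
      radius S means testing with a rotated function on the unit sphere.\<close>
    let ?G = "\<lambda>x. g (?S *\<^sub>R axis_rotate 3 p x)"
    have G: "smooth ?G" by (rule smooth_linear_comp[OF bounded_linear_axis_rotate smooth_scale[OF g]])
    have flow: "time_one_flow (H_kick p) (?S *\<^sub>R x) = ?S *\<^sub>R axis_rotate 3 p x" for x
      unfolding time_one_flow_kick using linear_cmul[OF bounded_linear.linear[OF bounded_linear_axis_rotate]] .
    have "Q (real n) = distr (\<mu> m 1) borel (axis_rotate 3 p)"
      using Qn[of "real n" n] by (simp add: n \<mu>Suc)
    then have "(\<integral>x. g (?S *\<^sub>R x) \<partial>P (real n)) = (\<integral>x. ?G x \<partial>\<mu> m 1)"
      using P_int[OF _ smooth_scale[OF g], of "real n"]
        sphere_prob_distr_axis_rotate(2)[OF sp[of 1 m] smooth_borel_measurable[OF smooth_scale[OF g, of ?S]], of 3 p]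
      by simp
    moreover have "((\<lambda>s. \<integral>x. ?G x \<partial>P s) \<longlongrightarrow> (\<integral>x. ?G x \<partial>\<mu> m 1)) (at_left (real n))"
      using left_Q[OF G, of m] unfolding n
    proof (rule Lim_transform_eventually)
      show "\<forall>\<^sub>F s in at_left (real (Suc m)). (\<integral>x. ?G x \<partial>Q s) = (\<integral>x. ?G x \<partial>P s)"
        using eventually_at_left_real[of "real m" "real (Suc m)"]
        by (auto elim!: eventually_mono simp: P_int[OF _ G])
    qed
    ultimately show "((\<lambda>s. \<integral>\<Omega>. g (time_one_flow (H_kick p) (?S *\<^sub>R \<Omega>)) \<partial>P s) \<longlongrightarrow>
         (\<integral>\<Omega>. g (?S *\<^sub>R \<Omega>) \<partial>P (real n))) (at_left (real n))"
      unfolding flow by simp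
  qed
  have P0: "P 0 = return unit_sphere \<Omega>\<^sub>0"
  proof -
    have "Q 0 = return borel \<Omega>\<^sub>0" using Qn[of 0 0] \<mu>0 by simp
    then have "P 0 = restrict_space (return borel \<Omega>\<^sub>0) (sphere 0 1)" by (simp add: P_def)
    also have "\<dots> = return unit_sphere \<Omega>\<^sub>0"
    proof (rule measure_eqI)
      show s: "sets (restrict_space (return borel \<Omega>\<^sub>0) (sphere 0 1)) = sets (return unit_sphere \<Omega>\<^sub>0)"
        by (simp add: sets_restrict_space)
      fix A assume "A \<in> sets (restrict_space (return borel \<Omega>\<^sub>0) (sphere 0 1))"
      then have A: "A \<in> sets unit_sphere" unfolding s by simp
      then have "A \<subseteq> sphere 0 1" "A \<in> sets borel" by (auto simp: sets_restrict_space)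
      then show "emeasure (restrict_space (return borel \<Omega>\<^sub>0) (sphere 0 1)) A = emeasure (return unit_sphere \<Omega>\<^sub>0) A"
        using A by (subst emeasure_restrict_space) auto
    qed
    finally show ?thesis .
  qed
  \<comment> \<open>Entries of the mixture. With the smooth symbol \<open>coh\<close> in place of
    the projector they are integrals of test functions, to which the evolution of \<open>Q\<close>
    applies.\<close>
  define J where "J t i j = (\<integral>x. coh N i j x \<partial>Q t)" for t i j
  have J_deriv: "((\<lambda>s. J s i j) has_vector_derivative lindblad_rhs N \<kappa> \<gamma> (square N (J t)) $$ (i, j))
      (at t within {real n..<real n + 1})"
    if t: "t \<in> {real n..<real n + 1}" and ij: "i \<le> N" "j \<le> N" for t n i j
  proof -
    have t0: "t \<ge> 0" using t by (auto intro: order_trans[of 0 "real n"])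
    note csm = csmooth_coh[of N i j, unfolded csmooth_def]
    have i: "integrable (Q s) (coh N i j)" if "s \<ge> 0" for s i j
      by (rule sphere_prob_integrable_complex[OF spQ[OF that] csmooth_coh])
    have bi: "integrable (Q t) (?B (\<lambda>x. Re (coh N i j x)))" "integrable (Q t) (?B (\<lambda>x. Im (coh N i j x)))"
      using csm by (auto intro!: sphere_prob_integrable[OF spQ[OF t0]] smooth_continuous smooth_backward_generator)
    define d where "d = Complex (\<integral>x. ?B (\<lambda>x. Re (coh N i j x)) x \<partial>Q t) (\<integral>x. ?B (\<lambda>x. Im (coh N i j x)) x \<partial>Q t)"
    have cd: "((\<lambda>s. Complex (\<integral>x. Re (coh N i j x) \<partial>Q s) (\<integral>x. Im (coh N i j x) \<partial>Q s)) has_vector_derivative d)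
        (at t within {real n..<real n + 1})"
      unfolding has_vector_derivative_complex_iff d_def
      using deriv_Q[OF csm[THEN conjunct1] t] deriv_Q[OF csm[THEN conjunct2] t]
      by (simp add: has_real_derivative_iff_has_vector_derivative)
    have J_eq: "J s i j = Complex (\<integral>x. Re (coh N i j x) \<partial>Q s) (\<integral>x. Im (coh N i j x) \<partial>Q s)"
      if "s \<in> {real n..<real n + 1}" for s
    proof -
      have "s \<ge> 0" using that by (auto intro: order_trans[of 0 "real n"])
      then show ?thesis using i[of s i j] by (simp add: J_def complex_eq_iff)
    qed
    have D: "((\<lambda>s. J s i j) has_vector_derivative d) (at t within {real n..<real n + 1})"
      by (rule has_vector_derivative_transform[OF t J_eq cd])
    have ci: "integrable (Q t) (cbackward \<gamma> ?c ?S (coh N i j))"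
      by (rule complex_integrable_Re_Im) (use bi in \<open>simp_all add: cbackward_def\<close>)
    have "d = integral\<^sup>L (Q t) (cbackward \<gamma> ?c ?S (coh N i j))"
      using integral_Re[OF ci] integral_Im[OF ci] unfolding d_def complex_eq_iff
      by (simp add: cbackward_def del: integral_Re integral_Im)
    \<comment> \<open>The identity of \<open>cbackward_coh\<close> holds on the sphere, which
      carries the measure; afterwards linearity takes the Lindblad generator out of the
      integral.\<close>
    also have "\<dots> = (\<integral>x. lindblad_rhs N \<kappa> \<gamma> (square N (\<lambda>k l. coh N k l x)) $$ (i, j) \<partial>Q t)"
    proof (rule integral_cong_AE)
      have ae: "AE x in Q t. x \<in> sphere 0 1" using spQ[OF t0] by (simp add: sphere_prob_def)
      show "AE x in Q t. cbackward \<gamma> ?c ?S (coh N i j) x = lindblad_rhs N \<kappa> \<gamma> (square N (\<lambda>k l. coh N k l x)) $$ (i, j)"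
        using ae by eventually_elim (rule cbackward_coh[OF _ ij])
      show "cbackward \<gamma> ?c ?S (coh N i j) \<in> borel_measurable (Q t)" using ci by simp
      show "(\<lambda>x. lindblad_rhs N \<kappa> \<gamma> (square N (\<lambda>k l. coh N k l x)) $$ (i, j)) \<in> borel_measurable (Q t)"
      proof -
        have "csmooth (\<lambda>x. spin_com N 1 (spin_anti N 1 (\<lambda>k l. coh N k l x)) i j)"
          "csmooth (\<lambda>x. spin_com N \<nu> (spin_com N \<nu> (\<lambda>k l. coh N k l x)) i j)" for \<nu>
          using csmooth_spin_com[of "\<lambda>k l x. spin_anti N 1 (\<lambda>k l. coh N k l x) k l" N 1 i j,
              OF csmooth_spin_anti[OF csmooth_coh]]
            csmooth_spin_com[of "\<lambda>k l x. spin_com N \<nu> (\<lambda>k l. coh N k l x) k l" N \<nu> i j,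
              OF csmooth_spin_com[OF csmooth_coh]]
          by simp_all
        then have "csmooth (\<lambda>x. lindblad_rhs N \<kappa> \<gamma> (square N (\<lambda>k l. coh N k l x)) $$ (i, j))"
          unfolding lindblad_rhs_square[OF ij] by (intro csmooth_diff csmooth_mult csmooth_add csmooth_const)
        then show ?thesis
          using sphere_prob_integrable_complex[OF spQ[OF t0]] by (blast intro: borel_measurable_integrable)
      qed
    qed
    also have "\<dots> = lindblad_rhs N \<kappa> \<gamma> (square N (J t)) $$ (i, j)"
      using integral_lindblad_rhs[OF i[OF t0] ij, of \<kappa> \<gamma>] by (simp add: J_def[abs_def])
    finally show ?thesis using D by simp
  qed
  have J_left: "((\<lambda>s. J s i j) \<longlongrightarrow> (\<integral>x. coh N i j x \<partial>\<mu> n 1)) (at_left (real (Suc n)))" for n i j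
  proof -
    note csm = csmooth_coh[of N i j, unfolded csmooth_def]
    have "((\<lambda>s. Complex (\<integral>x. Re (coh N i j x) \<partial>Q s) (\<integral>x. Im (coh N i j x) \<partial>Q s))
        \<longlongrightarrow> Complex (\<integral>x. Re (coh N i j x) \<partial>\<mu> n 1) (\<integral>x. Im (coh N i j x) \<partial>\<mu> n 1)) (at_left (real (Suc n)))"
      by (intro tendsto_Complex left_Q csm[THEN conjunct1] csm[THEN conjunct2])
    moreover have "Complex (\<integral>x. Re (coh N i j x) \<partial>\<mu> n 1) (\<integral>x. Im (coh N i j x) \<partial>\<mu> n 1) = (\<integral>x. coh N i j x \<partial>\<mu> n 1)"
      using sphere_prob_integrable_complex[OF sp[of 1 n] csmooth_coh[of N i j]] by (simp add: complex_eq_iff)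
    moreover have "\<forall>\<^sub>F s in at_left (real (Suc n)).
        Complex (\<integral>x. Re (coh N i j x) \<partial>Q s) (\<integral>x. Im (coh N i j x) \<partial>Q s) = J s i j"
    proof (rule eventually_mono[OF eventually_at_left_real[of "real n" "real (Suc n)"]])
      fix s assume "s \<in> {real n<..<real (Suc n)}"
      then have "s \<ge> 0" by (auto intro: order_trans[of 0 "real n"])
      then show "Complex (\<integral>x. Re (coh N i j x) \<partial>Q s) (\<integral>x. Im (coh N i j x) \<partial>Q s) = J s i j"
        using sphere_prob_integrable_complex[OF spQ csmooth_coh[of N i j]] by (simp add: J_def complex_eq_iff)
    qed simp
    ultimately show ?thesis by (simp only:) (rule Lim_transform_eventually)
  qed
  have \<rho>_car: "\<rho> t \<in> carrier_mat (Suc N) (Suc N)" if "t \<ge> 0" for t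
    using \<rho>(1) that by (simp add: lindblad_solution_def)
  have \<rho>_deriv: "((\<lambda>s. \<rho> s $$ (i, j)) has_vector_derivative lindblad_rhs N \<kappa> \<gamma> (square N (\<lambda>k l. \<rho> t $$ (k, l))) $$ (i, j))
      (at t within {real n..<real n + 1})"
    if t: "t \<in> {real n..<real n + 1}" and ij: "i \<le> N" "j \<le> N" for t n i j
  proof -
    have "t \<ge> 0" using t by (auto intro: order_trans[of 0 "real n"])
    then show ?thesis
      using \<rho>(1) t ij unfolding square_of_mat[OF \<rho>_car[OF \<open>t \<ge> 0\<close>]] lindblad_solution_def by blast
  qed
  \<comment> \<open>Uniqueness on one segment, given equality at its left end; the induction over
    the kicks supplies that equality.\<close>
  have step: "\<rho> t $$ (i, j) = J t i j"
    if init: "\<And>i j. i \<le> N \<Longrightarrow> j \<le> N \<Longrightarrow> \<rho> (real n) $$ (i, j) = J (real n) i j"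
      and t: "t \<in> {real n..<real n + 1}" and ij: "i \<le> N" "j \<le> N" for n t i j
  proof -
    obtain K where K: "K \<ge> 0" "\<And>F i j. i \<le> N \<Longrightarrow> j \<le> N \<Longrightarrow>
        cmod (lindblad_rhs N \<kappa> \<gamma> (square N F) $$ (i, j)) \<le> K * mat_l1 N F"
      using lindblad_rhs_bounded[of N \<kappa> \<gamma>] by blast
    let ?D = "\<lambda>ij t. \<rho> t $$ ij - J t (fst ij) (snd ij)"
    let ?D' = "\<lambda>ij t. lindblad_rhs N \<kappa> \<gamma> (square N (\<lambda>k l. ?D (k, l) t)) $$ ij"
    have "?D (i, j) t = 0"
    proof (rule linear_ode_zero[where I = "{..<Suc N} \<times> {..<Suc N}" and d = ?D and d' = ?D'
          and a = "real n" and b = "real n + 1" and K = K])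
      fix ij t assume ij: "ij \<in> {..<Suc N} \<times> {..<Suc N}" and t: "real n \<le> t" "t < real n + 1"
      then have ij': "fst ij \<le> N" "snd ij \<le> N" and t': "t \<in> {real n..<real n + 1}" by auto
      show "(?D ij has_vector_derivative ?D' ij t) (at t within {real n..<real n + 1})"
        using has_vector_derivative_diff[OF \<rho>_deriv[OF t' ij'] J_deriv[OF t' ij']]
        by (simp add: lindblad_rhs_diff[OF ij', unfolded prod.collapse])
      show "cmod (?D' ij t) \<le> K * (\<Sum>j\<in>{..<Suc N} \<times> {..<Suc N}. cmod (?D j t))"
        using K(2)[OF ij', of "\<lambda>k l. ?D (k, l) t"] by (simp add: mat_l1_def)
    next
      fix ij assume "ij \<in> {..<Suc N} \<times> {..<Suc N}"
      then show "?D ij (real n) = 0" using init[of "fst ij" "snd ij"] by auto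
    qed (use K(1) t ij in auto)
    then show ?thesis by simp
  qed
  have init: "\<rho> (real n) $$ (i, j) = J (real n) i j" if "i \<le> N" "j \<le> N" for n i j
    using that
  proof (induction n arbitrary: i j)
    case 0
    have "J 0 i j = coh N i j \<Omega>\<^sub>0"
      unfolding J_def using Qn[of 0 0] \<mu>0
      by (simp add: integral_return csmooth_borel_measurable[OF csmooth_coh])
    then show ?case using \<rho>(2) 0 by (simp add: coherent_proj_eq_coh[OF \<Omega>\<^sub>0])
  next
    case (Suc n)
    obtain \<sigma> where \<sigma>: "\<sigma> \<in> carrier_mat (N + 1) (N + 1)"
      "\<And>i j. i \<le> N \<Longrightarrow> j \<le> N \<Longrightarrow> ((\<lambda>s. \<rho> s $$ (i, j)) \<longlongrightarrow> \<sigma> $$ (i, j)) (at_left (real (Suc n)))"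
      "\<rho> (real (Suc n)) = kick_unitary N p * \<sigma> * mat_adjoint (kick_unitary N p)"
      using \<rho>(1) unfolding lindblad_solution_def by (metis le_add1 plus_1_eq_Suc)
    \<comment> \<open>Just before the kick both sides agree, hence so do their left limits. The
      unitary then multiplies the entries by the same phases that the rotation produces on the
      symbol.\<close>
    have \<sigma>_eq: "\<sigma> $$ (i, j) = (\<integral>x. coh N i j x \<partial>\<mu> n 1)" if ij: "i \<le> N" "j \<le> N" for i j
    proof (rule tendsto_unique[OF _ \<sigma>(2)[OF ij]])
      show "((\<lambda>s. \<rho> s $$ (i, j)) \<longlongrightarrow> (\<integral>x. coh N i j x \<partial>\<mu> n 1)) (at_left (real (Suc n)))"
        using J_left
      proof (rule Lim_transform_eventually)
        show "\<forall>\<^sub>F s in at_left (real (Suc n)). J s i j = \<rho> s $$ (i, j)"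
          using eventually_at_left_real[of "real n" "real (Suc n)"]
          by (auto elim!: eventually_mono simp: step[OF Suc.IH _ ij])
      qed
    qed simp
    have "J (real (Suc n)) i j = (\<integral>x. coh N i j x \<partial>distr (\<mu> n 1) borel (axis_rotate 3 p))"
      using Qn[of "real (Suc n)" "Suc n"] by (simp add: J_def \<mu>Suc)
    also have "\<dots> = (\<integral>x. coh N i j (axis_rotate 3 p x) \<partial>\<mu> n 1)"
      by (rule sphere_prob_distr_axis_rotate(2)[OF sp csmooth_borel_measurable[OF csmooth_coh]]) simp
    also have "\<dots> = (\<integral>x. kick_phase N p i * cnj (kick_phase N p j) * coh N i j x \<partial>\<mu> n 1)"
    proof (rule integral_cong_AE)
      have st: "sets (\<mu> n 1) = sets borel" and ae: "AE x in \<mu> n 1. x \<in> sphere 0 1"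
        using sp[of 1 n] by (simp_all add: sphere_prob_def)
      show "AE x in \<mu> n 1. coh N i j (axis_rotate 3 p x) = kick_phase N p i * cnj (kick_phase N p j) * coh N i j x"
        using ae by eventually_elim (rule coh_axis_rotate_kick[OF _ Suc.prems])
      have r: "axis_rotate 3 p \<in> borel_measurable borel"
        by (intro borel_measurable_continuous_onI linear_continuous_on bounded_linear_axis_rotate)
      show "(\<lambda>x. coh N i j (axis_rotate 3 p x)) \<in> borel_measurable (\<mu> n 1)"
        using measurable_compose[OF r csmooth_borel_measurable[OF csmooth_coh]]
        by (simp add: measurable_cong_sets[OF st refl])
      show "(\<lambda>x. kick_phase N p i * cnj (kick_phase N p j) * coh N i j x) \<in> borel_measurable (\<mu> n 1)"
        using csmooth_borel_measurable[OF csmooth_coh] by (simp add: measurable_cong_sets[OF st refl])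
    qed
    also have "\<dots> = kick_phase N p i * cnj (kick_phase N p j) * \<sigma> $$ (i, j)"
      unfolding \<sigma>_eq[OF Suc.prems] by simp
    also have "\<dots> = \<rho> (real (Suc n)) $$ (i, j)"
      unfolding \<sigma>(3) by (rule kick_conjugation_index[symmetric]) (use \<sigma>(1) Suc.prems in auto)
    finally show ?case ..
  qed
  have "positive_distribution (P t) \<and> \<rho> t = coherent_mixture N (P t)" if t: "t \<ge> 0" for t
  proof
    show "positive_distribution (P t)" unfolding P_def by (rule positive_distribution_restrict[OF spQ[OF t]])
    define n where "n = nat \<lfloor>t\<rfloor>"
    have tn: "t \<in> {real n..<real n + 1}" using t by (auto simp: n_def)
    show "\<rho> t = coherent_mixture N (P t)"
    proof (rule eq_matI)
      fix i j assume "i < dim_row (coherent_mixture N (P t))" "j < dim_col (coherent_mixture N (P t))"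
      then have ij: "i \<le> N" "j \<le> N" by (simp_all add: coherent_mixture_def)
      have "\<rho> t $$ (i, j) = J t i j" by (rule step[OF init tn ij])
      then show "\<rho> t $$ (i, j) = coherent_mixture N (P t) $$ (i, j)"
        unfolding P_def coherent_mixture_index[OF spQ[OF t] ij] J_def .
    qed (use \<rho>_car[OF t] in \<open>auto simp: coherent_mixture_def\<close>)
  qed
  with P0 weak show ?thesis by (intro exI[of _ P]) simp
qed

theorem theorem1:
  "\<exists>C::real. \<forall>(N::nat) (\<kappa>::real) (p::real) (\<gamma>::real).
     N \<ge> 1 \<and> \<gamma> \<ge> gamma_star N \<kappa> \<longrightarrow>
     (\<exists>(\<epsilon>::real) (\<delta>::real) (E :: 3 \<Rightarrow> 3 \<Rightarrow> real^3 \<Rightarrow> real).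
        \<bar>\<epsilon>\<bar> \<le> C / spin N \<and> \<bar>\<delta>\<bar> \<le> C / spin N \<and>
        (\<forall>\<mu> \<nu>. smooth (E \<mu> \<nu>) \<and>
           (\<forall>x\<in>sphere 0 (spin N). \<bar>E \<mu> \<nu> x\<bar> \<le> C * (gamma_star N \<kappa> / \<gamma>))) \<and>
        (\<forall>(\<Omega>\<^sub>0 :: real^3) (\<rho> :: real \<Rightarrow> complex mat).
           \<Omega>\<^sub>0 \<in> sphere 0 1 \<and> lindblad_solution N \<kappa> p \<gamma> \<rho> \<and> \<rho> 0 = coherent_proj N \<Omega>\<^sub>0 \<longrightarrow>
           (\<exists>P :: real \<Rightarrow> (real^3) measure.
              (\<forall>t\<ge>0. positive_distribution (P t) \<and> \<rho> t = coherent_mixture N (P t)) \<and>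
              P 0 = return unit_sphere \<Omega>\<^sub>0 \<and>
              weak_solution N (fp_rhs N \<kappa> \<gamma> \<epsilon> E) (H_kick ((1 + \<delta>) * p)) P)))"
\<comment> \<open>C = 1 suffices: 3 / 2 / (2 S + 1) is at most 1 / S, and the error entries are
  bounded by \<open>gamma_star N \<kappa> / \<gamma>\<close> itself. The kick is reproduced exactly,
  hence \<delta> = 0.\<close>
proof (rule exI[of _ 1], intro allI impI, elim conjE)
  fix N :: nat and \<kappa> p \<gamma> :: real
  assume N: "N \<ge> 1" and \<gamma>: "\<gamma> \<ge> gamma_star N \<kappa>"
  have S: "spin N > 0" using N by (simp add: spin_def)
  have "0 \<le> gamma_star N \<kappa>" using S by (simp add: gamma_star_def)
  then have \<gamma>0: "\<gamma> \<ge> 0" using \<gamma> by simp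
  let ?\<epsilon> = "3 / 2 / (2 * spin N + 1)"
  have \<epsilon>: "\<bar>?\<epsilon>\<bar> \<le> 1 / spin N" "\<bar>0 :: real\<bar> \<le> 1 / spin N" using S by (simp_all add: field_simps)
  have E: "smooth (relative_error N \<kappa> \<gamma> \<mu> \<nu>) \<and>
      (\<forall>x\<in>sphere 0 (spin N). \<bar>relative_error N \<kappa> \<gamma> \<mu> \<nu> x\<bar> \<le> 1 * (gamma_star N \<kappa> / \<gamma>))" for \<mu> \<nu>
    using smooth_relative_error relative_error_bound[OF N \<gamma>0] by simp
  have P: "\<exists>P :: real \<Rightarrow> (real^3) measure.
      (\<forall>t\<ge>0. positive_distribution (P t) \<and> \<rho> t = coherent_mixture N (P t)) \<and>
      P 0 = return unit_sphere \<Omega>\<^sub>0 \<and>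
      weak_solution N (fp_rhs N \<kappa> \<gamma> ?\<epsilon> (relative_error N \<kappa> \<gamma>)) (H_kick ((1 + 0) * p)) P"
    if "\<Omega>\<^sub>0 \<in> sphere 0 1 \<and> lindblad_solution N \<kappa> p \<gamma> \<rho> \<and> \<rho> 0 = coherent_proj N \<Omega>\<^sub>0" for \<Omega>\<^sub>0 \<rho>
    using kicked_evolution[OF N \<gamma>, of \<Omega>\<^sub>0 p \<rho>] that by simp
  show "\<exists>(\<epsilon>::real) (\<delta>::real) (E :: 3 \<Rightarrow> 3 \<Rightarrow> real^3 \<Rightarrow> real).
        \<bar>\<epsilon>\<bar> \<le> 1 / spin N \<and> \<bar>\<delta>\<bar> \<le> 1 / spin N \<and>
        (\<forall>\<mu> \<nu>. smooth (E \<mu> \<nu>) \<and>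
           (\<forall>x\<in>sphere 0 (spin N). \<bar>E \<mu> \<nu> x\<bar> \<le> 1 * (gamma_star N \<kappa> / \<gamma>))) \<and>
        (\<forall>(\<Omega>\<^sub>0 :: real^3) (\<rho> :: real \<Rightarrow> complex mat).
           \<Omega>\<^sub>0 \<in> sphere 0 1 \<and> lindblad_solution N \<kappa> p \<gamma> \<rho> \<and> \<rho> 0 = coherent_proj N \<Omega>\<^sub>0 \<longrightarrow>
           (\<exists>P :: real \<Rightarrow> (real^3) measure.
              (\<forall>t\<ge>0. positive_distribution (P t) \<and> \<rho> t = coherent_mixture N (P t)) \<and>
              P 0 = return unit_sphere \<Omega>\<^sub>0 \<and>
              weak_solution N (fp_rhs N \<kappa> \<gamma> \<epsilon> E) (H_kick ((1 + \<delta>) * p)) P))"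
    by (rule exI[of _ ?\<epsilon>], rule exI[of _ "0 :: real"], rule exI[of _ "relative_error N \<kappa> \<gamma>"])
      (intro conjI \<epsilon> allI E[THEN conjunct1] E[THEN conjunct2] impI, rule P)
qed

end
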